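(* Let $n\ge1$, $0<\alpha<n$ and $1<p\le q<\infty$ be such that $\Theta(\alpha):=\alpha+n\left(\frac1q-\frac1p\right)>0$ and $q<n/\Theta(\alpha)$. Let $v\in RH_\infty(\mathbb{R}^n)$ be such that $v^{-p'/p}\in A_\infty(\mathbb{R}^n)$, where $\frac1p+\frac1{p'}=1$, let $g\in L^1(\mathbb{R}^n)$, and set $$u:=\mathcal{M}(g)^{\Theta(\alpha)q/n}\,v^{q/p}.$$ Then $$\sup_Q|Q|^{\Theta(\alpha)/n}\left(\frac1{|Q|}\int_Q u\right)^{1/q}\left(\frac1{|Q|}\int_Q v^{-p'/p}\right)^{1/p'}\le C\,\|g\|_{L^1(\mathbb{R}^n)}^{\Theta(\alpha)/n}<\infty,$$ and, in particular, $$\left(\int_{\mathbb{R}^n}|I_\alpha(f)(x)|^q\,\mathcal{M}(g)(x)^{\Theta(\alpha)q/n}\,v(x)^{q/p}\,dx\right)^{1/q}\le C\,\|g\|_{L^1(\mathbb{R}^n)}^{\Theta(\alpha)/n}\left(\int_{\mathbb{R}^n}|f(x)|^p v(x)\,dx\right)^{1/p}$$ for every measurable $f$, where $C>0$ depends only on $n,\alpha,p,q,[v^{-p'/p}]_{A_\infty}$ and $[v]_{RH_\infty}$.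
   Context: $Q$ always denotes a cube in $\mathbb{R}^n$ with sides parallel to the coordinate axes, and suprema over $Q$ are over all such cubes. $\mathcal{M}(g)(x)=\sup_{Q\ni x}\frac1{|Q|}\int_Q|g|$ is the Hardy--Littlewood maximal function, and $I_\alpha(f)(x)=\int_{\mathbb{R}^n}\frac{f(y)}{|x-y|^{n-\alpha}}\,dy$. A weight is a function $w\in L^1_{\rm loc}(\mathbb{R}^n)$ with $w\ge0$ a.e.; $w\in A_\infty(\mathbb{R}^n)$ means $[w]_{A_\infty}:=\sup_Q\left(\frac1{|Q|}\int_Q w\right)\exp\left(-\frac1{|Q|}\int_Q\ln w\right)<\infty$; $w\in RH_\infty(\mathbb{R}^n)$ means $[w]_{RH_\infty}:=\sup_Q\left(\operatorname{ess\,sup}_Q w\right)\left(\frac1{|Q|}\int_Q w\right)^{-1}<\infty$. The weighted inequality is understood as trivially true when its right-hand side is infinite. *)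

theory Defs
  imports "HOL-Analysis.Analysis" "HOL-Probability.Essential_Supremum"
begin

text \<open>
  Weights and maximal functions take values in \<^typ>\<open>ennreal\<close>. A function that is nonnegative
  almost everywhere is such a function up to a null set, and negative powers, logarithms and
  suprema get their extended values: \<open>0\<close> to a negative power is \<open>\<infinity>\<close> and \<open>ln 0 = -\<infinity>\<close>,
  whereas for \<^typ>\<open>real\<close> both would be \<open>0\<close>.
\<close>

definition powr_ennreal :: "ennreal \<Rightarrow> real \<Rightarrow> ennreal" where
  "powr_ennreal x a =
    (if a = 0 then 1
     else if x = 0 then (if a > 0 then 0 else \<infinity>)
     else if x = \<infinity> then (if a > 0 then \<infinity> else 0)
     else ennreal (enn2real x powr a))"

definition ln_ennreal :: "ennreal \<Rightarrow> ereal" where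
  "ln_ennreal x = (if x = 0 then -\<infinity> else if x = \<infinity> then \<infinity> else ereal (ln (enn2real x)))"

definition exp_ereal :: "ereal \<Rightarrow> ennreal" where
  "exp_ereal x =
    (if x = -\<infinity> then 0 else if x = \<infinity> then \<infinity> else ennreal (exp (real_of_ereal x)))"

text \<open>
  The integral of the positive part minus that of the negative part; \<^const>\<open>e2ennreal\<close> sends
  negative arguments to \<open>0\<close>. In \<^typ>\<open>ereal\<close> one has \<open>\<infinity> - \<infinity> = \<infinity>\<close>.
\<close>

definition ereal_integral :: "'a measure \<Rightarrow> ('a \<Rightarrow> ereal) \<Rightarrow> ereal" where
  "ereal_integral M f =
    enn2ereal (\<integral>\<^sup>+x. e2ennreal (f x) \<partial>M) - enn2ereal (\<integral>\<^sup>+x. e2ennreal (- f x) \<partial>M)"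

definition cubes :: "(real^'n) set set" where
  "cubes = {cbox a (a + (\<chi> i. l)) | a l. 0 < l}"

definition average :: "(real^'n) set \<Rightarrow> (real^'n \<Rightarrow> ennreal) \<Rightarrow> ennreal" where
  "average Q w = (\<integral>\<^sup>+x\<in>Q. w x \<partial>lebesgue) / emeasure lebesgue Q"

definition maximal_function :: "(real^'n \<Rightarrow> real) \<Rightarrow> real^'n \<Rightarrow> ennreal" where
  "maximal_function g x = (SUP Q\<in>{Q\<in>cubes. x \<in> Q}. average Q (\<lambda>y. ennreal \<bar>g y\<bar>))"

text \<open>
  Infinite values are kept: where the integral does not converge absolutely, the absolute value
  of the potential is \<open>\<infinity>\<close> (the Bochner integral would give \<open>0\<close>).
\<close>

definition riesz_potential :: "real \<Rightarrow> (real^'n \<Rightarrow> real) \<Rightarrow> real^'n \<Rightarrow> ereal" where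
  "riesz_potential \<alpha> f x =
    ereal_integral lebesgue (\<lambda>y. ereal (f y / norm (x - y) powr (real CARD('n) - \<alpha>)))"

definition weight :: "(real^'n \<Rightarrow> ennreal) \<Rightarrow> bool" where
  "weight w \<longleftrightarrow> w \<in> borel_measurable lebesgue \<and>
    (\<forall>K. compact K \<longrightarrow> (\<integral>\<^sup>+x\<in>K. w x \<partial>lebesgue) < \<infinity>)"

definition A_infinity_const :: "(real^'n \<Rightarrow> ennreal) \<Rightarrow> ennreal" where
  "A_infinity_const w =
    (SUP Q\<in>cubes. average Q w *
      exp_ereal (- (ereal_integral (restrict_space lebesgue Q) (\<lambda>x. ln_ennreal (w x))
                     / ereal (measure lebesgue Q))))"

definition A_infinity :: "(real^'n \<Rightarrow> ennreal) set" where
  "A_infinity = {w. weight w \<and> A_infinity_const w < \<infinity>}"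

definition RH_infinity_const :: "(real^'n \<Rightarrow> ennreal) \<Rightarrow> ennreal" where
  "RH_infinity_const w =
    (SUP Q\<in>cubes. esssup (restrict_space lebesgue Q) w * inverse (average Q w))"

definition RH_infinity :: "(real^'n \<Rightarrow> ennreal) set" where
  "RH_infinity = {w. weight w \<and> RH_infinity_const w < \<infinity>}"

end

theory Submission
  imports Defs
begin

text \<open>
  With \<open>\<sigma> = v powr (- p' / p)\<close>, the two hypotheses say that \<open>\<sigma>\<close> is an \<open>A\<^sub>1\<close> weight: on a cube
  \<open>Q\<close>, the bound \<open>v \<le> \<kappa> m\<close> by the mean \<open>m\<close> of \<open>v\<close> gives \<open>\<sigma> \<ge> (\<kappa> m) powr (- p' / p)\<close> a.e.
  and \<open>v > m / 2\<close> on a fixed fraction of \<open>Q\<close>, so that the \<open>A\<^sub>\<infinity>\<close> condition bounds the mean of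
  \<open>\<sigma>\<close> by \<open>(m / 2) powr (- p' / p)\<close> up to a constant. The testing condition then is Kolmogorov's
  inequality for \<open>M(g)\<close>.

  For the potential, put \<open>F = v powr (1 / p)\<close> times the dyadic sum over \<open>k\<close> of
  \<open>2 powr (\<alpha> k)\<close> times the average of \<open>|f|\<close> over the cube of radius \<open>2 powr k\<close> at \<open>x\<close>. The function
  \<open>G = v powr (1 / p) M(f)\<close> is in \<open>L\<^sup>p\<close>, because \<open>M(f) \<le> A \<sigma> M\<^sub>\<sigma>(f / \<sigma>)\<close> and the maximal operator \<open>M\<^sub>\<sigma>\<close> of the
  doubling measure \<open>\<sigma> dx\<close> is bounded on \<open>L\<^sup>p(\<sigma>)\<close>. The \<open>k\<close>-th term of \<open>F\<close> is also bounded by a number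
  \<open>a\<^sub>k\<close>, independent of \<open>x\<close>, which \<open>G\<close> exceeds (up to a constant) on a set of measure at least
  \<open>2 powr (n k)\<close>; this makes \<open>2 powr (n k / p) a\<^sub>k\<close> summable in \<open>\<ell>\<^sup>p\<close>. Since \<open>M(g)\<close> lies only in weak
  \<open>L\<^sup>1\<close>, the sum is split at the scale \<open>r(x) = (N / M(g)(x)) powr (1 / n)\<close>, where \<open>N\<close> is the norm of
  \<open>g\<close>: the terms below it are controlled by \<open>G\<close>, the ones above it by the \<open>a\<^sub>k\<close> and Kolmogorov's inequality.
\<close>

section \<open>Extended powers and dyadic sums\<close>

text \<open>The weighted inequality is not deduced from the testing condition; both follow
  separately from the \<open>A_1\<close> property. It bounds the mean of \<open>\<sigma>\<close>
  over a cube by the value at almost every point of it, hence negative powers of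
  \<open>\<sigma>\<close>, that is, positive powers of \<open>v\<close>, at a point by those of a
  mean. As \<open>v = \<sigma> powr (1 - p)\<close>, the weight \<open>v powr (q / p)\<close> is
  absorbed into the \<open>q\<close>-th power of \<open>F\<close>, and only
  \<open>M(g) powr (\<Theta> * q / n)\<close> is left beside it. This power is critical: the near
  terms produce \<open>r powr (\<Theta> * q)\<close>, which cancels it up to a power of
  \<open>N\<close>. The far terms leave \<open>r powr (- \<epsilon> * q)\<close> and so raise the
  exponent of \<open>M(g)\<close> to \<open>\<delta> = (\<Theta> + \<epsilon>) * q / n\<close>.
  Kolmogorov's inequality needs \<open>\<delta> < 1\<close>; the assumption
  \<open>q < n / \<Theta>\<close> makes room for such an \<open>\<epsilon>\<close>. It is applied
  above the height \<open>N * 2 powr (- n * k)\<close>, because that is what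
  \<open>r(x) \<le> 2 powr k\<close> says about \<open>M(g)\<close>. The assumption
  \<open>p \<le> q\<close> permits interpolating the near terms between \<open>G\<close> and the
  numbers bounding the \<open>k\<close>-th terms, and passing from \<open>p\<close>-summability of
  these numbers to \<open>q\<close>-summability.\<close>

lemma powr_ennreal_0 [simp]: "powr_ennreal x 0 = 1"
  by (simp add: powr_ennreal_def)

lemma powr_ennreal_zero [simp]: "0 < a \<Longrightarrow> powr_ennreal 0 a = 0"
  by (simp add: powr_ennreal_def)

lemma powr_ennreal_top [simp]: "0 < a \<Longrightarrow> powr_ennreal top a = top"
  by (simp add: powr_ennreal_def)

lemma powr_ennreal_pos: "0 < x \<Longrightarrow> powr_ennreal (ennreal x) a = ennreal (x powr a)"
  by (simp add: powr_ennreal_def)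

lemma powr_ennreal_nonneg: "0 \<le> x \<Longrightarrow> 0 < a \<Longrightarrow> powr_ennreal (ennreal x) a = ennreal (x powr a)"
  by (cases "x = 0") (simp_all add: powr_ennreal_def)

lemma powr_ennreal_one [simp]: "powr_ennreal x 1 = x"
  by (cases x) (auto simp: powr_ennreal_def)

lemma powr_ennreal_mono: "0 \<le> a \<Longrightarrow> x \<le> y \<Longrightarrow> powr_ennreal x a \<le> powr_ennreal y a"
proof (cases "a = 0")
  case False
  assume "0 \<le> a" "x \<le> y"
  with False show ?thesis
    by (cases x; cases y) (auto simp: powr_ennreal_nonneg top_unique powr_mono2)
qed simp

lemma powr_ennreal_mult: "0 \<le> a \<Longrightarrow> powr_ennreal (x * y) a = powr_ennreal x a * powr_ennreal y a"
proof (cases "a = 0")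
  case False
  assume "0 \<le> a"
  with False have a: "0 < a" by simp
  show ?thesis
  proof (cases x; cases y)
    fix r s assume "x = ennreal r" "0 \<le> r" "y = ennreal s" "0 \<le> s"
    then show ?thesis using a by (simp add: powr_ennreal_nonneg powr_mult flip: ennreal_mult)
  qed (use a in \<open>auto simp: ennreal_mult_top ennreal_top_mult powr_ennreal_nonneg\<close>)
qed simp

lemma powr_ennreal_powr:
  "0 \<le> a \<Longrightarrow> 0 \<le> b \<Longrightarrow> powr_ennreal (powr_ennreal x a) b = powr_ennreal x (a * b)"
proof (cases "a = 0 \<or> b = 0")
  case True
  then show ?thesis using powr_ennreal_pos[of 1 b] by auto
next
  case False
  assume "0 \<le> a" "0 \<le> b"
  with False show ?thesis
    by (cases x) (auto simp: powr_ennreal_nonneg powr_powr)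
qed

lemma powr_ennreal_add:
  "0 \<le> a \<Longrightarrow> 0 \<le> b \<Longrightarrow> powr_ennreal x (a + b) = powr_ennreal x a * powr_ennreal x b"
proof (cases "a = 0 \<or> b = 0")
  case False
  assume "0 \<le> a" "0 \<le> b"
  with False show ?thesis
    by (cases x) (auto simp: powr_ennreal_nonneg powr_add ennreal_mult)
qed auto

lemma powr_ennreal_less_top: "0 \<le> a \<Longrightarrow> x < \<infinity> \<Longrightarrow> powr_ennreal x a < \<infinity>"
  by (cases "a = 0"; cases x) (auto simp: powr_ennreal_nonneg)

lemma powr_ennreal_add_le:
  assumes "0 \<le> a"
  shows "powr_ennreal (x + y) a \<le> ennreal (2 powr a) * (powr_ennreal x a + powr_ennreal y a)"
proof -
  have "powr_ennreal (x + y) a \<le> powr_ennreal (2 * max x y) a"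
    by (intro powr_ennreal_mono assms) (auto simp: max_def mult_2 add_mono)
  also have "\<dots> = ennreal (2 powr a) * powr_ennreal (max x y) a"
    using powr_ennreal_pos[of 2 a] by (simp add: powr_ennreal_mult assms)
  also have "\<dots> \<le> ennreal (2 powr a) * (powr_ennreal x a + powr_ennreal y a)"
    by (intro mult_left_mono) (auto simp: max_def add_increasing add_increasing2)
  finally show ?thesis .
qed

lemma borel_measurable_powr_ennreal [measurable (raw)]:
  assumes "f \<in> borel_measurable M"
  shows "(\<lambda>x. powr_ennreal (f x) a) \<in> borel_measurable M"
proof (rule measurable_compose[OF assms])
  have [measurable]: "(\<lambda>x. ennreal (enn2real x powr a)) \<in> borel_measurable borel"
    by (intro measurable_compose[OF _ measurable_ennreal] powr_real_measurable borel_measurable_enn2real) auto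
  have "{x::ennreal. x = 0} \<in> sets borel" "{x::ennreal. x = \<infinity>} \<in> sets borel"
    by (auto simp: borel_closed)
  then show "(\<lambda>x. powr_ennreal x a) \<in> borel_measurable borel"
    unfolding powr_ennreal_def by (intro measurable_If measurable_const) auto
qed

text \<open>Sums over all integers are written as integrals against counting measure, so that one
  Tonelli rule exchanges them with integrals in \<open>x\<close>. The sum here is a geometric series
  running downwards from the top index \<open>\<lfloor>log 2 r\<rfloor>\<close>.\<close>

lemma nn_integral_int_geometric_le:
  fixes \<beta> r :: real
  assumes "0 < \<beta>" "0 < r"
  shows "(\<integral>\<^sup>+k. ennreal (2 powr (\<beta> * real_of_int k)) * indicator {k. 2 powr real_of_int k \<le> r} k \<partial>count_space UNIV)
    \<le> ennreal (1 / (1 - 2 powr - \<beta>)) * ennreal (r powr \<beta>)"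
proof -
  define m where "m = \<lfloor>log 2 r\<rfloor>"
  have le: "2 powr real_of_int k \<le> r \<longleftrightarrow> k \<le> m" for k
    using assms by (simp add: m_def le_floor_iff powr_le_iff)
  have q: "0 < 2 powr - \<beta>" "2 powr - \<beta> < (1::real)"
    using assms powr_less_mono[of "-\<beta>" 0 2] by auto
  have bij: "bij_betw (\<lambda>i. m - int i) UNIV {..m}"
    by (rule bij_betwI[of _ _ _ "\<lambda>k. nat (m - k)"]) auto
  have "(\<integral>\<^sup>+k. ennreal (2 powr (\<beta> * real_of_int k)) * indicator {k. 2 powr real_of_int k \<le> r} k \<partial>count_space UNIV)
      = (\<integral>\<^sup>+k. ennreal (2 powr (\<beta> * real_of_int k)) * indicator {..m} k \<partial>count_space UNIV)"
    by (simp add: le atMost_def)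
  also have "\<dots> = (\<integral>\<^sup>+k. ennreal (2 powr (\<beta> * real_of_int k)) \<partial>count_space {..m})"
    by (subst nn_integral_count_space_indicator) auto
  also have "\<dots> = (\<integral>\<^sup>+i. ennreal (2 powr (\<beta> * real_of_int (m - int i))) \<partial>count_space UNIV)"
    by (subst nn_integral_bij_count_space[OF bij, symmetric]) auto
  also have "\<dots> = (\<Sum>i. ennreal (2 powr (\<beta> * real_of_int (m - int i))))"
    by (simp add: nn_integral_count_space_nat)
  also have "\<dots> = (\<Sum>i. ennreal (2 powr (\<beta> * m) * (2 powr - \<beta>) ^ i))"
  proof -
    have "2 powr (\<beta> * real_of_int (m - int i)) = 2 powr (\<beta> * m) * (2 powr - \<beta>) ^ i" for i
    proof -
      have "(2 powr - \<beta>) ^ i = 2 powr (- \<beta> * i)"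
        by (simp add: powr_powr flip: powr_realpow)
      then show ?thesis by (simp add: right_diff_distrib powr_diff powr_minus field_simps)
    qed
    then show ?thesis by simp
  qed
  also have "\<dots> = ennreal (2 powr (\<beta> * m) * (1 / (1 - 2 powr - \<beta>)))"
    using q by (intro suminf_ennreal_eq sums_mult geometric_sums) auto
  also have "\<dots> \<le> ennreal (r powr \<beta> * (1 / (1 - 2 powr - \<beta>)))"
  proof (intro ennreal_leI mult_right_mono)
    have "2 powr (\<beta> * m) = (2 powr m) powr \<beta>" by (simp add: powr_powr mult.commute)
    also have "\<dots> \<le> r powr \<beta>" using assms le[of m] by (intro powr_mono2) auto
    finally show "2 powr (\<beta> * m) \<le> r powr \<beta>" .
  qed (use q in auto)
  finally show ?thesis using q by (simp add: mult.commute flip: ennreal_mult)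
qed

lemma nn_integral_int_geometric_ge:
  fixes \<beta> r :: real
  assumes "0 < \<beta>" "0 < r"
  shows "(\<integral>\<^sup>+k. ennreal (2 powr (- \<beta> * real_of_int k)) * indicator {k. r \<le> 2 powr real_of_int k} k \<partial>count_space UNIV)
    \<le> ennreal (1 / (1 - 2 powr - \<beta>)) * ennreal (r powr - \<beta>)"
proof -
  have bij: "bij_betw (\<lambda>k::int. - k) UNIV UNIV"
    by (rule bij_betwI[of _ _ _ uminus]) auto
  have eq: "2 powr - real_of_int k \<ge> r \<longleftrightarrow> 2 powr real_of_int k \<le> 1 / r" for k
    using assms by (simp add: powr_minus field_simps)
  have "(\<integral>\<^sup>+k. ennreal (2 powr (- \<beta> * real_of_int k)) * indicator {k. r \<le> 2 powr real_of_int k} k \<partial>count_space UNIV)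
     = (\<integral>\<^sup>+k. ennreal (2 powr (\<beta> * real_of_int k)) * indicator {k. 2 powr real_of_int k \<le> 1 / r} k \<partial>count_space UNIV)"
    by (subst nn_integral_bij_count_space[OF bij, symmetric]) (simp add: indicator_def eq)
  also have "\<dots> \<le> ennreal (1 / (1 - 2 powr - \<beta>)) * ennreal ((1 / r) powr \<beta>)"
    using assms by (intro nn_integral_int_geometric_le) auto
  finally show ?thesis using assms by (simp add: powr_divide powr_minus_divide)
qed

text \<open>Upper half of a dyadic layer-cake formula: for finite positive \<open>z\<close> the
  single index with \<open>2 powr k < z \<le> 2 powr (k + 1)\<close> suffices. The strict inequality
  matches the open superlevel sets of maximal functions.\<close>

lemma powr_ennreal_le_dyadic:
  assumes "0 < a"
  shows "powr_ennreal z a \<le>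
    (\<integral>\<^sup>+k. ennreal (2 powr (a * (real_of_int k + 1))) * indicator {k. ennreal (2 powr real_of_int k) < z} k \<partial>count_space UNIV)"
    (is "_ \<le> ?R")
proof -
  have pt: "ennreal (2 powr (a * (real_of_int k + 1))) * indicator {k. ennreal (2 powr real_of_int k) < z} k \<le> ?R" for k
    by (rule nn_integral_ge_point) auto
  show ?thesis
  proof (cases z)
    case top
    have "ennreal x \<le> ?R" for x
    proof -
      \<comment> \<open>For \<open>z = top\<close> every index contributes, so it is enough that one
        term exceeds a given \<open>x\<close>; \<open>max x 1\<close> keeps the logarithm meaningful
        for \<open>x \<le> 0\<close>.\<close>
      define k where "k = \<lceil>log 2 (max x 1) / a\<rceil>"
      have "log 2 (max x 1) / a \<le> real_of_int k + 1" by (simp add: k_def) linarith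
      then have "log 2 (max x 1) \<le> a * (real_of_int k + 1)" using assms by (simp add: field_simps)
      then have "x \<le> 2 powr (a * (real_of_int k + 1))"
        by (simp add: log_le_iff)
      then have "ennreal x \<le> ennreal (2 powr (a * (real_of_int k + 1))) * indicator {k. ennreal (2 powr real_of_int k) < z} k"
        using top by (simp add: ennreal_leI)
      with pt show ?thesis by (rule order_trans[rotated])
    qed
    have "?R = top"
    proof (rule ccontr)
      assume "?R \<noteq> top"
      then obtain t where "0 \<le> t" "?R = ennreal t" by (cases ?R) auto
      with \<open>\<And>x. ennreal x \<le> ?R\<close>[of "t + 1"] show False by (simp del: ennreal_plus)
    qed
    then show ?thesis by simp
  next
    case (real r)
    show ?thesis
    proof (cases "r = 0")
      case True
      with real assms show ?thesis by simp
    next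
      case False
      with real have r: "0 < r" by simp
      \<comment> \<open>Ceiling minus one, not the floor: \<open>2 powr k < r\<close> must be strict
        even when \<open>r\<close> is a power of two.\<close>
      define k where "k = \<lceil>log 2 r\<rceil> - 1"
      have k: "real_of_int k < log 2 r" "log 2 r \<le> real_of_int k + 1" by (simp_all add: k_def) linarith+
      have "2 powr real_of_int k < r" using k r by (simp add: less_log_iff)
      moreover have "r powr a \<le> 2 powr (a * (real_of_int k + 1))"
      proof -
        have "r \<le> 2 powr (real_of_int k + 1)" using k r by (simp add: log_le_iff)
        then have "r powr a \<le> (2 powr (real_of_int k + 1)) powr a" using r assms by (intro powr_mono2) auto
        then show ?thesis by (simp add: powr_powr mult.commute)
      qed
      ultimately have "powr_ennreal z a \<le> ennreal (2 powr (a * (real_of_int k + 1))) * indicator {k. ennreal (2 powr real_of_int k) < z} k"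
        using real r by (simp add: powr_ennreal_pos ennreal_leI ennreal_less_iff)
      with pt show ?thesis by (rule order_trans[rotated])
    qed
  qed
qed

text \<open>Lower half of the layer-cake formula: the whole geometric series is comparable with its
  largest term.\<close>

lemma dyadic_le_powr_ennreal:
  assumes "0 < a"
  shows "(\<integral>\<^sup>+k. ennreal (2 powr (a * real_of_int k)) * indicator {k. ennreal (2 powr real_of_int k) \<le> z} k \<partial>count_space UNIV)
    \<le> ennreal (1 / (1 - 2 powr - a)) * powr_ennreal z a"
proof -
  have q: "2 powr - a < (1::real)"
    using assms powr_less_mono[of "-a" 0 2] by auto
  show ?thesis
  proof (cases z)
    case top
    then show ?thesis using assms q by (simp add: ennreal_mult_top)
  next
    case (real r)
    show ?thesis
    proof (cases "r = 0")
      case True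
      then have "{k. ennreal (2 powr real_of_int k) \<le> z} = {}" using real by (auto simp: ennreal_eq_0_iff)
      then show ?thesis by simp
    next
      case False
      with real have r: "0 < r" by simp
      then show ?thesis using nn_integral_int_geometric_le[OF assms r] real
        by (simp add: powr_ennreal_pos)
    qed
  qed
qed

section \<open>Maximal operators of doubling measures\<close>

text \<open>Corner and side, not centre and radius; the concentric triple of \<open>cube a l\<close>
  therefore appears as \<open>cube (a - (\<chi> i. l)) (3 * l)\<close>.\<close>

definition cube :: "real^'n \<Rightarrow> real \<Rightarrow> (real^'n) set" where
  "cube a l = cbox a (a + (\<chi> i. l))"

lemma mem_cube: "x \<in> cube a l \<longleftrightarrow> (\<forall>i. a $ i \<le> x $ i \<and> x $ i \<le> a $ i + l)"
  by (simp add: cube_def mem_box_cart)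

lemma cubes_eq: "cubes = {cube a l | a l. 0 < l}"
  by (simp add: cubes_def cube_def)

lemma compact_cube: "compact (cube a l)"
  by (simp add: cube_def compact_cbox)

lemma sets_cube [measurable]: "cube a l \<in> sets lebesgue"
  by (simp add: cube_def)

lemma emeasure_cube:
  assumes "0 < l"
  shows "emeasure lebesgue (cube (a :: real^'n) l) = ennreal (l powr real CARD('n))"
proof -
  have *: "b \<in> Basis \<Longrightarrow> a \<bullet> b \<le> (a + (\<chi> i. l)) \<bullet> b" for b
    using assms by (auto simp: Basis_vec_def inner_axis)
  have "emeasure lebesgue (cube a l) = emeasure lborel (cbox a (a + (\<chi> i. l)))"
    by (simp add: cube_def)
  also have "\<dots> = ennreal (\<Prod>b\<in>Basis. (a + (\<chi> i. l) - a) \<bullet> b)"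
    by (rule emeasure_lborel_cbox) (rule *)
  also have "(\<Prod>b\<in>Basis. (a + (\<chi> i. l) - a) \<bullet> b) = (\<Prod>b\<in>(Basis :: (real^'n) set). l)"
    by (intro prod.cong) (auto simp: Basis_vec_def inner_axis)
  also have "\<dots> = l powr real CARD('n)"
    using assms by (simp add: powr_realpow)
  finally show ?thesis .
qed

text \<open>As a simp rule it rewrites \<open>emeasure lebesgue\<close> through
  \<open>main_part\<close>, and \<open>emeasure_cube\<close> would no longer match.\<close>

declare emeasure_completion [simp del]

section \<open>Enlarged cubes and the finite Vitali covering\<close>

lemma subset_interior_cube:
  assumes "0 < \<delta>"
  shows "cube a l \<subseteq> interior (cube (a - (\<chi> i. \<delta>)) (l + 2 * \<delta>))"
proof
  fix x assume "x \<in> cube a l"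
  then have "a $ i - \<delta> < x $ i \<and> x $ i < a $ i - \<delta> + (l + 2 * \<delta>)" for i
    using assms by (simp add: mem_cube) (smt (verit))
  then show "x \<in> interior (cube (a - (\<chi> i. \<delta>)) (l + 2 * \<delta>))"
    by (simp add: cube_def interior_cbox mem_box_cart)
qed

text \<open>Greedy selection: a cube of maximal side is kept, all cubes meeting it are discarded
  since they lie in its triple, and the induction hypothesis treats the rest. Pairs
  \<open>(a, l)\<close> are selected instead of sets because the triple refers to the corner and the
  side.\<close>

lemma finite_Vitali_cubes:
  fixes F :: "((real^'n) \<times> real) set"
  assumes "finite F" "\<forall>p\<in>F. 0 < snd p"
  shows "\<exists>G\<subseteq>F. disjoint_family_on (\<lambda>(a, l). cube a l) G \<and>
    (\<Union>(a, l)\<in>F. cube a l) \<subseteq> (\<Union>(a, l)\<in>G. cube (a - (\<chi> i. l)) (3 * l))"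
  using assms
proof (induction F rule: finite_psubset_induct)
  case (psubset F)
  show ?case
  proof (cases "F = {}")
    case True
    then show ?thesis by (auto simp: disjoint_family_on_def)
  next
    case False
    define l0 where "l0 = Max (snd ` F)"
    have "l0 \<in> snd ` F" using False psubset.hyps by (simp add: l0_def)
    then obtain a0 where p0: "(a0, l0) \<in> F" by force
    have max: "l \<le> l0" if "(a, l) \<in> F" for a l
      using that psubset.hyps unfolding l0_def by (intro Max_ge) force+
    define F' where "F' = {(a, l) \<in> F. cube a l \<inter> cube a0 l0 = {}}"
    have "cube a0 l0 \<noteq> {}"
      using psubset.prems p0 by (auto simp: cube_def box_ne_empty Basis_vec_def inner_axis)
    then have "F' \<subset> F" using p0 by (auto simp: F'_def)
    moreover have "\<forall>p\<in>F'. 0 < snd p" using psubset.prems by (auto simp: F'_def)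
    ultimately obtain G where G: "G \<subseteq> F'" "disjoint_family_on (\<lambda>(a, l). cube a l) G"
      "(\<Union>(a, l)\<in>F'. cube a l) \<subseteq> (\<Union>(a, l)\<in>G. cube (a - (\<chi> i. l)) (3 * l))"
      using psubset.IH[of F'] by blast
    have "cube a l \<subseteq> (\<Union>(a, l)\<in>insert (a0, l0) G. cube (a - (\<chi> i. l)) (3 * l))" if "(a, l) \<in> F" for a l
    proof (cases "(a, l) \<in> F'")
      case True
      then have "cube a l \<subseteq> (\<Union>(a, l)\<in>F'. cube a l)" by auto
      also note G(3)
      finally show ?thesis by auto
    next
      case False
      with that obtain z where z: "z \<in> cube a l" "z \<in> cube a0 l0" by (auto simp: F'_def)
      have "x \<in> cube (a0 - (\<chi> i. l0)) (3 * l0)" if "x \<in> cube a l" for x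
      proof -
        have "a0 $ i - l0 \<le> x $ i \<and> x $ i \<le> a0 $ i - l0 + 3 * l0" for i
        proof -
          have "a $ i \<le> x $ i" "x $ i \<le> a $ i + l" "a $ i \<le> z $ i" "z $ i \<le> a $ i + l"
            "a0 $ i \<le> z $ i" "z $ i \<le> a0 $ i + l0" "l \<le> l0"
            using that z max[OF \<open>(a, l) \<in> F\<close>] by (auto simp: mem_cube)
          then show ?thesis by linarith
        qed
        then show ?thesis by (simp add: mem_cube)
      qed
      then show ?thesis by auto
    qed
    moreover have "disjoint_family_on (\<lambda>(a, l). cube a l) (insert (a0, l0) G)"
    proof -
      have "(a0, l0) \<notin> G" using G(1) \<open>cube a0 l0 \<noteq> {}\<close> by (auto simp: F'_def)
      moreover have "cube a0 l0 \<inter> cube a l = {}" if "(a, l) \<in> G" for a l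
        using that G(1) by (auto simp: F'_def)
      then have "cube a0 l0 \<inter> (\<Union>(a, l)\<in>G. cube a l) = {}" by auto
      ultimately show ?thesis using G(2) by (simp add: disjoint_family_on_insert)
    qed
    ultimately show ?thesis
      using G(1) p0 by (intro exI[of _ "insert (a0, l0) G"]) (auto simp: F'_def)
  qed
qed

text \<open>The measure is a parameter so that one theory serves both Lebesgue measure, for
  \<open>M(f)\<close> and \<open>M(g)\<close>, and the measure with density
  \<open>\<sigma>\<close>.\<close>

definition weighted_maximal :: "(real^'n) measure \<Rightarrow> (real^'n \<Rightarrow> ennreal) \<Rightarrow> real^'n \<Rightarrow> ennreal" where
  "weighted_maximal \<mu> h x = (SUP Q\<in>{Q\<in>cubes. x \<in> Q}. (\<integral>\<^sup>+y\<in>Q. h y \<partial>\<mu>) / emeasure \<mu> Q)"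

section \<open>Maximal operators: superlevel sets, weak type and strong type\<close>

lemma maximal_function_eq:
  "maximal_function g = weighted_maximal lebesgue (\<lambda>y. ennreal \<bar>g y\<bar>)"
  by (simp add: maximal_function_def weighted_maximal_def average_def fun_eq_iff)

lemma average_le_weighted_maximal:
  "0 < l \<Longrightarrow> x \<in> cube a l \<Longrightarrow>
    (\<integral>\<^sup>+y\<in>cube a l. h y \<partial>\<mu>) / emeasure \<mu> (cube a l) \<le> weighted_maximal \<mu> h x"
  unfolding weighted_maximal_def cubes_eq by (intro SUP_upper) auto

lemma weighted_maximal_least:
  "(\<And>a l. 0 < l \<Longrightarrow> x \<in> cube a l \<Longrightarrow> (\<integral>\<^sup>+y\<in>cube a l. h y \<partial>\<mu>) / emeasure \<mu> (cube a l) \<le> B) \<Longrightarrow>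
    weighted_maximal \<mu> h x \<le> B"
  unfolding weighted_maximal_def cubes_eq by (intro SUP_least) auto

text \<open>Doubling is stated for triples, the form that the Vitali selection consumes. Positive
  and finite measure of cubes makes the averages genuine quotients, so that inequalities between
  them can be cleared of denominators.\<close>

locale doubling_measure =
  fixes \<mu> :: "(real^'n) measure" and D :: real
  assumes sets_eq: "sets \<mu> = sets lebesgue"
    and emeasure_cube_pos: "\<And>a l. 0 < l \<Longrightarrow> 0 < emeasure \<mu> (cube a l)"
    and emeasure_cube_finite: "\<And>a l. emeasure \<mu> (cube a l) < \<infinity>"
    and doubling: "\<And>a l. 0 < l \<Longrightarrow>
      emeasure \<mu> (cube (a - (\<chi> i. l)) (3 * l)) \<le> ennreal D * emeasure \<mu> (cube a l)"
begin

lemma sets_cube' [measurable, simp]: "cube a l \<in> sets \<mu>"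
  by (simp add: sets_eq)

lemma space_eq: "space \<mu> = UNIV"
  using sets_eq_imp_space_eq[OF sets_eq] by simp

lemma less_average_iff:
  assumes "0 < l"
  shows "t < (\<integral>\<^sup>+y\<in>cube a l. h y \<partial>\<mu>) / emeasure \<mu> (cube a l) \<longleftrightarrow>
    t * emeasure \<mu> (cube a l) < (\<integral>\<^sup>+y\<in>cube a l. h y \<partial>\<mu>)"
proof -
  let ?b = "emeasure \<mu> (cube a l)" and ?I = "\<integral>\<^sup>+y\<in>cube a l. h y \<partial>\<mu>"
  have b: "?b \<noteq> 0" "?b \<noteq> top"
    using emeasure_cube_pos[OF assms, of a] emeasure_cube_finite[of a l] by auto
  have "?b * (?I / ?b) = ?I"
    using b mult_divide_eq_ennreal[of ?b ?I] by (simp add: ennreal_times_divide mult.commute)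
  then have "?I / ?b \<le> t \<longleftrightarrow> ?I \<le> t * ?b"
    using ennreal_mult_le_mult_iff[OF b, of "?I / ?b" t] by (simp add: mult.commute)
  then show ?thesis by (simp add: not_le[symmetric])
qed

text \<open>By continuity of the measure from above, an average exceeding \<open>t\<close> on a
  closed cube still does so on a slightly larger cube, whose interior contains the first. Openness
  of superlevel sets, and with it measurability of the maximal function, follows for arbitrary
  \<open>h\<close>.\<close>

lemma superlevel_eq:
  "{x. ennreal t < weighted_maximal \<mu> h x} =
    (\<Union>(a, l)\<in>{(a, l). 0 < l \<and> ennreal t * emeasure \<mu> (cube a l) < (\<integral>\<^sup>+y\<in>cube a l. h y \<partial>\<mu>)}. interior (cube a l))"
    (is "?L = ?R")
proof (intro set_eqI iffI)
  fix x assume "x \<in> ?L"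
  then obtain a l where al: "0 < l" "x \<in> cube a l"
    "ennreal t * emeasure \<mu> (cube a l) < (\<integral>\<^sup>+y\<in>cube a l. h y \<partial>\<mu>)"
    by (auto simp: weighted_maximal_def less_SUP_iff cubes_eq less_average_iff)
  define \<delta> :: "nat \<Rightarrow> real" where "\<delta> m = 1 / real (Suc m)" for m
  define Q where "Q m = cube (a - (\<chi> i. \<delta> m)) (l + 2 * \<delta> m)" for m
  have \<delta>: "0 < \<delta> m" for m by (simp add: \<delta>_def)
  have "decseq Q"
    unfolding decseq_def
  proof (intro allI impI subsetI)
    fix m m' x assume "m \<le> m'" and x: "x \<in> Q m'"
    then have "\<delta> m' \<le> \<delta> m" by (simp add: \<delta>_def frac_le)
    moreover have "a $ i - \<delta> m' \<le> x $ i \<and> x $ i \<le> a $ i - \<delta> m' + (l + 2 * \<delta> m')" for i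
      using x by (simp add: Q_def mem_cube)
    ultimately show "x \<in> Q m" by (simp add: Q_def mem_cube) (smt (verit))
  qed
  have "(\<Inter>m. Q m) = cube a l"
  proof (intro set_eqI iffI)
    fix y assume y: "y \<in> (\<Inter>m. Q m)"
    have lim: "\<delta> \<longlonglongrightarrow> 0" unfolding \<delta>_def by (rule LIMSEQ_Suc[OF lim_1_over_n])
    have "a $ i \<le> y $ i" for i
    proof (rule LIMSEQ_le_const2)
      show "(\<lambda>m. a $ i - \<delta> m) \<longlonglongrightarrow> a $ i" using tendsto_diff[OF tendsto_const lim, of "a $ i"] by simp
    qed (use y in \<open>auto simp: Q_def mem_cube\<close>)
    moreover have "y $ i \<le> a $ i + l" for i
    proof (rule LIMSEQ_le_const)
      show "(\<lambda>m. a $ i + l + \<delta> m) \<longlonglongrightarrow> a $ i + l" using tendsto_add[OF tendsto_const lim, of "a $ i + l"] by simp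
      have "y $ i \<le> a $ i - \<delta> m + (l + 2 * \<delta> m)" for m using y by (auto simp: Q_def mem_cube)
      then show "\<exists>N. \<forall>m\<ge>N. y $ i \<le> a $ i + l + \<delta> m" by (auto simp: algebra_simps)
    qed
    ultimately show "y \<in> cube a l" by (simp add: mem_cube)
  next
    fix y assume "y \<in> cube a l"
    then have "cube a l \<subseteq> Q m" for m
      using subset_interior_cube[OF \<delta>] interior_subset unfolding Q_def by blast
    with \<open>y \<in> cube a l\<close> show "y \<in> (\<Inter>m. Q m)" by blast
  qed
  moreover have "range Q \<subseteq> sets \<mu>" "emeasure \<mu> (Q m) \<noteq> \<infinity>" for m
    using emeasure_cube_finite by (auto simp: Q_def less_top)
  ultimately have "(\<lambda>m. emeasure \<mu> (Q m)) \<longlonglongrightarrow> emeasure \<mu> (cube a l)"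
    using Lim_emeasure_decseq[of Q \<mu>] \<open>decseq Q\<close> by simp
  then have "(\<lambda>m. ennreal t * emeasure \<mu> (Q m)) \<longlonglongrightarrow> ennreal t * emeasure \<mu> (cube a l)"
    by (intro ennreal_tendsto_cmult) auto
  from order_tendstoD(2)[OF this al(3)]
  obtain m where m: "ennreal t * emeasure \<mu> (Q m) < (\<integral>\<^sup>+y\<in>cube a l. h y \<partial>\<mu>)"
    by (auto simp: eventually_sequentially)
  \<comment> \<open>Only the measure of the cube needed the limit; the integral merely grows with
    the cube.\<close>
  have sub: "cube a l \<subseteq> interior (Q m)"
    unfolding Q_def by (rule subset_interior_cube[OF \<delta>])
  then have "(\<integral>\<^sup>+y\<in>cube a l. h y \<partial>\<mu>) \<le> (\<integral>\<^sup>+y\<in>Q m. h y \<partial>\<mu>)"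
    using interior_subset by (intro nn_integral_mono) (auto simp: indicator_def)
  with m have "ennreal t * emeasure \<mu> (Q m) < (\<integral>\<^sup>+y\<in>Q m. h y \<partial>\<mu>)" by (rule less_le_trans)
  then show "x \<in> ?R" using sub al \<delta>[of m]
    by (intro UN_I[of "(a - (\<chi> i. \<delta> m), l + 2 * \<delta> m)"]) (auto simp: Q_def)
next
  fix x assume "x \<in> ?R"
  then obtain a l where al: "0 < l" "x \<in> cube a l"
    "ennreal t * emeasure \<mu> (cube a l) < (\<integral>\<^sup>+y\<in>cube a l. h y \<partial>\<mu>)"
    using interior_subset by fastforce
  then have "ennreal t < (\<integral>\<^sup>+y\<in>cube a l. h y \<partial>\<mu>) / emeasure \<mu> (cube a l)"
    by (simp add: less_average_iff)
  with average_le_weighted_maximal[OF al(1,2)] show "x \<in> ?L" by (auto intro: less_le_trans)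
qed

lemma open_superlevel: "open {x. ennreal t < weighted_maximal \<mu> h x}"
  unfolding superlevel_eq by auto

lemma sets_superlevel: "{x. ennreal t < weighted_maximal \<mu> h x} \<in> sets \<mu>"
  using open_superlevel[of t h] by (auto simp: sets_eq)

lemma borel_measurable_weighted_maximal [measurable]: "weighted_maximal \<mu> h \<in> borel_measurable lebesgue"
proof (rule borel_measurableI_greater)
  fix y :: ennreal
  show "{x \<in> space lebesgue. y < weighted_maximal \<mu> h x} \<in> sets lebesgue"
  proof (cases y)
    case (real r)
    then show ?thesis using open_superlevel[of r h] by simp
  qed simp
qed

text \<open>The Vitali selection handles finite families of cubes with large average; Lindelof's
  theorem extracts countably many of their interiors that still cover the superlevel set, and finite
  unions exhaust these.\<close>

lemma weak_type:
  assumes [measurable]: "h \<in> borel_measurable lebesgue"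
  shows "ennreal t * emeasure \<mu> {x. ennreal t < weighted_maximal \<mu> h x} \<le> ennreal D * (\<integral>\<^sup>+x. h x \<partial>\<mu>)"
proof -
  define S where "S = {(a, l). 0 < l \<and> ennreal t * emeasure \<mu> (cube a l) < (\<integral>\<^sup>+y\<in>cube a l. h y \<partial>\<mu>)}"
  have [measurable]: "h \<in> borel_measurable \<mu>" using assms measurable_cong_sets[OF sets_eq refl] by blast
  have fin: "ennreal t * emeasure \<mu> (\<Union>(a, l)\<in>F. cube a l) \<le> ennreal D * (\<integral>\<^sup>+x. h x \<partial>\<mu>)"
    if F: "finite F" "F \<subseteq> S" for F
  proof -
    have "\<forall>p\<in>F. 0 < snd p" using F by (auto simp: S_def)
    from finite_Vitali_cubes[OF F(1) this]
    obtain G where G: "G \<subseteq> F" "disjoint_family_on (\<lambda>(a, l). cube a l) G"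
      "(\<Union>(a, l)\<in>F. cube a l) \<subseteq> (\<Union>(a, l)\<in>G. cube (a - (\<chi> i. l)) (3 * l))"
      by (elim exE conjE)
    then have fG: "finite G" using F finite_subset by auto
    have "emeasure \<mu> (\<Union>(a, l)\<in>F. cube a l) \<le> emeasure \<mu> (\<Union>(a, l)\<in>G. cube (a - (\<chi> i. l)) (3 * l))"
      using fG by (intro emeasure_mono G) auto
    also have "\<dots> \<le> (\<Sum>(a, l)\<in>G. emeasure \<mu> (cube (a - (\<chi> i. l)) (3 * l)))"
      unfolding case_prod_beta by (rule emeasure_subadditive_finite[OF fG]) auto
    also have "\<dots> \<le> (\<Sum>(a, l)\<in>G. ennreal D * emeasure \<mu> (cube a l))"
      using G F by (intro sum_mono) (auto simp: S_def intro!: doubling)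
    finally have "ennreal t * emeasure \<mu> (\<Union>(a, l)\<in>F. cube a l) \<le> ennreal t * (\<Sum>(a, l)\<in>G. ennreal D * emeasure \<mu> (cube a l))"
      by (rule mult_left_mono) simp
    also have "\<dots> = ennreal D * (\<Sum>(a, l)\<in>G. ennreal t * emeasure \<mu> (cube a l))"
      by (simp add: sum_distrib_left case_prod_beta mult_ac)
    also have "\<dots> \<le> ennreal D * (\<Sum>(a, l)\<in>G. emeasure (density \<mu> h) (cube a l))"
      using G F by (intro mult_left_mono sum_mono) (auto simp: S_def emeasure_density)
    \<comment> \<open>Here disjointness enters: read as measures of the selected cubes with density
      \<open>h\<close>, the integrals add up to at most the total integral.\<close>
    also have "(\<Sum>(a, l)\<in>G. emeasure (density \<mu> h) (cube a l)) = emeasure (density \<mu> h) (\<Union>(a, l)\<in>G. cube a l)"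
      using G(2) fG unfolding case_prod_beta by (intro sum_emeasure) auto
    also have "\<dots> \<le> emeasure (density \<mu> h) (space \<mu>)"
      by (rule order_trans[OF emeasure_space]) simp
    also have "\<dots> = (\<integral>\<^sup>+x. h x \<partial>\<mu>)"
      by (subst emeasure_density) (auto intro!: nn_integral_cong)
    finally show ?thesis by (simp add: mult_left_mono)
  qed
  obtain \<F> where \<F>: "\<F> \<subseteq> (\<lambda>(a, l). interior (cube a l)) ` S" "countable \<F>"
    "\<Union>\<F> = (\<Union>(a, l)\<in>S. interior (cube a l))"
  proof (rule Lindelof[of "(\<lambda>(a, l). interior (cube a l)) ` S"])
    show "open A" if "A \<in> (\<lambda>(a, l). interior (cube a l)) ` S" for A
      using that by auto
  qed (rule that)
  obtain C where C: "C \<subseteq> S" "countable C" "\<F> = (\<lambda>(a, l). interior (cube a l)) ` C"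
    using countable_subset_image[of \<F> "\<lambda>(a, l). interior (cube a l)" S] \<F> by auto
  show ?thesis
  proof (cases "C = {}")
    case True
    then have "\<Union>\<F> = {}" using C(3) by simp
    then have "{x. ennreal t < weighted_maximal \<mu> h x} = {}"
      unfolding superlevel_eq S_def[symmetric] \<F>(3) .
    then show ?thesis by (simp only: emeasure_empty mult_zero_right zero_le)
  next
    case False
    define e where "e = from_nat_into C"
    have e: "range e = C" unfolding e_def using False C by (simp add: range_from_nat_into)
    define U where "U m = (\<Union>n\<le>m. cube (fst (e n)) (snd (e n)))" for m :: nat
    have U: "U m \<in> sets \<mu>" for m by (auto simp: U_def)
    have "{x. ennreal t < weighted_maximal \<mu> h x} \<subseteq> (\<Union>m. U m)"
    proof
      fix x assume "x \<in> {x. ennreal t < weighted_maximal \<mu> h x}"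
      then have "x \<in> \<Union>\<F>" unfolding superlevel_eq S_def[symmetric] \<F>(3) .
      then obtain a l where al: "(a, l) \<in> C" "x \<in> interior (cube a l)" unfolding C(3) by auto
      then obtain m where "e m = (a, l)" using e by (metis rangeE)
      with al show "x \<in> (\<Union>m. U m)"
        using interior_subset[of "cube a l"] unfolding U_def by (intro UN_I[of m]) auto
    qed
    then have "ennreal t * emeasure \<mu> {x. ennreal t < weighted_maximal \<mu> h x} \<le> ennreal t * emeasure \<mu> (\<Union>m. U m)"
      using U by (intro mult_left_mono emeasure_mono) auto
    also have "\<dots> = ennreal t * (SUP m. emeasure \<mu> (U m))"
      using U by (subst SUP_emeasure_incseq) (auto simp: U_def incseq_def intro: order_trans)
    also have "\<dots> = (SUP m. ennreal t * emeasure \<mu> (U m))"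
      by (rule SUP_mult_left_ennreal)
    also have "\<dots> \<le> ennreal D * (\<integral>\<^sup>+x. h x \<partial>\<mu>)"
    proof (rule SUP_least)
      fix m
      have "U m = (\<Union>(a, l)\<in>e ` {..m}. cube a l)" by (simp add: U_def case_prod_beta)
      then show "ennreal t * emeasure \<mu> (U m) \<le> ennreal D * (\<integral>\<^sup>+x. h x \<partial>\<mu>)"
        using fin[of "e ` {..m}"] e C(1) by (metis finite_atMost finite_imageI image_mono subset_UNIV subset_trans)
    qed
    finally show ?thesis .
  qed
qed

lemma weak_type_truncated:
  assumes [measurable]: "h \<in> borel_measurable lebesgue" and t: "0 < t"
  shows "emeasure \<mu> {x. ennreal (2 * t) < weighted_maximal \<mu> h x} \<le>
    ennreal (D / t) * (\<integral>\<^sup>+x\<in>{x. ennreal t \<le> h x}. h x \<partial>\<mu>)"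
proof -
  let ?h = "\<lambda>x. h x * indicator {x. ennreal t \<le> h x} x"
  have [measurable]: "h \<in> borel_measurable \<mu>" using assms measurable_cong_sets[OF sets_eq refl] by blast
  have "{x. ennreal (2 * t) < weighted_maximal \<mu> h x} \<subseteq> {x. ennreal t < weighted_maximal \<mu> ?h x}"
  proof safe
    fix x assume "ennreal (2 * t) < weighted_maximal \<mu> h x"
    then obtain a l where al: "0 < l" "x \<in> cube a l"
      "ennreal (2 * t) * emeasure \<mu> (cube a l) < (\<integral>\<^sup>+y\<in>cube a l. h y \<partial>\<mu>)"
      by (auto simp: weighted_maximal_def less_SUP_iff cubes_eq less_average_iff)
    have "ennreal t * emeasure \<mu> (cube a l) + ennreal t * emeasure \<mu> (cube a l) = ennreal (2 * t) * emeasure \<mu> (cube a l)"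
    proof -
      have "ennreal (2 * t) = ennreal t + ennreal t" using t by (simp flip: ennreal_plus)
      then show ?thesis by (simp add: distrib_right)
    qed
    also note al(3)
    also have "(\<integral>\<^sup>+y\<in>cube a l. h y \<partial>\<mu>) \<le> (\<integral>\<^sup>+y. ?h y * indicator (cube a l) y + ennreal t * indicator (cube a l) y \<partial>\<mu>)"
      by (intro nn_integral_mono) (auto simp: indicator_def)
    also have "\<dots> = (\<integral>\<^sup>+y\<in>cube a l. ?h y \<partial>\<mu>) + ennreal t * emeasure \<mu> (cube a l)"
      by (subst nn_integral_add) (auto simp: nn_integral_cmult_indicator)
    finally have "ennreal t * emeasure \<mu> (cube a l) < (\<integral>\<^sup>+y\<in>cube a l. ?h y \<partial>\<mu>)"
      by (meson add_right_mono leD not_le_imp_less)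
    then have "ennreal t < (\<integral>\<^sup>+y\<in>cube a l. ?h y \<partial>\<mu>) / emeasure \<mu> (cube a l)"
      using al by (simp add: less_average_iff)
    with average_le_weighted_maximal[OF al(1,2)] show "ennreal t < weighted_maximal \<mu> ?h x"
      by (auto intro: less_le_trans)
  qed
  then have "emeasure \<mu> {x. ennreal (2 * t) < weighted_maximal \<mu> h x} \<le> emeasure \<mu> {x. ennreal t < weighted_maximal \<mu> ?h x}"
    by (intro emeasure_mono sets_superlevel)
  also have "\<dots> = ennreal (1 / t) * (ennreal t * emeasure \<mu> {x. ennreal t < weighted_maximal \<mu> ?h x})"
    using t by (simp add: mult.assoc[symmetric] flip: ennreal_mult)
  also have "\<dots> \<le> ennreal (1 / t) * (ennreal D * (\<integral>\<^sup>+x. ?h x \<partial>\<mu>))"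
    by (intro mult_left_mono weak_type) measurable
  also have "\<dots> = ennreal (D / t) * (\<integral>\<^sup>+x. ?h x \<partial>\<mu>)"
    using t by (simp add: mult.assoc[symmetric] flip: ennreal_mult')
  finally show ?thesis .
qed

text \<open>Marcinkiewicz interpolation in dyadic form: layer cake for the maximal function, the
  truncated weak bound at each level, then summation over the levels first. The trivial bound at
  infinity is contained in the truncation.\<close>

lemma strong_type:
  assumes [measurable]: "h \<in> borel_measurable lebesgue" and p: "1 < p"
  shows "(\<integral>\<^sup>+x. powr_ennreal (weighted_maximal \<mu> h x) p \<partial>\<mu>) \<le>
    ennreal (D * 4 powr p / (1 - 2 powr (1 - p))) * (\<integral>\<^sup>+x. powr_ennreal (h x) p \<partial>\<mu>)"
proof -
  let ?M = "weighted_maximal \<mu> h" and ?q = "1 / (1 - 2 powr (1 - p)) :: real"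
  have [measurable]: "h \<in> borel_measurable \<mu>" "?M \<in> borel_measurable \<mu>"
    using assms borel_measurable_weighted_maximal measurable_cong_sets[OF sets_eq refl] by blast+
  have q: "2 powr (1 - p) < (1::real)" using p powr_less_mono[of "1 - p" 0 2] by auto
  have "(\<integral>\<^sup>+x. powr_ennreal (?M x) p \<partial>\<mu>) \<le> (\<integral>\<^sup>+x. \<integral>\<^sup>+k. ennreal (2 powr (p * (real_of_int k + 1))) *
      indicator {k. ennreal (2 powr real_of_int k) < ?M x} k \<partial>count_space UNIV \<partial>\<mu>)"
    using p by (intro nn_integral_mono powr_ennreal_le_dyadic) auto
  also have "\<dots> = (\<integral>\<^sup>+k. \<integral>\<^sup>+x. ennreal (2 powr (p * (real_of_int k + 1))) *
      indicator {x. ennreal (2 powr real_of_int k) < ?M x} x \<partial>\<mu> \<partial>count_space UNIV)"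
    by (subst nn_integral_count_space_nn_integral[symmetric]) (simp_all add: indicator_def)
  also have "\<dots> = (\<integral>\<^sup>+k. ennreal (2 powr (p * (real_of_int k + 1))) *
      emeasure \<mu> {x. ennreal (2 powr real_of_int k) < ?M x} \<partial>count_space UNIV)"
    by (intro nn_integral_cong nn_integral_cmult_indicator sets_superlevel)
  also have "\<dots> \<le> (\<integral>\<^sup>+k. ennreal (2 powr (p * (real_of_int k + 1))) * (ennreal (D / (2 powr (real_of_int k - 1))) *
      (\<integral>\<^sup>+x\<in>{x. ennreal (2 powr (real_of_int k - 1)) \<le> h x}. h x \<partial>\<mu>)) \<partial>count_space UNIV)"
  proof (intro nn_integral_mono mult_left_mono)
    fix k :: int
    show "emeasure \<mu> {x. ennreal (2 powr real_of_int k) < ?M x} \<le> ennreal (D / (2 powr (real_of_int k - 1))) *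
      (\<integral>\<^sup>+x\<in>{x. ennreal (2 powr (real_of_int k - 1)) \<le> h x}. h x \<partial>\<mu>)"
      using weak_type_truncated[OF assms(1), of "2 powr (real_of_int k - 1)"]
      by (simp add: powr_diff)
  qed simp
  \<comment> \<open>Level \<open>2 powr k\<close> truncates at \<open>2 powr (k - 1)\<close>, so for
    fixed \<open>x\<close> the index runs over \<open>2 powr k \<le> 2 * h x\<close>. One power of
    \<open>2 powr k\<close> is lost to the weak bound; the remaining exponent \<open>p - 1\<close>
    is positive, and the series converges.\<close>
  also have "\<dots> = (\<integral>\<^sup>+k. \<integral>\<^sup>+x. ennreal (D * 2 powr (p + 1)) * (h x * (ennreal (2 powr ((p - 1) * real_of_int k)) *
      indicator {k. ennreal (2 powr real_of_int k) \<le> 2 * h x} k)) \<partial>\<mu> \<partial>count_space UNIV)"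
  proof (intro nn_integral_cong)
    fix k :: int
    have eq: "ennreal (2 powr (real_of_int k - 1)) \<le> z \<longleftrightarrow> ennreal (2 powr real_of_int k) \<le> 2 * z" for z
    proof -
      have "ennreal (2 powr real_of_int k) = ennreal 2 * ennreal (2 powr (real_of_int k - 1))"
        by (subst ennreal_mult[symmetric]) (simp_all add: powr_diff)
      then show ?thesis by (simp add: ennreal_mult_le_mult_iff)
    qed
    have c: "2 powr (p * (real_of_int k + 1)) * (D / 2 powr (real_of_int k - 1)) = D * 2 powr (p + 1) * 2 powr ((p - 1) * real_of_int k)"
      by (simp add: powr_diff powr_add algebra_simps)
    have "ennreal (2 powr (p * (real_of_int k + 1))) * (ennreal (D / 2 powr (real_of_int k - 1)) *
        (\<integral>\<^sup>+x\<in>{x. ennreal (2 powr (real_of_int k - 1)) \<le> h x}. h x \<partial>\<mu>))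
      = ennreal (2 powr (p * (real_of_int k + 1)) * (D / 2 powr (real_of_int k - 1))) *
        (\<integral>\<^sup>+x\<in>{x. ennreal (2 powr (real_of_int k - 1)) \<le> h x}. h x \<partial>\<mu>)"
      by (simp add: ennreal_mult' mult.assoc del: times_divide_eq_right)
    also have "\<dots> = ennreal (D * 2 powr (p + 1)) * ennreal (2 powr ((p - 1) * real_of_int k)) *
        (\<integral>\<^sup>+x\<in>{x. ennreal (2 powr (real_of_int k - 1)) \<le> h x}. h x \<partial>\<mu>)"
      unfolding c by (simp add: ennreal_mult'')
    also have "\<dots> = (\<integral>\<^sup>+x. ennreal (D * 2 powr (p + 1)) * (h x * (ennreal (2 powr ((p - 1) * real_of_int k)) *
      indicator {k. ennreal (2 powr real_of_int k) \<le> 2 * h x} k)) \<partial>\<mu>)"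
      by (subst nn_integral_cmult[symmetric]) (auto intro!: nn_integral_cong simp: indicator_def eq mult_ac)
    finally show "ennreal (2 powr (p * (real_of_int k + 1))) * (ennreal (D / 2 powr (real_of_int k - 1)) *
        (\<integral>\<^sup>+x\<in>{x. ennreal (2 powr (real_of_int k - 1)) \<le> h x}. h x \<partial>\<mu>)) =
      (\<integral>\<^sup>+x. ennreal (D * 2 powr (p + 1)) * (h x * (ennreal (2 powr ((p - 1) * real_of_int k)) *
      indicator {k. ennreal (2 powr real_of_int k) \<le> 2 * h x} k)) \<partial>\<mu>)" .
  qed
  also have "\<dots> = (\<integral>\<^sup>+x. \<integral>\<^sup>+k. ennreal (D * 2 powr (p + 1)) * (h x * (ennreal (2 powr ((p - 1) * real_of_int k)) *
      indicator {k. ennreal (2 powr real_of_int k) \<le> 2 * h x} k)) \<partial>count_space UNIV \<partial>\<mu>)"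
    by (subst nn_integral_count_space_nn_integral[symmetric]) (auto simp: indicator_def)
  also have "\<dots> \<le> (\<integral>\<^sup>+x. ennreal (D * 2 powr (p + 1)) * (h x * (ennreal ?q * powr_ennreal (2 * h x) (p - 1))) \<partial>\<mu>)"
  proof (intro nn_integral_mono)
    fix x
    show "(\<integral>\<^sup>+k. ennreal (D * 2 powr (p + 1)) * (h x * (ennreal (2 powr ((p - 1) * real_of_int k)) *
      indicator {k. ennreal (2 powr real_of_int k) \<le> 2 * h x} k)) \<partial>count_space UNIV)
      \<le> ennreal (D * 2 powr (p + 1)) * (h x * (ennreal ?q * powr_ennreal (2 * h x) (p - 1)))"
      using dyadic_le_powr_ennreal[of "p - 1" "2 * h x"] p
      by (simp add: nn_integral_cmult mult_left_mono)
  qed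
  also have "\<dots> = (\<integral>\<^sup>+x. ennreal (D * 4 powr p / (1 - 2 powr (1 - p))) * powr_ennreal (h x) p \<partial>\<mu>)"
  proof (intro nn_integral_cong)
    fix x
    have 1: "powr_ennreal (2 * h x) (p - 1) = ennreal (2 powr (p - 1)) * powr_ennreal (h x) (p - 1)"
      using p powr_ennreal_pos[of 2 "p - 1"] by (simp add: powr_ennreal_mult)
    have 2: "powr_ennreal (h x) p = h x * powr_ennreal (h x) (p - 1)"
      using p powr_ennreal_add[of 1 "p - 1" "h x"] by simp
    have "4 powr p = (2 powr (p + 1) * 2 powr (p - 1) :: real)"
      using powr_mult[of 2 2 p] by (simp add: powr_add powr_diff)
    then have 3: "D * 4 powr p / (1 - 2 powr (1 - p)) = D * 2 powr (p + 1) * (?q * 2 powr (p - 1))"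
      by simp
    show "ennreal (D * 2 powr (p + 1)) * (h x * (ennreal ?q * powr_ennreal (2 * h x) (p - 1)))
      = ennreal (D * 4 powr p / (1 - 2 powr (1 - p))) * powr_ennreal (h x) p"
      unfolding 1 2 3 using q by (subst ennreal_mult'', simp, subst ennreal_mult'', simp) (simp only: mult_ac)
  qed
  also have "\<dots> = ennreal (D * 4 powr p / (1 - 2 powr (1 - p))) * (\<integral>\<^sup>+x. powr_ennreal (h x) p \<partial>\<mu>)"
    by (rule nn_integral_cmult) measurable
  finally show ?thesis .
qed

end

section \<open>From the reverse Hoelder and Muckenhoupt conditions to an \<open>A\<^sub>1\<close> weight\<close>

text \<open>
  Every cube lies in a cube with rational data of at most twice its side, so countably many
  exceptional null sets suffice.
\<close>

lemma AE_all_cubes: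
  fixes s :: "real^'n \<Rightarrow> real" and S :: "(real^'n) set \<Rightarrow> ennreal"
  assumes K: "0 \<le> K" and s: "\<And>x. 0 < s x" and S: "\<And>P Q. P \<subseteq> Q \<Longrightarrow> S P \<le> S Q"
    and le: "\<And>a l. 0 < l \<Longrightarrow> AE x in lebesgue. x \<in> cube a l \<longrightarrow>
      S (cube a l) \<le> ennreal (K * s x) * emeasure lebesgue (cube a l)"
  shows "AE x in lebesgue. \<forall>a l. 0 < l \<longrightarrow> x \<in> cube a l \<longrightarrow>
      S (cube a l) \<le> ennreal (2 powr real CARD('n) * K * s x) * emeasure lebesgue (cube a l)"
proof -
  define c :: "('n \<Rightarrow> rat) \<Rightarrow> real^'n" where "c f = (\<chi> i. of_rat (f i))" for f
  have "AE x in lebesgue. \<forall>(r :: ('n \<Rightarrow> rat) \<times> rat). 0 < snd r \<longrightarrow> x \<in> cube (c (fst r)) (of_rat (snd r)) \<longrightarrow>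
      S (cube (c (fst r)) (of_rat (snd r))) \<le> ennreal (K * s x) * emeasure lebesgue (cube (c (fst r)) (of_rat (snd r)))"
    unfolding AE_all_countable using le by auto
  then show ?thesis
  proof (rule AE_mp, intro AE_I2 impI allI)
    fix x a :: "real^'n" and l :: real
    assume H: "\<forall>(r :: ('n \<Rightarrow> rat) \<times> rat). 0 < snd r \<longrightarrow> x \<in> cube (c (fst r)) (of_rat (snd r)) \<longrightarrow>
      S (cube (c (fst r)) (of_rat (snd r))) \<le> ennreal (K * s x) * emeasure lebesgue (cube (c (fst r)) (of_rat (snd r)))"
      and l: "0 < l" and x: "x \<in> cube a l"
    \<comment> \<open>Moving the corner down by less than \<open>l / 4\<close> is made up for by a
      side above \<open>3 * l / 2\<close>; a side below \<open>2 * l\<close> costs the factor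
      \<open>2 powr n\<close>.\<close>
    have "\<forall>i. \<exists>q. a $ i - l / 4 < of_rat q \<and> of_rat q < a $ i"
      using l by (intro allI of_rat_dense) auto
    then obtain f where f: "\<And>i. a $ i - l / 4 < of_rat (f i)" "\<And>i. of_rat (f i) < a $ i"
      by metis
    obtain q where q: "3 * l / 2 < of_rat q" "of_rat q < 2 * l"
      using l of_rat_dense[of "3 * l / 2" "2 * l"] by auto
    define Q where "Q = cube (c f) (of_rat q)"
    have q0: "0 < (of_rat q :: real)" using q l by linarith
    have sub: "cube a l \<subseteq> Q"
    proof
      fix y assume y: "y \<in> cube a l"
      have "of_rat (f i) \<le> y $ i \<and> y $ i \<le> of_rat (f i) + of_rat q" for i
      proof -
        have "a $ i \<le> y $ i" "y $ i \<le> a $ i + l" using y by (auto simp: mem_cube)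
        with f[of i] q l show ?thesis by linarith
      qed
      then show "y \<in> Q" by (simp add: Q_def mem_cube c_def)
    qed
    have "S (cube a l) \<le> S Q" using sub by (rule S)
    also have "\<dots> \<le> ennreal (K * s x) * emeasure lebesgue Q"
      using H[rule_format, of "(f, q)"] q0 sub x by (auto simp: Q_def)
    also have "\<dots> \<le> ennreal (K * s x) * ennreal ((2 * l) powr real CARD('n))"
      unfolding Q_def emeasure_cube[OF q0] using q q0 l
      by (intro mult_left_mono ennreal_leI powr_mono2) auto
    also have "\<dots> = ennreal (2 powr real CARD('n) * K * s x) * emeasure lebesgue (cube a l)"
      using l K s[of x] by (simp add: emeasure_cube powr_mult mult_ac flip: ennreal_mult)
    finally show "S (cube a l) \<le> ennreal (2 powr real CARD('n) * K * s x) * emeasure lebesgue (cube a l)" .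
  qed
qed

section \<open>The two weight conditions on a single cube\<close>

lemma weight_AE_finite:
  assumes "weight (w :: real^'n \<Rightarrow> ennreal)"
  shows "AE x in lebesgue. w x < \<infinity>"
proof -
  have [measurable]: "w \<in> borel_measurable lebesgue" using assms by (simp add: weight_def)
  let ?Q = "\<lambda>m::nat. cube (\<chi> i. - real m) (2 * real m) :: (real^'n) set"
  have "AE x in lebesgue. \<forall>m. w x * indicator (?Q m) x \<noteq> \<infinity>"
    unfolding AE_all_countable
  proof
    fix m
    have "(\<integral>\<^sup>+x\<in>?Q m. w x \<partial>lebesgue) \<noteq> \<infinity>"
      using assms compact_cube unfolding weight_def by (metis less_irrefl)
    then show "AE x in lebesgue. w x * indicator (?Q m) x \<noteq> \<infinity>"
      by (intro nn_integral_PInf_AE) auto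
  qed
  then show ?thesis
  proof (rule AE_mp, intro AE_I2 impI)
    fix x :: "real^'n" assume H: "\<forall>m. w x * indicator (?Q m) x \<noteq> \<infinity>"
    obtain m :: nat where m: "norm x \<le> real m" using real_arch_simple by blast
    have "\<bar>x $ i\<bar> \<le> real m" for i using component_le_norm_cart[of x i] m by linarith
    then have "x \<in> ?Q m" by (auto simp: mem_cube abs_le_iff) (smt (verit))
    with H[rule_format, of m] show "w x < \<infinity>" by (simp add: less_top)
  qed
qed

text \<open>
  On \<open>E\<close> the logarithm is at most \<open>ln \<tau>\<close>, elsewhere \<open>ln f \<le> ln R + f / R\<close>; integrating, the
  \<open>A\<^sub>\<infinity>\<close> condition absorbs a power of the mean \<open>R\<close> smaller than one.
\<close>

lemma average_le_of_log_bound: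
  fixes f :: "'a \<Rightarrow> real"
  assumes M: "finite_measure M" and W: "0 < measure M (space M)"
    and f: "integrable M f" "\<And>x. x \<in> space M \<Longrightarrow> 0 < f x" and ln: "integrable M (\<lambda>x. ln (f x))"
    and E: "E \<in> sets M" "0 < \<eta>" "\<eta> * measure M (space M) \<le> measure M E"
    and \<tau>: "0 < \<tau>" "\<And>x. x \<in> E \<Longrightarrow> f x \<le> \<tau>"
    and R: "R = (\<integral>x. f x \<partial>M) / measure M (space M)" "0 < R"
    and A: "R * exp (- ((\<integral>x. ln (f x) \<partial>M) / measure M (space M))) \<le> A"
  shows "R \<le> max 1 (A * exp 1) powr (1 / \<eta>) * \<tau>"
proof -
  interpret finite_measure M by fact
  let ?m = "measure M (space M)" and ?L = "\<integral>x. ln (f x) \<partial>M"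
  \<comment> \<open>\<open>ln B \<ge> 0\<close> is needed at the end, where the true proportion
    \<open>\<theta>\<close> of \<open>E\<close> is replaced by its lower bound \<open>\<eta>\<close>
    in the denominator.\<close>
  define B where "B = max 1 (A * exp 1)"
  have B: "1 \<le> B" "A * exp 1 \<le> B" by (simp_all add: B_def)
  define \<theta> where "\<theta> = measure M E / ?m"
  have \<theta>: "\<eta> \<le> \<theta>" "\<theta> \<le> 1" using E W bounded_measure[of E] by (auto simp: \<theta>_def field_simps)
  have "?L \<le> (\<integral>x. ln \<tau> * indicator E x + ln R * indicator (space M - E) x + f x / R \<partial>M)"
  proof (rule integral_mono[OF ln])
    show "integrable M (\<lambda>x. ln \<tau> * indicator E x + ln R * indicator (space M - E) x + f x / R)"
      using E f by (intro Bochner_Integration.integrable_add integrable_mult_right integrable_divide) (auto simp: less_top[symmetric])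
    fix x assume x: "x \<in> space M"
    show "ln (f x) \<le> ln \<tau> * indicator E x + ln R * indicator (space M - E) x + f x / R"
    proof (cases "x \<in> E")
      case True
      then have "ln (f x) \<le> ln \<tau>" using \<tau> f(2)[OF x] by simp
      moreover have "0 \<le> f x / R" using R(2) f(2)[OF x] by simp
      ultimately show ?thesis using True x by simp
    next
      case False
      have "ln (f x / R) \<le> f x / R" using f(2)[OF x] R(2) by (intro ln_bound) simp
      with False x f(2)[OF x] R(2) show ?thesis by (simp add: ln_div)
    qed
  qed
  also have "\<dots> = ln \<tau> * measure M E + ln R * (?m - measure M E) + (\<integral>x. f x \<partial>M) / R"
    using E f by (simp add: less_top[symmetric] finite_measure_compl)
  also have "(\<integral>x. f x \<partial>M) / R = ?m" using R W by (simp add: field_simps)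
  finally have L: "?L / ?m \<le> \<theta> * ln \<tau> + (1 - \<theta>) * ln R + 1"
    using W by (simp add: \<theta>_def field_simps)
  have "R \<le> A * exp (?L / ?m)"
    using A by (simp add: exp_minus field_simps)
  moreover have "0 < A" using calculation R by (metis exp_gt_zero less_le_trans zero_less_mult_pos2)
  ultimately have "ln R \<le> ln A + ?L / ?m"
    using R by (metis exp_gt_zero ln_exp ln_le_cancel_iff ln_mult_pos mult_pos_pos)
  \<comment> \<open>The term \<open>(1 - \<theta>) * ln R\<close> is absorbed on the left; what
    remains is divided by \<open>\<theta>\<close>.\<close>
  with L have "\<theta> * ln R \<le> ln (A * exp 1) + \<theta> * ln \<tau>"
    using \<open>0 < A\<close> by (simp add: ln_mult algebra_simps)
  also have "ln (A * exp 1) \<le> ln B" using \<open>0 < A\<close> B by simp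
  finally have "\<theta> * (ln R - ln \<tau>) \<le> ln B" by (simp add: algebra_simps)
  then have "ln R - ln \<tau> \<le> ln B / \<theta>" using \<theta> E by (simp add: field_simps)
  also have "\<dots> \<le> ln B / \<eta>" using \<theta> E B by (intro divide_left_mono) auto
  finally have "ln R \<le> ln (B powr (1 / \<eta>) * \<tau>)"
    using \<tau>(1) B(1) by (simp add: ln_mult ln_powr)
  then show ?thesis using R(2) \<tau>(1) B(1) unfolding B_def[symmetric]
    by (subst (asm) ln_le_cancel_iff) auto
qed

lemma ereal_integral_real:
  assumes "integrable M f"
  shows "ereal_integral M (\<lambda>x. ereal (f x)) = ereal (\<integral>x. f x \<partial>M)"
proof -
  have fin: "(\<integral>\<^sup>+x. ennreal (f x) \<partial>M) < \<infinity>" "(\<integral>\<^sup>+x. ennreal (- f x) \<partial>M) < \<infinity>"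
    using assms by (simp_all add: real_integrable_def less_top)
  have enn: "enn2ereal x = ereal (enn2real x)" if "x < \<infinity>" for x
    using that by (cases x) auto
  have "ereal_integral M (\<lambda>x. ereal (f x)) =
      enn2ereal (\<integral>\<^sup>+x. ennreal (f x) \<partial>M) - enn2ereal (\<integral>\<^sup>+x. ennreal (- f x) \<partial>M)"
    by (simp add: ereal_integral_def)
  also have "\<dots> = ereal (\<integral>x. f x \<partial>M)"
    using fin by (simp add: enn real_lebesgue_integral_def[OF assms])
  finally show ?thesis .
qed

lemma ereal_integral_cong_AE:
  "(AE x in M. f x = g x) \<Longrightarrow> ereal_integral M f = ereal_integral M g"
  unfolding ereal_integral_def
  by (intro arg_cong2[where f="(-)"] arg_cong[where f=enn2ereal] nn_integral_cong_AE) auto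

text \<open>\<open>b\<close> is \<open>p' / p\<close>, \<open>\<alpha>\<close> the
  \<open>A_\<infinity>\<close> constant and \<open>\<kappa>\<close> the reverse Hoelder constant.
  The exponent \<open>2 * \<kappa>\<close> is the inverse of the proportion of a cube on which
  \<open>v\<close> exceeds half its mean \<open>m\<close>; the last factor turns
  \<open>(m / 2) powr (- b)\<close> into \<open>(\<kappa> * m) powr (- b)\<close>.\<close>

definition A1_const :: "real \<Rightarrow> real \<Rightarrow> real \<Rightarrow> real" where
  "A1_const b \<alpha> \<kappa> = max 1 (\<alpha> * exp 1) powr (2 * \<kappa>) * (2 * \<kappa>) powr b"

text \<open>Besides the \<open>A_1\<close> estimate this supplies a real, everywhere positive
  version \<open>s\<close> of \<open>\<sigma>\<close>, so that all later powers obey the rules for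
  \<open>powr\<close>. Each cube still has its own exceptional null set here.\<close>

lemma A1_of_RH_A_infinity:
  fixes v :: "real^'n \<Rightarrow> ennreal" and b :: real
  defines "\<sigma> \<equiv> \<lambda>x. powr_ennreal (v x) (- b)"
  assumes v: "v \<in> RH_infinity" and \<sigma>: "\<sigma> \<in> A_infinity" and b: "0 < b"
  obtains s :: "real^'n \<Rightarrow> real" where "s \<in> borel_measurable lebesgue" "\<And>x. 0 < s x"
    "AE x in lebesgue. \<sigma> x = ennreal (s x)" "AE x in lebesgue. v x = ennreal (s x powr (- (1 / b)))"
    "\<And>a l. 0 < l \<Longrightarrow> AE x in lebesgue. x \<in> cube a l \<longrightarrow> (\<integral>\<^sup>+y\<in>cube a l. ennreal (s y) \<partial>lebesgue) \<le>
      ennreal (A1_const b (enn2real (A_infinity_const \<sigma>)) (enn2real (RH_infinity_const v)) * s x) *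
      emeasure lebesgue (cube a l)"
proof -
  define \<alpha> where "\<alpha> = enn2real (A_infinity_const \<sigma>)"
  define \<kappa> where "\<kappa> = enn2real (RH_infinity_const v)"
  have wv: "weight v" and w\<sigma>: "weight \<sigma>" and \<alpha>: "A_infinity_const \<sigma> = ennreal \<alpha>" and \<kappa>: "RH_infinity_const v = ennreal \<kappa>"
    using v \<sigma> by (auto simp: RH_infinity_def A_infinity_def \<alpha>_def \<kappa>_def less_top)
  have [measurable]: "v \<in> borel_measurable lebesgue" using wv by (simp add: weight_def)
  \<comment> \<open>The value \<open>1\<close> is a default on a null set that keeps
    \<open>s\<close> positive.\<close>
  define s where "s x = (if v x = 0 \<or> v x = \<infinity> then 1 else enn2real (v x) powr (- b))" for x
  have [measurable]: "s \<in> borel_measurable lebesgue" unfolding s_def by measurable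
  have s_pos: "0 < s x" for x
    by (cases "v x") (auto simp: s_def)
  \<comment> \<open>Where \<open>v\<close> vanishes, \<open>\<sigma>\<close> is infinite; local
    integrability of both weights excludes either extreme almost everywhere.\<close>
  have good: "AE x in lebesgue. v x \<noteq> 0 \<and> v x \<noteq> \<infinity>"
    using weight_AE_finite[OF wv] weight_AE_finite[OF w\<sigma>]
    by eventually_elim (use b in \<open>auto simp: \<sigma>_def powr_ennreal_def\<close>)
  have \<sigma>s: "AE x in lebesgue. \<sigma> x = ennreal (s x)"
    using good by eventually_elim (use b in \<open>auto simp: \<sigma>_def s_def powr_ennreal_def\<close>)
  define V where "V x = s x powr (- (1 / b))" for x
  have [measurable]: "V \<in> borel_measurable lebesgue" unfolding V_def by measurable
  have V_pos: "0 < V x" for x using s_pos[of x] by (simp add: V_def)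
  have sV: "s x = V x powr (- b)" for x using s_pos[of x] b by (simp add: V_def powr_powr)
  have vV: "AE x in lebesgue. v x = ennreal (V x)"
    using good
  proof eventually_elim
    case (elim x)
    then obtain r where r: "v x = ennreal r" "0 < r" by (cases "v x") (auto simp: less_le)
    then have "s x = r powr (- b)" by (simp add: s_def)
    then show ?case using r b by (simp add: V_def powr_powr)
  qed
  have A1: "AE x in lebesgue. x \<in> cube a l \<longrightarrow> (\<integral>\<^sup>+y\<in>cube a l. ennreal (s y) \<partial>lebesgue) \<le>
      ennreal (A1_const b \<alpha> \<kappa> * s x) * emeasure lebesgue (cube a l)" if l: "0 < l" for a l
  proof -
    define Q where "Q = cube a l"
    define M where "M = restrict_space lebesgue Q"
    have Qs [measurable]: "Q \<in> sets lebesgue" and Qc: "Q \<in> cubes" using l by (auto simp: Q_def cubes_eq)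
    define N where "N = l powr real CARD('n)"
    have N: "0 < N" "emeasure lebesgue Q = ennreal N" using l by (auto simp: Q_def N_def emeasure_cube)
    have spM: "space M = Q" by (simp add: M_def space_restrict_space)
    have "emeasure M Q = ennreal N"
      using N Qs unfolding M_def by (subst emeasure_restrict_space) auto
    then have mM: "measure M Q = N" using N by (simp add: measure_def)
    from \<open>emeasure M Q = ennreal N\<close> interpret M: finite_measure M
      by (intro finite_measureI) (simp add: spM)
    have AEM: "AE x in M. P x" if "AE x in lebesgue. P x" for P
      using that unfolding M_def by (subst AE_restrict_space_iff) auto
    have meas: "f \<in> borel_measurable M" if "f \<in> borel_measurable lebesgue" for f :: "_ \<Rightarrow> real"
      using that unfolding M_def by (rule measurable_restrict_space1)
    have [measurable]: "s \<in> borel_measurable M" "V \<in> borel_measurable M" by (simp_all add: meas)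
    have nnM: "(\<integral>\<^sup>+x. f x \<partial>M) = (\<integral>\<^sup>+x\<in>Q. f x \<partial>lebesgue)" for f
      unfolding M_def by (rule nn_integral_restrict_space) simp
    have cQ: "compact Q" by (simp add: Q_def compact_cube)
    have fin_s: "(\<integral>\<^sup>+x. ennreal (s x) \<partial>M) < \<infinity>"
    proof -
      have "(\<integral>\<^sup>+x. ennreal (s x) \<partial>M) = (\<integral>\<^sup>+x. \<sigma> x \<partial>M)" using AEM[OF \<sigma>s] by (intro nn_integral_cong_AE) auto
      then show ?thesis using w\<sigma> cQ by (simp add: nnM weight_def)
    qed
    have vVM: "(\<integral>\<^sup>+x. ennreal (V x) \<partial>M) = (\<integral>\<^sup>+x\<in>Q. v x \<partial>lebesgue)"
      unfolding nnM[symmetric] using AEM[OF vV] by (intro nn_integral_cong_AE) auto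
    have fin_V: "(\<integral>\<^sup>+x. ennreal (V x) \<partial>M) < \<infinity>"
      unfolding vVM using wv cQ by (simp add: weight_def)
    have int_s: "integrable M s"
      using fin_s by (intro integrableI_nonneg AE_I2 less_imp_le s_pos) simp_all
    have int_V: "integrable M V"
      using fin_V by (intro integrableI_nonneg AE_I2 less_imp_le V_pos) simp_all
    have pos: "0 < (\<integral>x. f x \<partial>M)" if "integrable M f" "\<And>x. 0 < f x" for f :: "_ \<Rightarrow> real"
    proof -
      have "0 \<le> (\<integral>x. f x \<partial>M)" by (intro integral_nonneg_AE AE_I2 less_imp_le that)
      moreover have "(\<integral>x. f x \<partial>M) \<noteq> 0"
      proof
        assume "(\<integral>x. f x \<partial>M) = 0"
        then have "AE x in M. f x = 0" using that by (subst (asm) integral_nonneg_eq_0_iff_AE) (auto intro: less_imp_le)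
        then have "AE x in M. False" by eventually_elim (metis that(2) less_irrefl)
        then have "emeasure M Q = 0" using AE_iff_measurable[of Q M "\<lambda>_. False"] sets.top[of M] spM by auto
        then show False using mM N by (simp add: measure_def)
      qed
      ultimately show ?thesis by simp
    qed
    \<comment> \<open>\<open>ln t \<le> t\<close>, applied to \<open>s\<close> and to
      \<open>V\<close>, bounds the logarithm from both sides. Thus the extended integral in the
      \<open>A_\<infinity>\<close> constant is an ordinary one.\<close>
    have int_ln: "integrable M (\<lambda>x. ln (s x))"
    proof (rule Bochner_Integration.integrable_bound)
      show "integrable M (\<lambda>x. s x + b * V x)" using int_s int_V by simp
      show "(\<lambda>x. ln (s x)) \<in> borel_measurable M" by measurable
      have "\<bar>ln (s x)\<bar> \<le> s x + b * V x" for x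
      proof -
        have "ln (s x) \<le> s x" using s_pos[of x] by (rule ln_bound)
        moreover have "- ln (s x) = b * ln (V x)" using V_pos[of x] by (simp add: sV ln_powr)
        moreover have "b * ln (V x) \<le> b * V x" using V_pos[of x] b by (intro mult_left_mono ln_bound) auto
        moreover have "0 < s x" "0 < b * V x" using s_pos V_pos b by auto
        ultimately show ?thesis by linarith
      qed
      then show "AE x in M. norm (ln (s x)) \<le> norm (s x + b * V x)"
        using s_pos V_pos b by (auto intro!: AE_I2 order_trans[OF _ abs_ge_self])
    qed
    define R where "R = (\<integral>x. s x \<partial>M) / N"
    define m where "m = (\<integral>x. V x \<partial>M) / N"
    have R: "0 < R" using pos[OF int_s s_pos] N by (simp add: R_def)
    have m: "0 < m" using pos[OF int_V V_pos] N by (simp add: m_def)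
    have avgV: "average Q v = ennreal m"
    proof -
      have "(\<integral>\<^sup>+x\<in>Q. v x \<partial>lebesgue) = ennreal (\<integral>x. V x \<partial>M)"
        unfolding vVM[symmetric] using int_V V_pos by (intro nn_integral_eq_integral) (auto intro: less_imp_le)
      then show ?thesis using N pos[OF int_V V_pos] by (simp add: average_def m_def divide_ennreal)
    qed
    have int_s_eq: "(\<integral>\<^sup>+x\<in>Q. ennreal (s x) \<partial>lebesgue) = ennreal (R * N)"
    proof -
      have "(\<integral>\<^sup>+x\<in>Q. ennreal (s x) \<partial>lebesgue) = ennreal (\<integral>x. s x \<partial>M)"
        unfolding nnM[symmetric] using int_s s_pos by (intro nn_integral_eq_integral) (auto intro: less_imp_le)
      then show ?thesis using N by (simp add: R_def)
    qed
    have avgs: "average Q \<sigma> = ennreal R"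
    proof -
      have "(\<integral>\<^sup>+x\<in>Q. \<sigma> x \<partial>lebesgue) = (\<integral>\<^sup>+x\<in>Q. ennreal (s x) \<partial>lebesgue)"
        using \<sigma>s by (intro nn_integral_cong_AE) auto
      then show ?thesis using N R by (simp add: average_def int_s_eq divide_ennreal)
    qed
    have V_le: "AE x in M. V x \<le> \<kappa> * m"
    proof -
      have "esssup M v * inverse (average Q v) \<le> ennreal \<kappa>"
        unfolding \<kappa>[symmetric] RH_infinity_const_def M_def using Qc by (rule SUP_upper)
      then have "esssup M v * inverse (ennreal m) * ennreal m \<le> ennreal \<kappa> * ennreal m"
        unfolding avgV by (rule mult_right_mono) simp
      then have le: "esssup M v \<le> ennreal (\<kappa> * m)"
        using m by (simp add: inverse_ennreal mult.assoc \<kappa>_def flip: ennreal_mult)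
      show ?thesis using esssup_AE[where M=M and f=v] AEM[OF vV]
      proof eventually_elim
        case (elim x)
        then have "ennreal (V x) \<le> ennreal (\<kappa> * m)" using le by simp
        then show ?case using V_pos[of x] m \<open>\<kappa> = enn2real (RH_infinity_const v)\<close> by (simp add: ennreal_le_iff)
      qed
    qed
    \<comment> \<open>Bounding \<open>V\<close> by \<open>\<kappa> * m\<close> on \<open>E\<close>
      and by \<open>m / 2\<close> off it, and integrating, gives \<open>E\<close> at least the
      proportion \<open>1 / (2 * \<kappa>)\<close> of \<open>Q\<close>.\<close>
    define E where "E = {x\<in>Q. m / 2 < V x}"
    have E [measurable]: "E \<in> sets M"
    proof -
      have "{x \<in> space M. m / 2 < V x} \<in> sets M" by measurable
      then show ?thesis by (simp add: E_def spM)
    qed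
    have "(\<integral>x. V x \<partial>M) \<le> (\<integral>x. \<kappa> * m * indicator E x + m / 2 \<partial>M)"
    proof (rule integral_mono_AE[OF int_V])
      show "integrable M (\<lambda>x. \<kappa> * m * indicator E x + m / 2)" using E by (auto simp: less_top[symmetric])
      show "AE x in M. V x \<le> \<kappa> * m * indicator E x + m / 2"
        using V_le AE_space
      proof eventually_elim
        case (elim x)
        then show ?case using m by (cases "x \<in> E") (auto simp: E_def spM)
      qed
    qed
    also have "\<dots> = \<kappa> * m * measure M E + m / 2 * N"
    proof -
      have "E \<inter> Q = E" by (auto simp: E_def)
      then show ?thesis using E by (simp add: less_top[symmetric] spM mM)
    qed
    finally have "m * N \<le> \<kappa> * m * measure M E + m / 2 * N" using N by (simp add: m_def)
    then have "m * N \<le> m * (2 * \<kappa> * measure M E)" by (simp add: field_simps)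
    then have E2: "N \<le> 2 * \<kappa> * measure M E" using m by simp
    have \<kappa>_pos: "0 < \<kappa>"
      using E2 N measure_nonneg[of M E] by (smt (verit) mult_nonneg_nonneg mult_nonpos_nonneg)
    have "R \<le> max 1 (\<alpha> * exp 1) powr (1 / (1 / (2 * \<kappa>))) * (m / 2) powr (- b)"
    proof (rule average_le_of_log_bound[OF M.finite_measure_axioms _ int_s _ int_ln E])
      show "1 / (2 * \<kappa>) * measure M (space M) \<le> measure M E" using E2 \<kappa>_pos by (simp add: spM mM field_simps)
      show "s x \<le> (m / 2) powr (- b)" if "x \<in> E" for x
        using that m b V_pos[of x] unfolding sV by (intro powr_mono2') (auto simp: E_def)
      have "average Q \<sigma> * exp_ereal (- (ereal_integral M (\<lambda>x. ln_ennreal (\<sigma> x)) / ereal (measure lebesgue Q))) \<le> ennreal \<alpha>"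
        unfolding \<alpha>[symmetric] A_infinity_const_def M_def using Qc by (rule SUP_upper)
      moreover have "ereal_integral M (\<lambda>x. ln_ennreal (\<sigma> x)) = ereal (\<integral>x. ln (s x) \<partial>M)"
      proof -
        have "AE x in M. ln_ennreal (\<sigma> x) = ereal (ln (s x))"
          using AEM[OF \<sigma>s] by eventually_elim (simp add: ln_ennreal_def less_imp_le[OF s_pos] less_imp_neq[OF s_pos, symmetric])
        then show ?thesis using ereal_integral_real[OF int_ln] ereal_integral_cong_AE by metis
      qed
      moreover have "measure lebesgue Q = N" using N by (simp add: measure_def)
      ultimately have "ennreal R * ennreal (exp (- ((\<integral>x. ln (s x) \<partial>M) / N))) \<le> ennreal \<alpha>"
        using N by (simp add: avgs exp_ereal_def)
      then show "R * exp (- ((\<integral>x. ln (s x) \<partial>M) / measure M (space M))) \<le> \<alpha>"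
        using R by (simp add: spM mM \<alpha>_def flip: ennreal_mult)
    qed (use N R m s_pos \<kappa>_pos in \<open>auto simp: spM mM R_def\<close>)
    then have R_le: "R \<le> max 1 (\<alpha> * exp 1) powr (2 * \<kappa>) * (m / 2) powr (- b)" by simp
    have "AE x in M. R \<le> A1_const b \<alpha> \<kappa> * s x"
      using V_le
    proof eventually_elim
      case (elim x)
      have "(m / 2) powr (- b) = (2 * \<kappa>) powr b * (\<kappa> * m) powr (- b)"
        using m \<kappa>_pos by (simp add: powr_mult powr_divide powr_minus field_simps)
      also have "\<dots> \<le> (2 * \<kappa>) powr b * s x"
        unfolding sV using elim V_pos[of x] b by (intro mult_left_mono powr_mono2') auto
      finally have "(m / 2) powr (- b) \<le> (2 * \<kappa>) powr b * s x" .
      then have "max 1 (\<alpha> * exp 1) powr (2 * \<kappa>) * (m / 2) powr (- b) \<le>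
          max 1 (\<alpha> * exp 1) powr (2 * \<kappa>) * ((2 * \<kappa>) powr b * s x)"
        by (rule mult_left_mono) simp
      then show ?case using R_le by (simp add: A1_const_def mult.assoc)
    qed
    then have "AE x in lebesgue. x \<in> Q \<longrightarrow> R \<le> A1_const b \<alpha> \<kappa> * s x"
      unfolding M_def by (subst (asm) AE_restrict_space_iff) auto
    then show ?thesis unfolding Q_def[symmetric]
    proof eventually_elim
      case (elim x)
      show ?case
      proof
        assume "x \<in> Q"
        with elim have "R * N \<le> A1_const b \<alpha> \<kappa> * s x * N" using N by (intro mult_right_mono) auto
        then have "ennreal (R * N) \<le> ennreal (A1_const b \<alpha> \<kappa> * s x * N)" by (rule ennreal_leI)
        also have "\<dots> = ennreal (A1_const b \<alpha> \<kappa> * s x) * emeasure lebesgue Q"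
          using N by (simp add: ennreal_mult'')
        finally show "(\<integral>\<^sup>+y\<in>Q. ennreal (s y) \<partial>lebesgue) \<le> ennreal (A1_const b \<alpha> \<kappa> * s x) * emeasure lebesgue Q"
          by (simp add: int_s_eq)
      qed
    qed
  qed
  show ?thesis
    by (rule that[of s]) (use s_pos \<sigma>s vV A1 in \<open>auto simp: V_def \<alpha>_def \<kappa>_def\<close>)
qed

section \<open>Dyadic O'Neil inequality\<close>

lemma two_powr_mult: "ennreal (2 powr x) * ennreal (2 powr y) = ennreal (2 powr (x + y))"
  by (simp add: powr_add ennreal_mult)

lemma powr_ennreal_two_powr: "powr_ennreal (ennreal (2 powr x)) a = ennreal (2 powr (x * a))"
  by (simp add: powr_ennreal_pos powr_powr)

lemma nn_integral_int_level_le: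
  assumes "0 < n"
  shows "(\<integral>\<^sup>+k. ennreal (2 powr (n * real_of_int k)) * indicator {k. ennreal (2 powr (n * real_of_int k)) \<le> V} k \<partial>count_space UNIV)
    \<le> ennreal (1 / (1 - 2 powr - n)) * V"
proof -
  have "(\<integral>\<^sup>+k. ennreal (2 powr (n * real_of_int k)) * indicator {k. ennreal (2 powr (n * real_of_int k)) \<le> V} k \<partial>count_space UNIV)
    \<le> (\<integral>\<^sup>+k. ennreal (2 powr (n * real_of_int k)) *
        indicator {k. ennreal (2 powr real_of_int k) \<le> powr_ennreal V (1 / n)} k \<partial>count_space UNIV)"
  proof (intro nn_integral_mono mult_left_mono)
    fix k :: int
    have "ennreal (2 powr real_of_int k) \<le> powr_ennreal V (1 / n)" if "ennreal (2 powr (n * real_of_int k)) \<le> V"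
      using powr_ennreal_mono[OF _ that, of "1 / n"] assms by (simp add: powr_ennreal_two_powr)
    then show "indicator {k. ennreal (2 powr (n * real_of_int k)) \<le> V} k \<le>
        (indicator {k. ennreal (2 powr real_of_int k) \<le> powr_ennreal V (1 / n)} k :: ennreal)"
      by (auto simp: indicator_def)
  qed simp
  also have "\<dots> \<le> ennreal (1 / (1 - 2 powr - n)) * powr_ennreal (powr_ennreal V (1 / n)) n"
    using assms by (rule dyadic_le_powr_ennreal)
  finally show ?thesis using assms by (simp add: powr_ennreal_powr)
qed

text \<open>After a layer cake for \<open>a\<close> and an exchange of sums, at the level
  \<open>2 powr j\<close> only indices with \<open>2 powr (n * k)\<close> at most the measure of
  \<open>{G \<ge> 2 powr j}\<close> remain. Geometric growth bounds their sum by a multiple of that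
  measure and takes the place of disjointness of the sets belonging to different
  \<open>k\<close>.\<close>

lemma sum_levels_le:
  assumes [measurable]: "G \<in> borel_measurable M" and n: "0 < n" and p: "0 < p"
    and level: "\<And>k t. t < a k \<Longrightarrow> ennreal (2 powr (n * real_of_int k)) \<le> emeasure M {x\<in>space M. t \<le> G x}"
  shows "(\<integral>\<^sup>+k. ennreal (2 powr (n * real_of_int k)) * powr_ennreal (a k) p \<partial>count_space UNIV)
    \<le> ennreal (2 powr p / ((1 - 2 powr - n) * (1 - 2 powr - p))) * (\<integral>\<^sup>+x. powr_ennreal (G x) p \<partial>M)"
proof -
  let ?cn = "1 / (1 - 2 powr - n) :: real" and ?cp = "1 / (1 - 2 powr - p) :: real"
  let ?V = "\<lambda>j::int. emeasure M {x\<in>space M. ennreal (2 powr real_of_int j) \<le> G x}"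
  have c: "2 powr - n < (1::real)" "2 powr - p < (1::real)"
    using n p powr_less_mono[of "-n" 0 2] powr_less_mono[of "-p" 0 2] by auto
  have "(\<integral>\<^sup>+k. ennreal (2 powr (n * real_of_int k)) * powr_ennreal (a k) p \<partial>count_space UNIV)
    \<le> (\<integral>\<^sup>+k. \<integral>\<^sup>+j. ennreal (2 powr (n * real_of_int k)) * (ennreal (2 powr (p * (real_of_int j + 1))) *
        indicator {j. ennreal (2 powr real_of_int j) < a k} j) \<partial>count_space UNIV \<partial>count_space UNIV)"
    by (intro nn_integral_mono) (simp add: nn_integral_cmult mult_left_mono powr_ennreal_le_dyadic[OF p])
  also have "\<dots> = (\<integral>\<^sup>+j. \<integral>\<^sup>+k. ennreal (2 powr (n * real_of_int k)) * (ennreal (2 powr (p * (real_of_int j + 1))) *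
        indicator {j. ennreal (2 powr real_of_int j) < a k} j) \<partial>count_space UNIV \<partial>count_space UNIV)"
    by (rule nn_integral_count_space_nn_integral) auto
  also have "\<dots> \<le> (\<integral>\<^sup>+j. ennreal (2 powr (p * (real_of_int j + 1))) * (ennreal ?cn * ?V j) \<partial>count_space UNIV)"
  proof (intro nn_integral_mono)
    fix j :: int
    have "(\<integral>\<^sup>+k. ennreal (2 powr (n * real_of_int k)) * (ennreal (2 powr (p * (real_of_int j + 1))) *
        indicator {j. ennreal (2 powr real_of_int j) < a k} j) \<partial>count_space UNIV)
      \<le> (\<integral>\<^sup>+k. ennreal (2 powr (p * (real_of_int j + 1))) * (ennreal (2 powr (n * real_of_int k)) *
        indicator {k. ennreal (2 powr (n * real_of_int k)) \<le> ?V j} k) \<partial>count_space UNIV)"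
      using level by (intro nn_integral_mono) (auto simp: indicator_def mult.commute)
    also have "\<dots> \<le> ennreal (2 powr (p * (real_of_int j + 1))) * (ennreal ?cn * ?V j)"
      by (simp add: nn_integral_cmult mult_left_mono nn_integral_int_level_le[OF n])
    finally show "(\<integral>\<^sup>+k. ennreal (2 powr (n * real_of_int k)) * (ennreal (2 powr (p * (real_of_int j + 1))) *
        indicator {j. ennreal (2 powr real_of_int j) < a k} j) \<partial>count_space UNIV)
      \<le> ennreal (2 powr (p * (real_of_int j + 1))) * (ennreal ?cn * ?V j)" .
  qed
  also have "\<dots> = (\<integral>\<^sup>+j. \<integral>\<^sup>+x. (ennreal (2 powr p) * ennreal ?cn) * (ennreal (2 powr (p * real_of_int j)) *
      indicator {j. ennreal (2 powr real_of_int j) \<le> G x} j) \<partial>M \<partial>count_space UNIV)"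
  proof (intro nn_integral_cong)
    fix j :: int
    have "(\<integral>\<^sup>+x. (ennreal (2 powr p) * ennreal ?cn) * (ennreal (2 powr (p * real_of_int j)) *
        indicator {j. ennreal (2 powr real_of_int j) \<le> G x} j) \<partial>M)
      = (\<integral>\<^sup>+x. ((ennreal (2 powr p) * ennreal ?cn) * ennreal (2 powr (p * real_of_int j))) *
        indicator {x\<in>space M. ennreal (2 powr real_of_int j) \<le> G x} x \<partial>M)"
      by (intro nn_integral_cong) (auto simp: indicator_def)
    also have "\<dots> = ((ennreal (2 powr p) * ennreal ?cn) * ennreal (2 powr (p * real_of_int j))) * ?V j"
      by (rule nn_integral_cmult_indicator) measurable
    also have "\<dots> = (ennreal (2 powr p) * ennreal (2 powr (p * real_of_int j))) * (ennreal ?cn * ?V j)"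
      by (simp only: mult_ac)
    also have "\<dots> = ennreal (2 powr (p * (real_of_int j + 1))) * (ennreal ?cn * ?V j)"
      by (simp add: two_powr_mult algebra_simps)
    finally show "ennreal (2 powr (p * (real_of_int j + 1))) * (ennreal ?cn * ?V j) =
      (\<integral>\<^sup>+x. (ennreal (2 powr p) * ennreal ?cn) * (ennreal (2 powr (p * real_of_int j)) *
        indicator {j. ennreal (2 powr real_of_int j) \<le> G x} j) \<partial>M)" ..
  qed
  also have "\<dots> = (\<integral>\<^sup>+x. \<integral>\<^sup>+j. (ennreal (2 powr p) * ennreal ?cn) * (ennreal (2 powr (p * real_of_int j)) *
      indicator {j. ennreal (2 powr real_of_int j) \<le> G x} j) \<partial>count_space UNIV \<partial>M)"
    by (rule nn_integral_count_space_nn_integral[symmetric]) (auto simp: indicator_def)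
  also have "\<dots> \<le> (\<integral>\<^sup>+x. (ennreal (2 powr p) * ennreal ?cn) * (ennreal ?cp * powr_ennreal (G x) p) \<partial>M)"
    by (intro nn_integral_mono) (simp add: nn_integral_cmult mult_left_mono dyadic_le_powr_ennreal[OF p])
  also have "\<dots> = (ennreal (2 powr p) * ennreal ?cn * ennreal ?cp) * (\<integral>\<^sup>+x. powr_ennreal (G x) p \<partial>M)"
    by (simp add: nn_integral_cmult mult.assoc)
  also have "ennreal (2 powr p) * ennreal ?cn * ennreal ?cp = ennreal (2 powr p / ((1 - 2 powr - n) * (1 - 2 powr - p)))"
    using c by (simp flip: ennreal_mult)
  finally show ?thesis .
qed

text \<open>Layers with \<open>2 powr j \<le> \<tau>\<close> are measured by \<open>{W \<ge> \<tau>}\<close>, the others by the weak bound.\<close>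

lemma Kolmogorov:
  assumes [measurable]: "W \<in> borel_measurable M" and D: "0 \<le> D" and \<delta>: "0 < \<delta>" "\<delta> < 1" and \<tau>: "0 < \<tau>"
    and weak: "\<And>t. 0 < t \<Longrightarrow> ennreal t * emeasure M {x\<in>space M. ennreal t < W x} \<le> ennreal D"
  shows "(\<integral>\<^sup>+x. powr_ennreal (W x) \<delta> * indicator {x. ennreal \<tau> \<le> W x} x \<partial>M) \<le>
    ennreal (2 powr \<delta> * (2 / (1 - 2 powr - \<delta>) + 1 / (1 - 2 powr (\<delta> - 1))) * D * \<tau> powr (\<delta> - 1))"
proof -
  let ?c1 = "1 / (1 - 2 powr - \<delta>) :: real" and ?c2 = "1 / (1 - 2 powr - (1 - \<delta>)) :: real"
  have c: "2 powr - \<delta> < (1::real)" "2 powr - (1 - \<delta>) < (1::real)"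
    using \<delta> powr_less_mono[of "-\<delta>" 0 2] powr_less_mono[of "-(1 - \<delta>)" 0 2] by auto
  have weak': "emeasure M {x\<in>space M. ennreal t < W x} \<le> ennreal (D / t)" if "0 < t" for t
  proof -
    have "emeasure M {x\<in>space M. ennreal t < W x} = ennreal (1 / t) * (ennreal t * emeasure M {x\<in>space M. ennreal t < W x})"
      using that by (simp add: mult.assoc[symmetric] flip: ennreal_mult)
    also have "\<dots> \<le> ennreal (1 / t) * ennreal D" using weak[OF that] by (rule mult_left_mono) simp
    also have "\<dots> = ennreal (D / t)" using that D by (simp flip: ennreal_mult)
    finally show ?thesis .
  qed
  let ?E = "\<lambda>j::int. {x\<in>space M. ennreal (2 powr real_of_int j) < W x \<and> ennreal \<tau> \<le> W x}"
  have E: "emeasure M (?E j) \<le> ennreal (2 * D / \<tau>) * indicator {j. 2 powr real_of_int j \<le> \<tau>} j +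
      ennreal (D / 2 powr real_of_int j) * indicator {j. \<tau> \<le> 2 powr real_of_int j} j" for j
  proof (cases "2 powr real_of_int j \<le> \<tau>")
    case True
    \<comment> \<open>The weak bound concerns strict superlevel sets, hence the passage to
      \<open>\<tau> / 2\<close> and the \<open>2\<close> in the constant.\<close>
    have "ennreal (\<tau> / 2) < ennreal \<tau>" using \<tau> by (simp add: ennreal_less_iff)
    then have "?E j \<subseteq> {x\<in>space M. ennreal (\<tau> / 2) < W x}" by auto
    then have "emeasure M (?E j) \<le> emeasure M {x\<in>space M. ennreal (\<tau> / 2) < W x}"
      by (intro emeasure_mono) auto
    also have "\<dots> \<le> ennreal (2 * D / \<tau>)" using weak'[of "\<tau> / 2"] \<tau> by (simp add: mult.commute)
    finally show ?thesis using True by (simp add: add_increasing2)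
  next
    case False
    have "emeasure M (?E j) \<le> emeasure M {x\<in>space M. ennreal (2 powr real_of_int j) < W x}"
      by (intro emeasure_mono) auto
    also have "\<dots> \<le> ennreal (D / 2 powr real_of_int j)" by (rule weak') simp
    finally show ?thesis using False by simp
  qed
  have "(\<integral>\<^sup>+x. powr_ennreal (W x) \<delta> * indicator {x. ennreal \<tau> \<le> W x} x \<partial>M) \<le>
    (\<integral>\<^sup>+x. (\<integral>\<^sup>+j. ennreal (2 powr (\<delta> * (real_of_int j + 1))) * indicator (?E j) x \<partial>count_space UNIV) \<partial>M)"
  proof (intro nn_integral_mono)
    fix x assume x: "x \<in> space M"
    show "powr_ennreal (W x) \<delta> * indicator {x. ennreal \<tau> \<le> W x} x \<le>
      (\<integral>\<^sup>+j. ennreal (2 powr (\<delta> * (real_of_int j + 1))) * indicator (?E j) x \<partial>count_space UNIV)"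
    proof (cases "ennreal \<tau> \<le> W x")
      case True
      then show ?thesis using powr_ennreal_le_dyadic[OF \<delta>(1), of "W x"] x by (simp add: indicator_def)
    qed simp
  qed
  also have "\<dots> = (\<integral>\<^sup>+j. \<integral>\<^sup>+x. ennreal (2 powr (\<delta> * (real_of_int j + 1))) * indicator (?E j) x \<partial>M \<partial>count_space UNIV)"
    by (rule nn_integral_count_space_nn_integral) auto
  also have "\<dots> = (\<integral>\<^sup>+j. ennreal (2 powr (\<delta> * (real_of_int j + 1))) * emeasure M (?E j) \<partial>count_space UNIV)"
    by (intro nn_integral_cong nn_integral_cmult_indicator) measurable
  also have "\<dots> \<le> (\<integral>\<^sup>+j. ennreal (2 powr \<delta> * (2 * D / \<tau>)) * (ennreal (2 powr (\<delta> * real_of_int j)) * indicator {j. 2 powr real_of_int j \<le> \<tau>} j) +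
      ennreal (2 powr \<delta> * D) * (ennreal (2 powr (- (1 - \<delta>) * real_of_int j)) * indicator {j. \<tau> \<le> 2 powr real_of_int j} j) \<partial>count_space UNIV)"
  proof (intro nn_integral_mono)
    fix j :: int
    have 1: "2 powr (\<delta> * (real_of_int j + 1)) * (2 * D / \<tau>) = 2 powr \<delta> * (2 * D / \<tau>) * 2 powr (\<delta> * real_of_int j)"
      by (simp add: powr_add algebra_simps)
    have 2: "2 powr (\<delta> * (real_of_int j + 1)) * (D / 2 powr real_of_int j) = 2 powr \<delta> * D * 2 powr (- (1 - \<delta>) * real_of_int j)"
      by (simp add: powr_add powr_diff algebra_simps)
    have "ennreal (2 powr (\<delta> * (real_of_int j + 1))) * emeasure M (?E j) \<le>
      ennreal (2 powr (\<delta> * (real_of_int j + 1))) * (ennreal (2 * D / \<tau>) * indicator {j. 2 powr real_of_int j \<le> \<tau>} j +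
      ennreal (D / 2 powr real_of_int j) * indicator {j. \<tau> \<le> 2 powr real_of_int j} j)"
      by (intro mult_left_mono E) simp
    also have "\<dots> = ennreal (2 powr (\<delta> * (real_of_int j + 1)) * (2 * D / \<tau>)) * indicator {j. 2 powr real_of_int j \<le> \<tau>} j +
      ennreal (2 powr (\<delta> * (real_of_int j + 1)) * (D / 2 powr real_of_int j)) * indicator {j. \<tau> \<le> 2 powr real_of_int j} j"
      by (simp only: distrib_left mult.assoc[symmetric] ennreal_mult'[OF powr_ge_zero, symmetric])
    also have "\<dots> = ennreal (2 powr \<delta> * (2 * D / \<tau>)) * (ennreal (2 powr (\<delta> * real_of_int j)) * indicator {j. 2 powr real_of_int j \<le> \<tau>} j) +
      ennreal (2 powr \<delta> * D) * (ennreal (2 powr (- (1 - \<delta>) * real_of_int j)) * indicator {j. \<tau> \<le> 2 powr real_of_int j} j)"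
      unfolding 1 2 by (simp only: mult.assoc[symmetric] ennreal_mult''[OF powr_ge_zero])
    finally show "ennreal (2 powr (\<delta> * (real_of_int j + 1))) * emeasure M (?E j) \<le>
      ennreal (2 powr \<delta> * (2 * D / \<tau>)) * (ennreal (2 powr (\<delta> * real_of_int j)) * indicator {j. 2 powr real_of_int j \<le> \<tau>} j) +
      ennreal (2 powr \<delta> * D) * (ennreal (2 powr (- (1 - \<delta>) * real_of_int j)) * indicator {j. \<tau> \<le> 2 powr real_of_int j} j)" .
  qed
  also have "\<dots> \<le> ennreal (2 powr \<delta> * (2 * D / \<tau>)) * (ennreal ?c1 * ennreal (\<tau> powr \<delta>)) +
      ennreal (2 powr \<delta> * D) * (ennreal ?c2 * ennreal (\<tau> powr - (1 - \<delta>)))"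
    using \<delta> \<tau> by (simp only: nn_integral_add nn_integral_cmult borel_measurable_count_space)
      (intro add_mono mult_left_mono nn_integral_int_geometric_le nn_integral_int_geometric_ge, auto)
  also have "\<dots> = ennreal (2 powr \<delta> * (2 * D / \<tau>) * (?c1 * \<tau> powr \<delta>) + 2 powr \<delta> * D * (?c2 * \<tau> powr - (1 - \<delta>)))"
    using c D \<tau> by (simp add: ennreal_mult del: times_divide_eq_left times_divide_eq_right)
  also have "2 powr \<delta> * (2 * D / \<tau>) * (?c1 * \<tau> powr \<delta>) + 2 powr \<delta> * D * (?c2 * \<tau> powr - (1 - \<delta>)) =
      2 powr \<delta> * (2 / (1 - 2 powr - \<delta>) + 1 / (1 - 2 powr (\<delta> - 1))) * D * \<tau> powr (\<delta> - 1)"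
    using \<tau> by (simp add: powr_diff algebra_simps)
  finally show ?thesis .
qed

definition Kolmogorov_const :: "real \<Rightarrow> real" where
  "Kolmogorov_const \<delta> = 2 powr \<delta> * (2 / (1 - 2 powr - \<delta>) + 1 / (1 - 2 powr (\<delta> - 1)))"

text \<open>\<open>(n / q - \<Theta>) / 2\<close> is the \<open>\<epsilon>\<close> and
  \<open>(\<Theta> * q / n + 1) / 2\<close> the \<open>\<delta>\<close> of
  \<open>ONeil_dyadic\<close>; the leading \<open>2 powr q\<close> comes from splitting the
  \<open>q\<close>-th power of near plus far terms.\<close>

definition ONeil_const :: "real \<Rightarrow> real \<Rightarrow> real \<Rightarrow> real \<Rightarrow> real" where
  "ONeil_const n q \<Theta> D = 2 powr q * ((1 / (1 - 2 powr - \<Theta>)) powr q +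
    (1 / (1 - 2 powr - ((n / q - \<Theta>) / 2))) powr q * (Kolmogorov_const ((\<Theta> * q / n + 1) / 2) * D))"

text \<open>A Hedberg-type splitting at scale \<open>r\<close>. Small scales interpolate between the
  two bounds of \<open>H k\<close>, with the weights \<open>p / q\<close> and
  \<open>1 - p / q\<close>. Large scales use \<open>a k\<close> alone: each term is at most the
  whole sum with the extra growth \<open>2 powr (\<epsilon> * k)\<close>, and the decay gained makes
  the series summable.\<close>

lemma ONeil_pointwise:
  fixes H a :: "int \<Rightarrow> ennreal" and p q \<alpha> \<Theta> n \<epsilon> r :: real
  assumes p: "1 < p" "p \<le> q" and n: "0 < n" and \<Theta>: "\<Theta> = \<alpha> + n * (1 / q - 1 / p)" "0 < \<Theta>" and \<epsilon>: "0 < \<epsilon>" and r: "0 < r"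
    and H: "\<And>k. H k \<le> g" "\<And>k. H k \<le> a k"
    and I: "(\<integral>\<^sup>+k. ennreal (2 powr (n * real_of_int k)) * powr_ennreal (a k) p \<partial>count_space UNIV) \<le> I"
  shows "powr_ennreal (\<integral>\<^sup>+k. ennreal (2 powr (\<alpha> * real_of_int k)) * H k \<partial>count_space UNIV) q \<le>
    ennreal (2 powr q) * (ennreal ((1 / (1 - 2 powr - \<Theta>)) powr q) * (ennreal (r powr (\<Theta> * q)) * (powr_ennreal g p * powr_ennreal I (q / p - 1))) +
      ennreal ((1 / (1 - 2 powr - \<epsilon>)) powr q) * (ennreal (r powr (- \<epsilon> * q)) *
        (\<integral>\<^sup>+k. ennreal (2 powr ((\<alpha> + \<epsilon>) * q * real_of_int k)) * powr_ennreal (a k) q * indicator {k. r \<le> 2 powr real_of_int k} k \<partial>count_space UNIV)))"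
proof -
  let ?c1 = "1 / (1 - 2 powr - \<Theta>) :: real" and ?c2 = "1 / (1 - 2 powr - \<epsilon>) :: real"
  have c: "0 < ?c1" "0 < ?c2"
    using \<Theta> \<epsilon> powr_less_mono[of "-\<Theta>" 0 2] powr_less_mono[of "-\<epsilon>" 0 2] by auto
  have q: "0 < q" "0 < p" using p by auto
  define Y where "Y = (\<integral>\<^sup>+k. ennreal (2 powr ((\<alpha> + \<epsilon>) * q * real_of_int k)) * powr_ennreal (a k) q *
    indicator {k. r \<le> 2 powr real_of_int k} k \<partial>count_space UNIV)"
  let ?u = "1 / p - 1 / q"
  have u: "0 \<le> ?u" "p * ?u = 1 - p / q" using p by (auto simp: field_simps)
  let ?L = "powr_ennreal g (p / q) * powr_ennreal I ?u"
  have near: "ennreal (2 powr (\<alpha> * real_of_int k)) * H k \<le> ?L * ennreal (2 powr (\<Theta> * real_of_int k))" for k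
  proof -
    have "H k = powr_ennreal (H k) (p / q + (1 - p / q))" by simp
    also have "\<dots> = powr_ennreal (H k) (p / q) * powr_ennreal (H k) (1 - p / q)"
      using p by (intro powr_ennreal_add) auto
    also have "\<dots> \<le> powr_ennreal g (p / q) * powr_ennreal (a k) (1 - p / q)"
      using p H by (intro mult_mono powr_ennreal_mono) auto
    also have "powr_ennreal (a k) (1 - p / q) = powr_ennreal (powr_ennreal (a k) p) ?u"
      using u q by (simp add: powr_ennreal_powr)
    also have "powr_ennreal (a k) p \<le> ennreal (2 powr (- n * real_of_int k)) * I"
    proof -
      have "ennreal (2 powr (n * real_of_int k)) * powr_ennreal (a k) p \<le> I"
        by (rule order_trans[OF nn_integral_ge_point I]) simp
      then have "ennreal (2 powr (- n * real_of_int k)) * (ennreal (2 powr (n * real_of_int k)) * powr_ennreal (a k) p) \<le>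
          ennreal (2 powr (- n * real_of_int k)) * I"
        by (rule mult_left_mono) simp
      then show ?thesis by (simp add: mult.assoc[symmetric] two_powr_mult)
    qed
    then have "powr_ennreal (powr_ennreal (a k) p) ?u \<le> powr_ennreal (ennreal (2 powr (- n * real_of_int k)) * I) ?u"
      by (rule powr_ennreal_mono[OF u(1)])
    then have "powr_ennreal (powr_ennreal (a k) p) ?u \<le> ennreal (2 powr (- n * real_of_int k * ?u)) * powr_ennreal I ?u"
      by (simp only: powr_ennreal_mult[OF u(1)] powr_ennreal_two_powr)
    finally have "ennreal (2 powr (\<alpha> * real_of_int k)) * H k \<le> ennreal (2 powr (\<alpha> * real_of_int k)) *
        (powr_ennreal g (p / q) * (ennreal (2 powr (- n * real_of_int k * ?u)) * powr_ennreal I ?u))"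
      by (simp add: mult_left_mono)
    also have "\<dots> = ?L * (ennreal (2 powr (\<alpha> * real_of_int k)) * ennreal (2 powr (- n * real_of_int k * ?u)))"
      by (simp only: mult_ac)
    \<comment> \<open>Interpolation costs \<open>2 powr (- n * k * (1 / p - 1 / q))\<close>, which
      is exactly the gap between \<open>\<alpha>\<close> and \<open>\<Theta>\<close>.\<close>
    also have "\<alpha> * real_of_int k + - n * real_of_int k * ?u = \<Theta> * real_of_int k"
      by (simp add: \<Theta> algebra_simps)
    then have "ennreal (2 powr (\<alpha> * real_of_int k)) * ennreal (2 powr (- n * real_of_int k * ?u)) = ennreal (2 powr (\<Theta> * real_of_int k))"
      by (simp only: two_powr_mult)
    finally show ?thesis .
  qed
  have far: "ennreal (2 powr (\<alpha> * real_of_int k)) * H k \<le> powr_ennreal Y (1 / q) * ennreal (2 powr (- \<epsilon> * real_of_int k))"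
    if "r \<le> 2 powr real_of_int k" for k
  proof -
    have "ennreal (2 powr ((\<alpha> + \<epsilon>) * q * real_of_int k)) * powr_ennreal (a k) q * indicator {k. r \<le> 2 powr real_of_int k} k \<le> Y"
      unfolding Y_def by (rule nn_integral_ge_point) simp
    then have "powr_ennreal (ennreal (2 powr ((\<alpha> + \<epsilon>) * q * real_of_int k)) * powr_ennreal (a k) q) (1 / q) \<le> powr_ennreal Y (1 / q)"
      using that q by (intro powr_ennreal_mono) auto
    then have "ennreal (2 powr ((\<alpha> + \<epsilon>) * real_of_int k)) * a k \<le> powr_ennreal Y (1 / q)"
      using q by (simp add: powr_ennreal_mult powr_ennreal_two_powr powr_ennreal_powr)
    then have "ennreal (2 powr (- \<epsilon> * real_of_int k)) * (ennreal (2 powr ((\<alpha> + \<epsilon>) * real_of_int k)) * a k) \<le>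
        ennreal (2 powr (- \<epsilon> * real_of_int k)) * powr_ennreal Y (1 / q)"
      by (rule mult_left_mono) simp
    also have "ennreal (2 powr (- \<epsilon> * real_of_int k)) * (ennreal (2 powr ((\<alpha> + \<epsilon>) * real_of_int k)) * a k) = ennreal (2 powr (\<alpha> * real_of_int k)) * a k"
      by (simp add: mult.assoc[symmetric] two_powr_mult algebra_simps)
    finally have *: "ennreal (2 powr (\<alpha> * real_of_int k)) * a k \<le> powr_ennreal Y (1 / q) * ennreal (2 powr (- \<epsilon> * real_of_int k))"
      by (simp only: mult.commute)
    show ?thesis by (rule order_trans[OF mult_left_mono[OF H(2)] *]) simp
  qed
  let ?Z = "powr_ennreal Y (1 / q)"
  have "(\<integral>\<^sup>+k. ennreal (2 powr (\<alpha> * real_of_int k)) * H k \<partial>count_space UNIV) \<le>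
    (\<integral>\<^sup>+k. ?L * (ennreal (2 powr (\<Theta> * real_of_int k)) * indicator {k. 2 powr real_of_int k \<le> r} k) +
      ?Z * (ennreal (2 powr (- \<epsilon> * real_of_int k)) * indicator {k. r \<le> 2 powr real_of_int k} k) \<partial>count_space UNIV)"
  proof (intro nn_integral_mono)
    fix k :: int
    show "ennreal (2 powr (\<alpha> * real_of_int k)) * H k \<le>
      ?L * (ennreal (2 powr (\<Theta> * real_of_int k)) * indicator {k. 2 powr real_of_int k \<le> r} k) +
      ?Z * (ennreal (2 powr (- \<epsilon> * real_of_int k)) * indicator {k. r \<le> 2 powr real_of_int k} k)"
    proof (cases "2 powr real_of_int k \<le> r")
      case True
      then show ?thesis using near[of k] by (simp add: add_increasing2)
    next
      case False
      then show ?thesis using far[of k] by simp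
    qed
  qed
  also have "\<dots> \<le> ?L * (ennreal ?c1 * ennreal (r powr \<Theta>)) + ?Z * (ennreal ?c2 * ennreal (r powr - \<epsilon>))"
    using \<Theta> \<epsilon> r by (simp only: nn_integral_add nn_integral_cmult borel_measurable_count_space)
      (intro add_mono mult_left_mono nn_integral_int_geometric_le nn_integral_int_geometric_ge, auto)
  finally have "powr_ennreal (\<integral>\<^sup>+k. ennreal (2 powr (\<alpha> * real_of_int k)) * H k \<partial>count_space UNIV) q \<le>
    powr_ennreal (?L * (ennreal ?c1 * ennreal (r powr \<Theta>)) + ?Z * (ennreal ?c2 * ennreal (r powr - \<epsilon>))) q"
    using q by (intro powr_ennreal_mono) auto
  also have "\<dots> \<le> ennreal (2 powr q) * (powr_ennreal (?L * (ennreal ?c1 * ennreal (r powr \<Theta>))) q +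
      powr_ennreal (?Z * (ennreal ?c2 * ennreal (r powr - \<epsilon>))) q)"
    using q by (intro powr_ennreal_add_le) auto
  also have "powr_ennreal (?L * (ennreal ?c1 * ennreal (r powr \<Theta>))) q =
      ennreal (?c1 powr q) * (ennreal (r powr (\<Theta> * q)) * (powr_ennreal g p * powr_ennreal I (q / p - 1)))"
  proof -
    have 1: "powr_ennreal ?L q = powr_ennreal g p * powr_ennreal I (q / p - 1)"
    proof -
      have "?u * q = q / p - 1" using q by (simp add: field_simps)
      then show ?thesis using q u by (simp add: powr_ennreal_mult powr_ennreal_powr)
    qed
    have 2: "powr_ennreal (ennreal ?c1) q = ennreal (?c1 powr q)" using c by (intro powr_ennreal_pos)
    have 3: "powr_ennreal (ennreal (r powr \<Theta>)) q = ennreal (r powr (\<Theta> * q))"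
      using r by (simp add: powr_ennreal_pos powr_powr)
    have "powr_ennreal (?L * (ennreal ?c1 * ennreal (r powr \<Theta>))) q =
        powr_ennreal ?L q * (powr_ennreal (ennreal ?c1) q * powr_ennreal (ennreal (r powr \<Theta>)) q)"
      using q by (simp only: powr_ennreal_mult[of q ?L] powr_ennreal_mult[of q "ennreal ?c1"] less_imp_le)
    then show ?thesis unfolding 1 2 3 by (simp only: mult_ac)
  qed
  also have "powr_ennreal (?Z * (ennreal ?c2 * ennreal (r powr - \<epsilon>))) q = ennreal (?c2 powr q) * (ennreal (r powr (- \<epsilon> * q)) * Y)"
  proof -
    have "powr_ennreal ?Z q = Y" using q by (simp add: powr_ennreal_powr)
    moreover have "powr_ennreal (ennreal ?c2) q = ennreal (?c2 powr q)" using c by (intro powr_ennreal_pos)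
    moreover have "powr_ennreal (ennreal (r powr - \<epsilon>)) q = ennreal (r powr (- \<epsilon> * q))"
      using r by (simp add: powr_ennreal_pos powr_powr)
    ultimately show ?thesis using q by (simp only: powr_ennreal_mult less_imp_le mult_ac)
  qed
  finally show ?thesis unfolding Y_def .
qed

text \<open>Every term is at most the total, so \<open>c - 1\<close> of its powers can be replaced
  by those of \<open>I\<close>. With \<open>c = q / p\<close> this raises
  \<open>p\<close>-summability to \<open>q\<close>-summability.\<close>

lemma sum_powr_ennreal_le:
  assumes c: "1 \<le> c" and I: "(\<integral>\<^sup>+k. x k \<partial>count_space UNIV) \<le> I"
  shows "(\<integral>\<^sup>+k. powr_ennreal (x k) c \<partial>count_space UNIV) \<le> powr_ennreal I c"
proof -
  have "powr_ennreal (x k) c \<le> x k * powr_ennreal I (c - 1)" for k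
  proof -
    have "x k \<le> I" by (rule order_trans[OF nn_integral_ge_point I]) simp
    then have "x k * powr_ennreal (x k) (c - 1) \<le> x k * powr_ennreal I (c - 1)"
      using c by (intro mult_left_mono powr_ennreal_mono) auto
    then show ?thesis using c powr_ennreal_add[of 1 "c - 1" "x k"] by simp
  qed
  then have "(\<integral>\<^sup>+k. powr_ennreal (x k) c \<partial>count_space UNIV) \<le> (\<integral>\<^sup>+k. x k * powr_ennreal I (c - 1) \<partial>count_space UNIV)"
    by (intro nn_integral_mono)
  also have "\<dots> = (\<integral>\<^sup>+k. x k \<partial>count_space UNIV) * powr_ennreal I (c - 1)"
    by (rule nn_integral_multc) simp
  also have "\<dots> \<le> I * powr_ennreal I (c - 1)" using I by (rule mult_right_mono) simp
  finally show ?thesis using c powr_ennreal_add[of 1 "c - 1" I] by simp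
qed

lemma borel_measurable_nn_integral_int:
  fixes f :: "int \<Rightarrow> 'a \<Rightarrow> ennreal"
  assumes "\<And>k. f k \<in> borel_measurable M"
  shows "(\<lambda>x. \<integral>\<^sup>+k. f k x \<partial>count_space UNIV) \<in> borel_measurable M"
proof -
  have "(\<integral>\<^sup>+k. f k x \<partial>count_space UNIV) = (\<Sum>i. f (int_decode i) x)" for x
    by (subst nn_integral_bij_count_space[OF bij_int_decode, symmetric]) (rule nn_integral_count_space_nat)
  with assms show ?thesis by simp
qed

lemma weak_type_AE_finite:
  assumes [measurable]: "W \<in> borel_measurable M"
    and weak: "\<And>t. 0 < t \<Longrightarrow> ennreal t * emeasure M {x\<in>space M. ennreal t < W x} \<le> ennreal D"
  shows "AE x in M. W x < \<infinity>"
proof -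
  let ?E = "{x\<in>space M. W x = \<infinity>}"
  have [measurable]: "?E \<in> sets M" by measurable
  have le: "ennreal t * emeasure M ?E \<le> ennreal D" if "0 < t" for t
  proof -
    have "emeasure M ?E \<le> emeasure M {x\<in>space M. ennreal t < W x}"
      by (intro emeasure_mono) auto
    then show ?thesis using weak[OF that] by (meson mult_left_mono order_trans zero_le)
  qed
  have "emeasure M ?E = 0"
  proof (cases "emeasure M ?E")
    case (real e)
    have "e = 0"
    proof (rule ccontr)
      assume "e \<noteq> 0"
      with real have e: "0 < e" by simp
      have "ennreal ((\<bar>D\<bar> + 1) / e) * ennreal e \<le> ennreal D"
        using le[of "(\<bar>D\<bar> + 1) / e"] e real by simp
      then have "ennreal (\<bar>D\<bar> + 1) \<le> ennreal D" using e by (simp flip: ennreal_mult)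
      also have "ennreal D \<le> ennreal \<bar>D\<bar>" by (intro ennreal_leI) simp
      finally show False by (subst (asm) ennreal_le_iff) auto
    qed
    with real show ?thesis by simp
  next
    case top
    then show ?thesis using le[of 1] by (simp add: top_unique)
  qed
  then have "AE x in M. x \<notin> ?E" by (intro AE_not_in) (simp add: null_sets_def)
  then show ?thesis using AE_space by eventually_elim (auto simp: less_top)
qed

text \<open>\<open>H k\<close>, \<open>a k\<close> and \<open>W\<close> stand for the weighted
  average at scale \<open>2 powr k\<close>, its bound independent of the point, and the maximal
  function of \<open>g\<close> normalized by its norm. After the pointwise splitting, integration in
  \<open>x\<close> meets Kolmogorov's inequality at height \<open>2 powr (- n * k)\<close> for every
  \<open>k\<close>.\<close>

lemma ONeil_dyadic:
  fixes H :: "int \<Rightarrow> 'a \<Rightarrow> ennreal" and a :: "int \<Rightarrow> ennreal" and p q \<alpha> \<Theta> n D :: real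
  assumes p: "1 < p" "p \<le> q" and n: "0 < n" and \<Theta>: "\<Theta> = \<alpha> + n * (1 / q - 1 / p)" "0 < \<Theta>" "\<Theta> * q < n" and D: "0 \<le> D"
    and [measurable]: "g \<in> borel_measurable M" "W \<in> borel_measurable M"
    and weak: "\<And>t. 0 < t \<Longrightarrow> ennreal t * emeasure M {x\<in>space M. ennreal t < W x} \<le> ennreal D"
    and H: "AE x in M. \<forall>k. H k x \<le> g x \<and> H k x \<le> a k"
    and g: "(\<integral>\<^sup>+x. powr_ennreal (g x) p \<partial>M) \<le> I"
    and a: "(\<integral>\<^sup>+k. ennreal (2 powr (n * real_of_int k)) * powr_ennreal (a k) p \<partial>count_space UNIV) \<le> I"
  shows "(\<integral>\<^sup>+x. powr_ennreal (W x) (\<Theta> * q / n) *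
      powr_ennreal (\<integral>\<^sup>+k. ennreal (2 powr (\<alpha> * real_of_int k)) * H k x \<partial>count_space UNIV) q \<partial>M)
    \<le> ennreal (ONeil_const n q \<Theta> D) * powr_ennreal I (q / p)"
proof -
  \<comment> \<open>Any \<open>\<epsilon>\<close> in \<open>(0, n / q - \<Theta>)\<close> would do: Kolmogorov's inequality needs \<open>\<delta> < 1\<close>.\<close>
  define \<epsilon> where "\<epsilon> = (n / q - \<Theta>) / 2"
  define \<delta> where "\<delta> = (\<Theta> * q / n + 1) / 2"
  have q: "0 < q" "0 < p" using p by auto
  have \<epsilon>: "0 < \<epsilon>" using \<Theta> q by (simp add: \<epsilon>_def field_simps)
  have "0 \<le> \<Theta> * q / n" "\<Theta> * q / n < 1" using \<Theta>(2,3) q n by auto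
  then have \<delta>: "0 < \<delta>" "\<delta> < 1" by (auto simp: \<delta>_def)
  have \<epsilon>\<delta>: "(\<Theta> + \<epsilon>) * q / n = \<delta>" using q n by (simp add: \<epsilon>_def \<delta>_def field_simps)
  have fin: "AE x in M. W x < \<infinity>"
    by (rule weak_type_AE_finite) (measurable, erule weak)
  define c1 where "c1 = (1 / (1 - 2 powr - \<Theta>)) powr q"
  define c2 where "c2 = (1 / (1 - 2 powr - \<epsilon>)) powr q"
  have c: "0 \<le> c1" "0 \<le> c2" by (simp_all add: c1_def c2_def)
  let ?J = "powr_ennreal I (q / p - 1)"
  let ?b = "\<lambda>k::int. ennreal (2 powr ((\<alpha> + \<epsilon>) * q * real_of_int k)) * powr_ennreal (a k) q"
  let ?w = "\<lambda>k::int. \<lambda>x. powr_ennreal (W x) \<delta> * indicator {x. ennreal (2 powr (- n * real_of_int k)) \<le> W x} x"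
  have "(\<integral>\<^sup>+x. powr_ennreal (W x) (\<Theta> * q / n) *
      powr_ennreal (\<integral>\<^sup>+k. ennreal (2 powr (\<alpha> * real_of_int k)) * H k x \<partial>count_space UNIV) q \<partial>M)
    \<le> (\<integral>\<^sup>+x. ennreal (2 powr q) * (ennreal c1 * (powr_ennreal (g x) p * ?J) +
        ennreal c2 * (\<integral>\<^sup>+k. ?b k * ?w k x \<partial>count_space UNIV)) \<partial>M)"
  proof (rule nn_integral_mono_AE)
    show "AE x in M. powr_ennreal (W x) (\<Theta> * q / n) *
      powr_ennreal (\<integral>\<^sup>+k. ennreal (2 powr (\<alpha> * real_of_int k)) * H k x \<partial>count_space UNIV) q
      \<le> ennreal (2 powr q) * (ennreal c1 * (powr_ennreal (g x) p * ?J) +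
        ennreal c2 * (\<integral>\<^sup>+k. ?b k * ?w k x \<partial>count_space UNIV))"
      using H fin
    proof eventually_elim
      case (elim x)
      show ?case
      proof (cases "W x = 0")
        case True
        then show ?thesis using \<Theta>(2) q n by simp
      next
        case False
        with elim obtain w where w: "W x = ennreal w" "0 < w"
          by (cases "W x") (auto simp: less_le)
        \<comment> \<open>Chosen so that \<open>W x * r powr n = 1\<close>: the near part loses its
          dependence on \<open>W\<close>, and \<open>r \<le> 2 powr k\<close> becomes
          \<open>2 powr (- n * k) \<le> W x\<close>.\<close>
        define r where "r = w powr (- (1 / n))"
        have r: "0 < r" using w by (simp add: r_def)
        have Wr: "powr_ennreal (W x) (\<Theta> * q / n) = ennreal (r powr (- \<Theta> * q))"
          using w by (simp add: powr_ennreal_pos r_def powr_powr)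
        have W\<delta>: "powr_ennreal (W x) \<delta> = ennreal (r powr (- (\<Theta> + \<epsilon>) * q))"
        proof -
          have "- (1 / n) * (- (\<Theta> + \<epsilon>) * q) = \<delta>" unfolding \<epsilon>\<delta>[symmetric] using n by (simp add: field_simps)
          then show ?thesis by (simp only: w powr_ennreal_pos r_def powr_powr)
        qed
        have ind: "indicator {k. r \<le> 2 powr real_of_int k} k = (indicator {x. ennreal (2 powr (- n * real_of_int k)) \<le> W x} x :: ennreal)" for k
        proof -
          have "r \<le> 2 powr real_of_int k \<longleftrightarrow> ln r \<le> ln (2 powr real_of_int k)"
            using r by (intro ln_le_cancel_iff[symmetric]) auto
          also have "\<dots> \<longleftrightarrow> - n * real_of_int k * ln 2 \<le> ln w"
            using w n by (simp add: r_def ln_powr field_simps) linarith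
          also have "\<dots> \<longleftrightarrow> ln (2 powr (- n * real_of_int k)) \<le> ln w" by (simp add: ln_powr)
          also have "\<dots> \<longleftrightarrow> 2 powr (- n * real_of_int k) \<le> w" using w by (intro ln_le_cancel_iff) auto
          finally show ?thesis using w by (simp add: indicator_def)
        qed
        have "powr_ennreal (W x) (\<Theta> * q / n) *
          powr_ennreal (\<integral>\<^sup>+k. ennreal (2 powr (\<alpha> * real_of_int k)) * H k x \<partial>count_space UNIV) q \<le>
          ennreal (r powr (- \<Theta> * q)) * (ennreal (2 powr q) * (ennreal c1 * (ennreal (r powr (\<Theta> * q)) * (powr_ennreal (g x) p * ?J)) +
            ennreal c2 * (ennreal (r powr (- \<epsilon> * q)) * (\<integral>\<^sup>+k. ?b k * indicator {k. r \<le> 2 powr real_of_int k} k \<partial>count_space UNIV))))"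
          unfolding Wr c1_def c2_def using elim
          by (intro mult_left_mono ONeil_pointwise[where n = n and p = p and \<alpha> = \<alpha>] p n \<Theta> \<epsilon> r a) auto
        also have "\<dots> = ennreal (2 powr q) * (ennreal c1 * ((ennreal (r powr (- \<Theta> * q)) * ennreal (r powr (\<Theta> * q))) * (powr_ennreal (g x) p * ?J)) +
            ennreal c2 * ((ennreal (r powr (- \<Theta> * q)) * ennreal (r powr (- \<epsilon> * q))) *
              (\<integral>\<^sup>+k. ?b k * indicator {k. r \<le> 2 powr real_of_int k} k \<partial>count_space UNIV)))"
          by (simp only: distrib_left mult_ac)
        also have "ennreal (r powr (- \<Theta> * q)) * ennreal (r powr (\<Theta> * q)) = 1"
          using r by (simp add: powr_minus flip: ennreal_mult)
        also have "ennreal (r powr (- \<Theta> * q)) * ennreal (r powr (- \<epsilon> * q)) = powr_ennreal (W x) \<delta>"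
          unfolding W\<delta> using r by (simp add: algebra_simps flip: ennreal_mult powr_add)
        also have "powr_ennreal (W x) \<delta> * (\<integral>\<^sup>+k. ?b k * indicator {k. r \<le> 2 powr real_of_int k} k \<partial>count_space UNIV)
          = (\<integral>\<^sup>+k. ?b k * ?w k x \<partial>count_space UNIV)"
          unfolding ind by (subst nn_integral_cmult[symmetric]) (auto intro!: nn_integral_cong simp only: mult_ac borel_measurable_count_space)
        finally show ?thesis by simp
      qed
    qed
  qed
  also have "\<dots> = ennreal (2 powr q) * (ennreal c1 * ((\<integral>\<^sup>+x. powr_ennreal (g x) p \<partial>M) * ?J) +
        ennreal c2 * (\<integral>\<^sup>+x. \<integral>\<^sup>+k. ?b k * ?w k x \<partial>count_space UNIV \<partial>M))"
  proof -
    have [measurable]: "(\<lambda>x. \<integral>\<^sup>+k. ?b k * ?w k x \<partial>count_space UNIV) \<in> borel_measurable M"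
      by (rule borel_measurable_nn_integral_int) measurable
    show ?thesis
      by (subst nn_integral_cmult, measurable, subst nn_integral_add, measurable, subst nn_integral_cmult, measurable,
          subst nn_integral_multc, measurable, subst nn_integral_cmult, measurable)
  qed
  also have "(\<integral>\<^sup>+x. \<integral>\<^sup>+k. ?b k * ?w k x \<partial>count_space UNIV \<partial>M) = (\<integral>\<^sup>+k. \<integral>\<^sup>+x. ?b k * ?w k x \<partial>M \<partial>count_space UNIV)"
    by (rule nn_integral_count_space_nn_integral) auto
  also have "\<dots> = (\<integral>\<^sup>+k. ?b k * (\<integral>\<^sup>+x. ?w k x \<partial>M) \<partial>count_space UNIV)"
    by (intro nn_integral_cong nn_integral_cmult) measurable
  also have "\<dots> \<le> (\<integral>\<^sup>+k. ennreal (Kolmogorov_const \<delta> * D) *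
      powr_ennreal (ennreal (2 powr (n * real_of_int k)) * powr_ennreal (a k) p) (q / p) \<partial>count_space UNIV)"
  proof (intro nn_integral_mono)
    fix k :: int
    have "(\<integral>\<^sup>+x. ?w k x \<partial>M) \<le> ennreal (Kolmogorov_const \<delta> * D * (2 powr (- n * real_of_int k)) powr (\<delta> - 1))"
      unfolding Kolmogorov_const_def by (intro Kolmogorov \<delta> D weak) auto
    also have "\<dots> = ennreal (Kolmogorov_const \<delta> * D) * ennreal (2 powr (- n * real_of_int k * (\<delta> - 1)))"
      by (simp add: powr_powr ennreal_mult'')
    finally have "?b k * (\<integral>\<^sup>+x. ?w k x \<partial>M) \<le> ?b k * (ennreal (Kolmogorov_const \<delta> * D) * ennreal (2 powr (- n * real_of_int k * (\<delta> - 1))))"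
      by (rule mult_left_mono) simp
    also have "\<dots> = ennreal (Kolmogorov_const \<delta> * D) *
        ((ennreal (2 powr ((\<alpha> + \<epsilon>) * q * real_of_int k)) * ennreal (2 powr (- n * real_of_int k * (\<delta> - 1)))) * powr_ennreal (a k) q)"
      by (simp only: mult_ac)
    \<comment> \<open>The balance of exponents: \<open>\<epsilon>\<close> drops out against
      \<open>n * \<delta>\<close>, leaving the power of \<open>2 powr (n * k)\<close> for which the
      sum is one of \<open>q / p\<close>-th powers.\<close>
    also have "(\<alpha> + \<epsilon>) * q * real_of_int k + - n * real_of_int k * (\<delta> - 1) = n * real_of_int k * (q / p)"
    proof -
      have "n * \<delta> = (\<Theta> + \<epsilon>) * q" using n by (simp flip: \<epsilon>\<delta>)
      then have "(\<alpha> + \<epsilon>) * q - n * (\<delta> - 1) = (\<alpha> - \<Theta>) * q + n" by (simp add: algebra_simps)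
      also have "\<dots> = n * (q / p)" using q by (simp add: \<Theta> field_simps)
      finally have "((\<alpha> + \<epsilon>) * q - n * (\<delta> - 1)) * real_of_int k = n * (q / p) * real_of_int k" by simp
      then show ?thesis by (simp add: algebra_simps)
    qed
    then have "ennreal (2 powr ((\<alpha> + \<epsilon>) * q * real_of_int k)) * ennreal (2 powr (- n * real_of_int k * (\<delta> - 1))) =
        ennreal (2 powr (n * real_of_int k * (q / p)))"
      by (simp only: two_powr_mult)
    also have "ennreal (2 powr (n * real_of_int k * (q / p))) * powr_ennreal (a k) q =
        powr_ennreal (ennreal (2 powr (n * real_of_int k)) * powr_ennreal (a k) p) (q / p)"
      using q by (simp add: powr_ennreal_mult powr_ennreal_two_powr powr_ennreal_powr)
    finally show "?b k * (\<integral>\<^sup>+x. ?w k x \<partial>M) \<le> ennreal (Kolmogorov_const \<delta> * D) *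
      powr_ennreal (ennreal (2 powr (n * real_of_int k)) * powr_ennreal (a k) p) (q / p)" .
  qed
  also have "\<dots> \<le> ennreal (Kolmogorov_const \<delta> * D) * powr_ennreal I (q / p)"
    using p a by (simp add: nn_integral_cmult mult_left_mono sum_powr_ennreal_le)
  finally have "(\<integral>\<^sup>+x. powr_ennreal (W x) (\<Theta> * q / n) *
      powr_ennreal (\<integral>\<^sup>+k. ennreal (2 powr (\<alpha> * real_of_int k)) * H k x \<partial>count_space UNIV) q \<partial>M)
    \<le> ennreal (2 powr q) * (ennreal c1 * ((\<integral>\<^sup>+x. powr_ennreal (g x) p \<partial>M) * ?J) +
        ennreal c2 * (ennreal (Kolmogorov_const \<delta> * D) * powr_ennreal I (q / p)))"
    by (simp add: add_left_mono mult_left_mono)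
  also have "\<dots> \<le> ennreal (2 powr q) * (ennreal c1 * (I * ?J) +
        ennreal c2 * (ennreal (Kolmogorov_const \<delta> * D) * powr_ennreal I (q / p)))"
    using g by (intro mult_left_mono add_right_mono mult_right_mono) auto
  also have "I * ?J = powr_ennreal I (q / p)"
    using p powr_ennreal_add[of 1 "q / p - 1" I] by simp
  also have "ennreal (2 powr q) * (ennreal c1 * powr_ennreal I (q / p) + ennreal c2 * (ennreal (Kolmogorov_const \<delta> * D) * powr_ennreal I (q / p)))
    = (ennreal (2 powr q) * (ennreal c1 + ennreal c2 * ennreal (Kolmogorov_const \<delta> * D))) * powr_ennreal I (q / p)"
    by (simp only: distrib_left distrib_right mult.assoc)
  also have "ennreal (2 powr q) * (ennreal c1 + ennreal c2 * ennreal (Kolmogorov_const \<delta> * D)) = ennreal (ONeil_const n q \<Theta> D)"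
  proof -
    have "2 powr - \<delta> < (1::real)" "2 powr (\<delta> - 1) < (1::real)"
      using \<delta> powr_less_mono[of "-\<delta>" 0 2] powr_less_mono[of "\<delta> - 1" 0 2] by auto
    then have "0 \<le> Kolmogorov_const \<delta> * D" using D by (simp add: Kolmogorov_const_def)
    then show ?thesis using c
      by (simp add: ONeil_const_def c1_def c2_def \<delta>_def \<epsilon>_def flip: ennreal_mult ennreal_plus)
  qed
  finally show ?thesis .
qed

section \<open>Maximal function estimates for an \<open>A\<^sub>1\<close> weight\<close>

lemma ennreal_times_divide_cancel: "b \<noteq> 0 \<Longrightarrow> b \<noteq> top \<Longrightarrow> b * (x / b) = (x :: ennreal)"
  using mult_divide_eq_ennreal[of b x] by (simp add: ennreal_times_divide mult.commute)

lemma AE_exists_cube: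
  fixes a :: "real^'n"
  assumes "AE x in lebesgue. P x" "0 < l"
  shows "\<exists>x\<in>cube a l. P x"
proof (rule ccontr)
  assume "\<not> ?thesis"
  then have "P x \<Longrightarrow> x \<notin> cube a l" for x by auto
  with assms(1) have "AE x in lebesgue. x \<notin> cube a l" by (rule eventually_mono)
  then have "emeasure lebesgue (cube a l) = 0"
    using AE_iff_measurable[of "cube a l" lebesgue "\<lambda>x. x \<notin> cube a l"] by auto
  then show False using assms(2) by (simp add: emeasure_cube)
qed

lemma doubling_lebesgue: "doubling_measure (lebesgue :: (real^'n) measure) (3 powr real CARD('n))"
proof
  fix a :: "real^'n" and l :: real
  show "emeasure lebesgue (cube a l) < \<infinity>"
    using emeasure_lborel_cbox_finite[of a "a + (\<chi> i. l)"] by (simp add: cube_def emeasure_completion)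
qed (auto simp: emeasure_cube powr_mult ennreal_mult)

text \<open>One null set serves all cubes, as the supremum in the maximal function demands. The
  constant is kept abstract; it is instantiated only in the final theorem.\<close>

locale A1_weight =
  fixes s :: "real^'n \<Rightarrow> real" and A :: real
  assumes s_measurable [measurable]: "s \<in> borel_measurable lebesgue"
    and s_pos: "\<And>x. 0 < s x" and A_pos: "0 < A"
    and A1: "AE x in lebesgue. \<forall>a l. 0 < l \<longrightarrow> x \<in> cube a l \<longrightarrow>
      (\<integral>\<^sup>+y\<in>cube a l. ennreal (s y) \<partial>lebesgue) \<le> ennreal (A * s x) * emeasure lebesgue (cube a l)"
begin

definition \<nu> :: "(real^'n) measure" where "\<nu> = density lebesgue (\<lambda>x. ennreal (s x))"

lemma emeasure_\<nu>: "emeasure \<nu> (cube a l) = (\<integral>\<^sup>+y\<in>cube a l. ennreal (s y) \<partial>lebesgue)"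
  unfolding \<nu>_def by (rule emeasure_density) auto

lemma emeasure_\<nu>_finite: "emeasure \<nu> (cube a l) < \<infinity>"
proof -
  \<comment> \<open>Finiteness is claimed also for \<open>l \<le> 0\<close>, where \<open>A1\<close>
    says nothing, hence the larger cube. A single point of it satisfying \<open>A1\<close> is
    enough.\<close>
  obtain x where x: "x \<in> cube a (max l 1)" "(\<integral>\<^sup>+y\<in>cube a (max l 1). ennreal (s y) \<partial>lebesgue)
      \<le> ennreal (A * s x) * emeasure lebesgue (cube a (max l 1))"
  proof -
    have "0 < max l 1" by simp
    from AE_exists_cube[OF A1 this, of a] this show ?thesis using that by blast
  qed
  have "emeasure \<nu> (cube a l) \<le> emeasure \<nu> (cube a (max l 1))"
  proof (rule emeasure_mono)
    show "cube a l \<subseteq> cube a (max l 1)"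
    proof
      fix x assume "x \<in> cube a l"
      then have "a $ i \<le> x $ i \<and> x $ i \<le> a $ i + max l 1" for i
        by (simp add: mem_cube) (smt (verit))
      then show "x \<in> cube a (max l 1)" by (simp add: mem_cube)
    qed
  qed (simp add: \<nu>_def)
  also have "\<dots> \<le> ennreal (A * s x) * emeasure lebesgue (cube a (max l 1))"
    unfolding emeasure_\<nu> by (rule x)
  also have "\<dots> < \<infinity>" by (simp add: emeasure_cube ennreal_mult_less_top)
  finally show ?thesis .
qed

lemma emeasure_\<nu>_pos:
  assumes "0 < l"
  shows "0 < emeasure \<nu> (cube a l)"
proof (rule ccontr)
  assume "\<not> ?thesis"
  then have "(\<integral>\<^sup>+y\<in>cube a l. ennreal (s y) \<partial>lebesgue) = 0" by (simp add: emeasure_\<nu>)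
  then have "AE y in lebesgue. ennreal (s y) * indicator (cube a l) y = 0"
    by (subst (asm) nn_integral_0_iff_AE) auto
  from AE_exists_cube[OF this assms, of a] obtain x where "s x \<le> 0"
    by (auto simp: ennreal_eq_0_iff)
  with s_pos[of x] show False by simp
qed

definition mean :: "real^'n \<Rightarrow> real \<Rightarrow> real" where
  "mean a l = measure \<nu> (cube a l) / l powr real CARD('n)"

lemma emeasure_\<nu>_eq:
  assumes "0 < l"
  shows "emeasure \<nu> (cube a l) = ennreal (mean a l * l powr real CARD('n))"
  using assms emeasure_\<nu>_finite[of a l] by (simp add: mean_def emeasure_eq_ennreal_measure)

lemma mean_pos:
  assumes "0 < l"
  shows "0 < mean a l"
  using assms emeasure_\<nu>_pos[OF assms, of a] emeasure_\<nu>_finite[of a l]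
  by (auto simp: mean_def measure_def enn2real_positive_iff)

lemma mean_le: "AE x in lebesgue. \<forall>a l. 0 < l \<longrightarrow> x \<in> cube a l \<longrightarrow> mean a l \<le> A * s x"
  using A1
proof eventually_elim
  case (elim x)
  show ?case
  proof (intro allI impI)
    fix a l assume *: "0 < l" "x \<in> cube a l"
    with elim have "ennreal (mean a l * l powr real CARD('n)) \<le> ennreal (A * s x) * ennreal (l powr real CARD('n))"
      by (simp add: emeasure_cube flip: emeasure_\<nu>_eq emeasure_\<nu>)
    then have "mean a l * l powr real CARD('n) \<le> A * s x * l powr real CARD('n)"
      using A_pos s_pos[of x] by (subst (asm) ennreal_mult[symmetric]) (auto simp: ennreal_le_iff)
    then show "mean a l \<le> A * s x" using *(1) by simp
  qed
qed

text \<open>Powers of \<open>v\<close> are nonpositive powers of \<open>s\<close>, so the lower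
  bound on \<open>s\<close> becomes an upper bound. It is used with \<open>c = 1 / p - 1\<close>,
  which is \<open>v powr (1 / p)\<close>, and \<open>c = q * (1 / p - 1)\<close>, which is
  \<open>v powr (q / p)\<close>.\<close>

lemma powr_le_mean:
  assumes c: "c \<le> 0"
  shows "AE x in lebesgue. \<forall>a l. 0 < l \<longrightarrow> x \<in> cube a l \<longrightarrow> s x powr c \<le> A powr (- c) * mean a l powr c"
  using mean_le
proof eventually_elim
  case (elim x)
  show ?case
  proof (intro allI impI)
    fix a l assume *: "0 < l" "x \<in> cube a l"
    then have "mean a l / A \<le> s x" using elim A_pos by (simp add: field_simps)
    then have "s x powr c \<le> (mean a l / A) powr c"
      using mean_pos[OF *(1), of a] A_pos c by (intro powr_mono2') auto
    also have "\<dots> = A powr (- c) * mean a l powr c"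
      using mean_pos[OF *(1), of a] A_pos by (simp add: powr_divide powr_minus field_simps)
    finally show "s x powr c \<le> A powr (- c) * mean a l powr c" .
  qed
qed

text \<open>The triple of \<open>Q\<close> is also a cube around each point of \<open>Q\<close>;
  integrating the \<open>A_1\<close> estimate for the triple over \<open>Q\<close> gives
  \<open>|Q| * \<nu>(3Q) \<le> A * |3Q| * \<nu>(Q)\<close>.\<close>

sublocale doubling_measure \<nu> "A * 3 powr real CARD('n)"
proof
  fix a :: "real^'n" and l :: real
  show "sets \<nu> = sets lebesgue" by (simp add: \<nu>_def)
  show "emeasure \<nu> (cube a l) < \<infinity>" by (rule emeasure_\<nu>_finite)
  assume l: "0 < l"
  show "0 < emeasure \<nu> (cube a l)" using l by (rule emeasure_\<nu>_pos)
  define L where "L = l powr real CARD('n)"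
  define T where "T = (3 * l) powr real CARD('n)"
  have L: "0 < L" "0 < T" "T = 3 powr real CARD('n) * L" using l by (auto simp: L_def T_def powr_mult)
  let ?Q = "cube a l" and ?S = "emeasure \<nu> (cube (a - (\<chi> i. l)) (3 * l))"
  have sub: "?Q \<subseteq> cube (a - (\<chi> i. l)) (3 * l)"
  proof
    fix x assume x: "x \<in> cube a l"
    have "a $ i - l \<le> x $ i \<and> x $ i \<le> a $ i - l + 3 * l" for i
    proof -
      have "a $ i \<le> x $ i" "x $ i \<le> a $ i + l" using x by (auto simp: mem_cube)
      then show ?thesis using l by linarith
    qed
    then show "x \<in> cube (a - (\<chi> i. l)) (3 * l)" by (simp add: mem_cube)
  qed
  have "ennreal L * ?S = (\<integral>\<^sup>+x\<in>?Q. ?S \<partial>lebesgue)"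
    using l by (subst nn_integral_cmult_indicator) (simp_all add: emeasure_cube L_def mult.commute)
  also have "\<dots> \<le> (\<integral>\<^sup>+x. ennreal (A * T) * (ennreal (s x) * indicator ?Q x) \<partial>lebesgue)"
  proof (rule nn_integral_mono_AE)
    show "AE x in lebesgue. ?S * indicator ?Q x \<le> ennreal (A * T) * (ennreal (s x) * indicator ?Q x)"
      using A1
    proof eventually_elim
      case (elim x)
      show ?case
      proof (cases "x \<in> ?Q")
        case True
        then have "?S \<le> ennreal (A * s x) * ennreal T"
          using elim[rule_format, of "3 * l" "a - (\<chi> i. l)"] l sub by (auto simp: emeasure_\<nu> emeasure_cube T_def)
        also have "\<dots> = ennreal (A * T) * ennreal (s x)"
          using A_pos s_pos[of x] L by (simp add: mult_ac flip: ennreal_mult)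
        finally show ?thesis using True by simp
      qed simp
    qed
  qed
  also have "\<dots> = ennreal (A * T) * emeasure \<nu> ?Q"
    by (simp add: nn_integral_cmult emeasure_\<nu>)
  also have "\<dots> = ennreal L * (ennreal (A * 3 powr real CARD('n)) * emeasure \<nu> ?Q)"
  proof -
    have "ennreal (A * T) = ennreal L * ennreal (A * 3 powr real CARD('n))"
      using L A_pos by (simp add: mult_ac flip: ennreal_mult)
    then show ?thesis by (simp only: mult.assoc)
  qed
  finally show "?S \<le> ennreal (A * 3 powr real CARD('n)) * emeasure \<nu> ?Q"
    using L by (simp add: ennreal_mult_le_mult_iff)
qed

lemma nn_integral_\<nu>:
  "f \<in> borel_measurable lebesgue \<Longrightarrow> (\<integral>\<^sup>+x. f x \<partial>\<nu>) = (\<integral>\<^sup>+x. ennreal (s x) * f x \<partial>lebesgue)"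
  unfolding \<nu>_def by (rule nn_integral_density) auto

lemma nn_integral_cube_\<nu>:
  assumes [measurable]: "f \<in> borel_measurable lebesgue"
  shows "(\<integral>\<^sup>+y\<in>cube a l. f y * ennreal (1 / s y) \<partial>\<nu>) = (\<integral>\<^sup>+y\<in>cube a l. f y \<partial>lebesgue)"
proof -
  have "ennreal (s y) * ennreal (1 / s y) = 1" for y using s_pos[of y] by (simp flip: ennreal_mult)
  then have "ennreal (s y) * (f y * ennreal (1 / s y) * indicator (cube a l) y) = f y * indicator (cube a l) y" for y
    by (metis mult.assoc mult.commute mult_1)
  then show ?thesis by (subst nn_integral_\<nu>) auto
qed

text \<open>An average of \<open>f\<close> is the \<open>\<nu>\<close>-average of
  \<open>f / s\<close> times the mean of \<open>s\<close>, and the latter is at most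
  \<open>A * s x\<close>.\<close>

lemma maximal_le:
  assumes [measurable]: "f \<in> borel_measurable lebesgue"
  shows "AE x in lebesgue. weighted_maximal lebesgue f x \<le>
    ennreal (A * s x) * weighted_maximal \<nu> (\<lambda>y. f y * ennreal (1 / s y)) x"
  using A1
proof eventually_elim
  case (elim x)
  show ?case
  proof (rule weighted_maximal_least)
    fix a l assume *: "0 < l" "x \<in> cube a l"
    let ?Q = "cube a l" and ?I = "\<integral>\<^sup>+y\<in>cube a l. f y \<partial>lebesgue"
    let ?S = "emeasure \<nu> ?Q" and ?L = "emeasure lebesgue ?Q"
    have S: "?S \<noteq> 0" "?S \<noteq> top" using emeasure_\<nu>_pos[OF *(1), of a] emeasure_\<nu>_finite[of a l] by auto
    have L: "?L \<noteq> 0" "?L \<noteq> top" using *(1) by (auto simp: emeasure_cube)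
    have "?I = ?I / ?S * ?S"
      using ennreal_times_divide_cancel[OF S] by (simp add: mult.commute)
    also have "\<dots> \<le> ?I / ?S * (ennreal (A * s x) * ?L)"
      using elim * by (intro mult_left_mono) (auto simp: emeasure_\<nu>)
    also have "\<dots> = ?L * (?I / ?S * ennreal (A * s x))" by (simp only: mult_ac)
    finally have "?L * (?I / ?L) \<le> ?L * (?I / ?S * ennreal (A * s x))"
      by (simp only: ennreal_times_divide_cancel[OF L])
    then have "?I / ?L \<le> ennreal (A * s x) * (?I / ?S)"
      using L by (simp add: ennreal_mult_le_mult_iff mult.commute)
    also have "?I / ?S \<le> weighted_maximal \<nu> (\<lambda>y. f y * ennreal (1 / s y)) x"
      using average_le_weighted_maximal[OF *, where h = "\<lambda>y. f y * ennreal (1 / s y)" and \<mu> = \<nu>]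
      by (simp add: nn_integral_cube_\<nu>)
    finally show "?I / ?L \<le> ennreal (A * s x) * weighted_maximal \<nu> (\<lambda>y. f y * ennreal (1 / s y)) x"
      by (simp add: mult_left_mono)
  qed
qed

text \<open>\<open>s powr (1 / p - 1)\<close> is \<open>v powr (1 / p)\<close> almost everywhere, so
  this is the weighted maximal function of \<open>f\<close>.\<close>

definition G :: "real \<Rightarrow> (real^'n \<Rightarrow> ennreal) \<Rightarrow> real^'n \<Rightarrow> ennreal" where
  "G p f x = ennreal (s x powr (1 / p - 1)) * weighted_maximal lebesgue f x"

text \<open>The point value of \<open>s\<close> is replaced by its mean over the cube, which removes
  the dependence on the point.\<close>

definition level :: "real \<Rightarrow> (real^'n \<Rightarrow> ennreal) \<Rightarrow> real^'n \<Rightarrow> real \<Rightarrow> ennreal" where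
  "level p f a l = ennreal (mean a l powr (1 / p - 1)) *
    ((\<integral>\<^sup>+y\<in>cube a l. f y \<partial>lebesgue) / emeasure lebesgue (cube a l))"

lemma borel_measurable_G [measurable]: "G p f \<in> borel_measurable lebesgue"
proof -
  interpret L: doubling_measure "lebesgue :: (real^'n) measure" "3 powr real CARD('n)" by (rule doubling_lebesgue)
  show ?thesis unfolding G_def by measurable
qed

lemma sets_G_ge: "{x. c \<le> G p f x} \<in> sets lebesgue"
proof -
  have "G p f -` {c..} \<inter> space lebesgue \<in> sets lebesgue"
    by (rule measurable_sets[OF borel_measurable_G]) simp
  then show ?thesis by (simp add: vimage_def)
qed

text \<open>By \<open>maximal_le\<close>, \<open>G\<close> is at most
  \<open>A * s powr (1 / p)\<close> times the maximal function for \<open>\<nu>\<close>, and the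
  factor \<open>s\<close> in the \<open>p\<close>-th power is the density of \<open>\<nu>\<close>.
  On the right, \<open>s * (f / s) powr p\<close> is \<open>f powr p\<close> times
  \<open>v\<close>.\<close>

lemma G_bound:
  assumes [measurable]: "f \<in> borel_measurable lebesgue" and p: "1 < p"
  shows "(\<integral>\<^sup>+x. powr_ennreal (G p f x) p \<partial>lebesgue) \<le>
    ennreal (A powr p * (A * 3 powr real CARD('n) * 4 powr p / (1 - 2 powr (1 - p)))) *
    (\<integral>\<^sup>+x. powr_ennreal (f x) p * ennreal (s x powr (1 - p)) \<partial>lebesgue)"
proof -
  let ?h = "\<lambda>y. f y * ennreal (1 / s y)"
  let ?M = "weighted_maximal \<nu> ?h"
  have p0: "0 < p" using p by simp
  have [measurable]: "?M \<in> borel_measurable lebesgue" by (rule borel_measurable_weighted_maximal)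
  have "(\<integral>\<^sup>+x. powr_ennreal (G p f x) p \<partial>lebesgue) \<le>
      (\<integral>\<^sup>+x. ennreal (A powr p) * (ennreal (s x) * powr_ennreal (?M x) p) \<partial>lebesgue)"
  proof (rule nn_integral_mono_AE)
    show "AE x in lebesgue. powr_ennreal (G p f x) p \<le> ennreal (A powr p) * (ennreal (s x) * powr_ennreal (?M x) p)"
      using maximal_le[OF assms(1)]
    proof eventually_elim
      case (elim x)
      have "G p f x \<le> ennreal (s x powr (1 / p - 1)) * (ennreal (A * s x) * ?M x)"
        unfolding G_def using elim by (rule mult_left_mono) simp
      also have "\<dots> = ennreal (s x powr (1 / p - 1) * (A * s x)) * ?M x"
        using A_pos s_pos[of x] by (simp add: ennreal_mult mult.assoc)
      also have "s x powr (1 / p - 1) * (A * s x) = A * s x powr (1 / p)"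
        using s_pos[of x] by (simp add: powr_diff)
      finally have "powr_ennreal (G p f x) p \<le> powr_ennreal (ennreal (A * s x powr (1 / p)) * ?M x) p"
        using p0 by (intro powr_ennreal_mono) auto
      also have "\<dots> = ennreal ((A * s x powr (1 / p)) powr p) * powr_ennreal (?M x) p"
        using p0 A_pos s_pos[of x] by (simp add: powr_ennreal_mult powr_ennreal_pos)
      also have "(A * s x powr (1 / p)) powr p = A powr p * s x"
        using p0 A_pos s_pos[of x] by (simp add: powr_mult powr_powr)
      finally show ?case using s_pos[of x] by (simp add: ennreal_mult mult.assoc less_imp_le)
    qed
  qed
  also have "\<dots> = ennreal (A powr p) * (\<integral>\<^sup>+x. powr_ennreal (?M x) p \<partial>\<nu>)"
    by (subst nn_integral_cmult, measurable, subst nn_integral_\<nu>, measurable)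
  also have "\<dots> \<le> ennreal (A powr p) * (ennreal (A * 3 powr real CARD('n) * 4 powr p / (1 - 2 powr (1 - p))) *
      (\<integral>\<^sup>+x. powr_ennreal (?h x) p \<partial>\<nu>))"
    using p by (intro mult_left_mono strong_type) auto
  also have "(\<integral>\<^sup>+x. powr_ennreal (?h x) p \<partial>\<nu>) = (\<integral>\<^sup>+x. powr_ennreal (f x) p * ennreal (s x powr (1 - p)) \<partial>lebesgue)"
  proof -
    have "ennreal (s x) * powr_ennreal (?h x) p = powr_ennreal (f x) p * ennreal (s x powr (1 - p))" for x
    proof -
      have "ennreal (s x) * ennreal ((1 / s x) powr p) = ennreal (s x powr (1 - p))"
        using s_pos[of x] by (simp add: powr_diff powr_divide flip: ennreal_mult)
      then show ?thesis
        using p0 s_pos[of x] by (simp add: powr_ennreal_mult powr_ennreal_pos mult_ac) (metis mult.assoc mult.commute)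
    qed
    then show ?thesis by (subst nn_integral_\<nu>) auto
  qed
  finally show ?thesis
    by (simp only: mult.assoc[symmetric] ennreal_mult'[OF powr_ge_zero])
qed

text \<open>By Chebyshev's inequality \<open>s\<close> is at most twice its mean on at least half of
  the cube; the negative exponent turns this into a lower bound for \<open>G\<close> there.\<close>

lemma level_set:
  assumes l: "0 < l" and p: "1 < p"
  shows "ennreal (l powr real CARD('n) / 2) \<le>
    emeasure lebesgue {x. ennreal (2 powr (1 / p - 1)) * level p f a l \<le> G p f x}"
proof -
  let ?Q = "cube a l" and ?m = "mean a l"
  define L where "L = l powr real CARD('n)"
  have L: "0 < L" "emeasure lebesgue ?Q = ennreal L" using l by (auto simp: L_def emeasure_cube)
  have m: "0 < ?m" using l by (rule mean_pos)
  define B where "B = {x\<in>?Q. 2 * ?m < s x}"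
  define E where "E = {x\<in>?Q. s x \<le> 2 * ?m}"
  have "{x \<in> space lebesgue. x \<in> ?Q \<and> 2 * ?m < s x} \<in> sets lebesgue" "{x \<in> space lebesgue. x \<in> ?Q \<and> s x \<le> 2 * ?m} \<in> sets lebesgue"
    by measurable
  then have [measurable]: "B \<in> sets lebesgue" "E \<in> sets lebesgue" by (simp_all add: B_def E_def)
  have "B \<union> E = ?Q" "B \<inter> E = {}" by (auto simp: B_def E_def)
  then have BE: "emeasure lebesgue B + emeasure lebesgue E = ennreal L"
    using plus_emeasure[of B lebesgue E] L by simp
  have "ennreal (2 * ?m) * emeasure lebesgue B = (\<integral>\<^sup>+x. ennreal (2 * ?m) * indicator B x \<partial>lebesgue)"
    by (subst nn_integral_cmult_indicator) auto
  also have "\<dots> \<le> (\<integral>\<^sup>+x\<in>?Q. ennreal (s x) \<partial>lebesgue)"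
    by (intro nn_integral_mono) (auto simp: B_def indicator_def intro: ennreal_leI less_imp_le)
  also have "\<dots> = ennreal (?m * L)" using l by (simp add: L_def emeasure_\<nu>_eq flip: emeasure_\<nu>)
  finally have *: "ennreal (2 * ?m) * emeasure lebesgue B \<le> ennreal (?m * L)" .
  have "ennreal (L / 2) \<le> emeasure lebesgue E"
  proof (cases "emeasure lebesgue B"; cases "emeasure lebesgue E")
    fix b e assume be: "emeasure lebesgue B = ennreal b" "0 \<le> b" "emeasure lebesgue E = ennreal e" "0 \<le> e"
    then have "2 * ?m * b \<le> ?m * L" using * m L by (simp flip: ennreal_mult)
    then have "b \<le> L / 2" using m by simp
    moreover have "b + e = L" using BE be L by (simp flip: ennreal_plus)
    ultimately show ?thesis using be by (simp add: ennreal_leI)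
  qed (use BE in auto)
  also have "\<dots> \<le> emeasure lebesgue {x. ennreal (2 powr (1 / p - 1)) * level p f a l \<le> G p f x}"
  proof (rule emeasure_mono)
    show "{x. ennreal (2 powr (1 / p - 1)) * level p f a l \<le> G p f x} \<in> sets lebesgue" by (rule sets_G_ge)
    show "E \<subseteq> {x. ennreal (2 powr (1 / p - 1)) * level p f a l \<le> G p f x}"
    proof
      fix x assume x: "x \<in> E"
      have "(2 * ?m) powr (1 / p - 1) \<le> s x powr (1 / p - 1)"
        using x p s_pos[of x] by (intro powr_mono2') (auto simp: E_def)
      then have "2 powr (1 / p - 1) * ?m powr (1 / p - 1) \<le> s x powr (1 / p - 1)"
        using m by (simp add: powr_mult)
      moreover have "(\<integral>\<^sup>+y\<in>?Q. f y \<partial>lebesgue) / emeasure lebesgue ?Q \<le> weighted_maximal lebesgue f x"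
        using x l by (intro average_le_weighted_maximal) (auto simp: E_def)
      ultimately have "ennreal (2 powr (1 / p - 1) * ?m powr (1 / p - 1)) * ((\<integral>\<^sup>+y\<in>?Q. f y \<partial>lebesgue) / emeasure lebesgue ?Q)
          \<le> G p f x"
        unfolding G_def by (intro mult_mono ennreal_leI) auto
      then show "x \<in> {x. ennreal (2 powr (1 / p - 1)) * level p f a l \<le> G p f x}"
        by (simp add: level_def ennreal_mult mult.assoc)
    qed
  qed
  finally show ?thesis by (simp add: L_def)
qed

text \<open>A number strictly below the supremum over corners is already below the value at one
  corner, so a single cube supplies the set that \<open>sum_levels_le\<close> asks for.\<close>

lemma sum_level_le:
  assumes p: "1 < p"
  shows "(\<integral>\<^sup>+k. ennreal (2 powr (real CARD('n) * real_of_int k)) *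
      powr_ennreal (ennreal (2 powr (1 / p - 1)) * (SUP a. level p f a (2 * 2 powr real_of_int k))) p \<partial>count_space UNIV)
    \<le> ennreal (2 powr p / ((1 - 2 powr - real CARD('n)) * (1 - 2 powr - p))) *
      (\<integral>\<^sup>+x. powr_ennreal (G p f x) p \<partial>lebesgue)"
proof (rule sum_levels_le)
  fix k :: int and t
  assume "t < ennreal (2 powr (1 / p - 1)) * (SUP a. level p f a (2 * 2 powr real_of_int k))"
  then obtain a where a: "t < ennreal (2 powr (1 / p - 1)) * level p f a (2 * 2 powr real_of_int k)"
    by (auto simp: SUP_mult_left_ennreal less_SUP_iff)
  \<comment> \<open>Half of a cube of side \<open>2 * 2 powr k\<close> has measure
    \<open>2 powr (n - 1) * 2 powr (n * k)\<close>, which suffices because the dimension is at least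
    one.\<close>
  have "1 \<le> (2::real) powr (real CARD('n) - 1)" by (rule ge_one_powr_ge_zero) auto
  then have "2 powr (real CARD('n) * real_of_int k) \<le> 2 powr (real CARD('n) - 1) * 2 powr (real CARD('n) * real_of_int k)"
    by simp
  also have "\<dots> = (2 * 2 powr real_of_int k) powr real CARD('n) / 2"
    by (simp add: powr_mult powr_powr powr_diff mult.commute)
  finally have "ennreal (2 powr (real CARD('n) * real_of_int k)) \<le> ennreal ((2 * 2 powr real_of_int k) powr real CARD('n) / 2)"
    by (rule ennreal_leI)
  also have "\<dots> \<le> emeasure lebesgue {x. ennreal (2 powr (1 / p - 1)) * level p f a (2 * 2 powr real_of_int k) \<le> G p f x}"
    using p by (intro level_set) auto
  also have "\<dots> \<le> emeasure lebesgue {x\<in>space lebesgue. t \<le> G p f x}"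
    using a sets_G_ge[of t p f] by (intro emeasure_mono) auto
  finally show "ennreal (2 powr (real CARD('n) * real_of_int k)) \<le> emeasure lebesgue {x\<in>space lebesgue. t \<le> G p f x}" .
qed (use p in auto)

lemma average_le_level:
  assumes p: "1 < p"
  shows "AE x in lebesgue. \<forall>a l. 0 < l \<longrightarrow> x \<in> cube a l \<longrightarrow>
    ennreal (s x powr (1 / p - 1)) * ((\<integral>\<^sup>+y\<in>cube a l. f y \<partial>lebesgue) / emeasure lebesgue (cube a l))
    \<le> ennreal (A powr (1 - 1 / p)) * level p f a l"
proof -
  have "1 / p - 1 \<le> 0" using p by simp
  from powr_le_mean[OF this] show ?thesis
  proof eventually_elim
    case (elim x)
    show ?case
    proof (intro allI impI)
      fix a l assume "0 < l" "x \<in> cube a l"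
      with elim have "s x powr (1 / p - 1) \<le> A powr (1 - 1 / p) * mean a l powr (1 / p - 1)" by simp
      then have "ennreal (s x powr (1 / p - 1)) \<le> ennreal (A powr (1 - 1 / p)) * ennreal (mean a l powr (1 / p - 1))"
        by (simp add: ennreal_leI flip: ennreal_mult)
      then show "ennreal (s x powr (1 / p - 1)) * ((\<integral>\<^sup>+y\<in>cube a l. f y \<partial>lebesgue) / emeasure lebesgue (cube a l))
          \<le> ennreal (A powr (1 - 1 / p)) * level p f a l"
        unfolding level_def mult.assoc[symmetric] by (rule mult_right_mono) simp
    qed
  qed
qed

end

section \<open>Testing condition and Riesz potential\<close>

text \<open>No measurability of \<open>F\<close> is assumed, unlike in \<open>nn_integral_cmult\<close>.\<close>

lemma nn_integral_cmult_le:
  assumes c: "0 < c"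
  shows "(\<integral>\<^sup>+x. ennreal c * F x \<partial>M) \<le> ennreal c * (\<integral>\<^sup>+x. F x \<partial>M)"
  unfolding nn_integral_def[of M "\<lambda>x. ennreal c * F x"]
proof (rule SUP_least)
  fix u assume "u \<in> {u. simple_function M u \<and> u \<le> (\<lambda>x. ennreal c * F x)}"
  then have u: "simple_function M u" "\<And>x. u x \<le> ennreal c * F x" by (auto simp: le_fun_def)
  have 1: "ennreal c * (ennreal (1 / c) * z) = z" "ennreal (1 / c) * (ennreal c * z) = z" for z
    using c by (simp_all add: mult.assoc[symmetric] flip: ennreal_mult)
  let ?v = "\<lambda>x. ennreal (1 / c) * u x"
  have v: "simple_function M ?v" using u(1) by simp
  have "?v x \<le> F x" for x
    using mult_left_mono[OF u(2), of "ennreal (1 / c)" x] by (simp only: 1) simp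
  then have "integral\<^sup>S M ?v \<le> (\<integral>\<^sup>+x. F x \<partial>M)"
    unfolding nn_integral_def using v by (intro SUP_upper) (auto simp: le_fun_def)
  then have "ennreal c * integral\<^sup>S M ?v \<le> ennreal c * (\<integral>\<^sup>+x. F x \<partial>M)"
    by (rule mult_left_mono) simp
  then show "integral\<^sup>S M u \<le> ennreal c * (\<integral>\<^sup>+x. F x \<partial>M)"
    by (simp only: simple_integral_mult[OF v, symmetric] 1)
qed

section \<open>Domination of the potential by a dyadic sum of averages\<close>

lemma ereal_integral_abs_le:
  "e2ennreal \<bar>ereal_integral M (\<lambda>x. ereal (f x))\<bar> \<le> (\<integral>\<^sup>+x. ennreal \<bar>f x\<bar> \<partial>M)"
proof -
  let ?X = "\<integral>\<^sup>+x. ennreal (f x) \<partial>M" and ?Y = "\<integral>\<^sup>+x. ennreal (- f x) \<partial>M" and ?J = "\<integral>\<^sup>+x. ennreal \<bar>f x\<bar> \<partial>M"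
  have le: "?X \<le> ?J" "?Y \<le> ?J" by (intro nn_integral_mono ennreal_leI; simp)+
  have eq: "ereal_integral M (\<lambda>x. ereal (f x)) = enn2ereal ?X - enn2ereal ?Y"
    by (simp add: ereal_integral_def)
  show ?thesis
  proof (cases ?J)
    case (real j)
    with le obtain x y where xy: "?X = ennreal x" "0 \<le> x" "?Y = ennreal y" "0 \<le> y"
      by (cases ?X; cases ?Y) (auto simp: top_unique)
    with le real have "x \<le> j" "y \<le> j" by auto
    then have "\<bar>x - y\<bar> \<le> j" using xy by linarith
    with xy real show ?thesis unfolding eq by (simp add: ennreal_leI)
  qed simp
qed

text \<open>Dyadic shells around \<open>x\<close>: at distance between \<open>2 powr (k - 1)\<close>
  and \<open>2 powr k\<close> the kernel is at most
  \<open>2 powr ((k - 1) * (\<alpha> - n))\<close>, and the surrounding cube has measure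
  \<open>2 powr (n + n * k)\<close>. The product of the two is
  \<open>2 powr (2 * n - \<alpha>) * 2 powr (\<alpha> * k)\<close>.\<close>

lemma riesz_potential_le:
  fixes f :: "real^'n \<Rightarrow> real" and x :: "real^'n"
  assumes [measurable]: "f \<in> borel_measurable lebesgue" and \<alpha>: "\<alpha> < real CARD('n)"
  shows "e2ennreal \<bar>riesz_potential \<alpha> f x\<bar> \<le> ennreal (2 powr (2 * real CARD('n) - \<alpha>)) *
    (\<integral>\<^sup>+k. ennreal (2 powr (\<alpha> * real_of_int k)) *
      ((\<integral>\<^sup>+y\<in>cube (x - (\<chi> i. 2 powr real_of_int k)) (2 * 2 powr real_of_int k). ennreal \<bar>f y\<bar> \<partial>lebesgue) /
        emeasure lebesgue (cube (x - (\<chi> i. 2 powr real_of_int k)) (2 * 2 powr real_of_int k))) \<partial>count_space UNIV)"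
proof -
  let ?n = "real CARD('n)"
  let ?Q = "\<lambda>k. cube (x - (\<chi> i. 2 powr real_of_int k)) (2 * 2 powr real_of_int k)"
  let ?c = "\<lambda>k. ennreal (2 powr ((real_of_int k - 1) * (\<alpha> - ?n)))"
  have pt: "ennreal \<bar>f y / norm (x - y) powr (?n - \<alpha>)\<bar> \<le>
      (\<integral>\<^sup>+k. ?c k * (ennreal \<bar>f y\<bar> * indicator (?Q k) y) \<partial>count_space UNIV)" for y
  \<comment> \<open>At \<open>y = x\<close> the integrand is \<open>0\<close>, since
    \<open>0 powr _ = 0\<close> and division by zero yields zero.\<close>
  proof (cases "y = x")
    case False
    define d where "d = norm (x - y)"
    have d: "0 < d" using False by (simp add: d_def)
    define k where "k = \<lceil>log 2 d\<rceil>"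
    have k: "real_of_int k - 1 < log 2 d" "log 2 d \<le> real_of_int k" using ceiling_correct[of "log 2 d"] by (auto simp: k_def)
    have d1: "2 powr (real_of_int k - 1) \<le> d" using k d by (simp add: le_log_iff[symmetric])
    have d2: "d \<le> 2 powr real_of_int k" using k d by (simp add: log_le_iff)
    have "y \<in> ?Q k"
    proof -
      have "x $ i - 2 powr real_of_int k \<le> y $ i \<and> y $ i \<le> x $ i - 2 powr real_of_int k + 2 * 2 powr real_of_int k" for i
        using component_le_norm_cart[of "x - y" i] d2 unfolding d_def by (simp add: abs_le_iff)
      then show ?thesis by (simp add: mem_cube)
    qed
    have "\<bar>f y / d powr (?n - \<alpha>)\<bar> = d powr (\<alpha> - ?n) * \<bar>f y\<bar>"
      using d by (simp add: powr_diff abs_mult field_simps)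
    also have "\<dots> \<le> (2 powr (real_of_int k - 1)) powr (\<alpha> - ?n) * \<bar>f y\<bar>"
      using d1 d \<alpha> by (intro mult_right_mono powr_mono2') auto
    finally have "ennreal \<bar>f y / d powr (?n - \<alpha>)\<bar> \<le> ennreal (2 powr ((real_of_int k - 1) * (\<alpha> - ?n)) * \<bar>f y\<bar>)"
      by (intro ennreal_leI) (simp add: powr_powr)
    also have "\<dots> = ?c k * (ennreal \<bar>f y\<bar> * indicator (?Q k) y)"
      using \<open>y \<in> ?Q k\<close> by (simp add: ennreal_mult)
    also have "\<dots> \<le> (\<integral>\<^sup>+k. ?c k * (ennreal \<bar>f y\<bar> * indicator (?Q k) y) \<partial>count_space UNIV)"
      by (rule nn_integral_ge_point) simp
    finally show ?thesis by (simp add: d_def)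
  qed simp
  have "e2ennreal \<bar>riesz_potential \<alpha> f x\<bar> \<le> (\<integral>\<^sup>+y. ennreal \<bar>f y / norm (x - y) powr (?n - \<alpha>)\<bar> \<partial>lebesgue)"
    unfolding riesz_potential_def by (rule ereal_integral_abs_le)
  also have "\<dots> \<le> (\<integral>\<^sup>+y. \<integral>\<^sup>+k. ?c k * (ennreal \<bar>f y\<bar> * indicator (?Q k) y) \<partial>count_space UNIV \<partial>lebesgue)"
    by (intro nn_integral_mono pt)
  also have "\<dots> = (\<integral>\<^sup>+k. \<integral>\<^sup>+y. ?c k * (ennreal \<bar>f y\<bar> * indicator (?Q k) y) \<partial>lebesgue \<partial>count_space UNIV)"
    by (rule nn_integral_count_space_nn_integral) auto
  also have "\<dots> = (\<integral>\<^sup>+k. ennreal (2 powr (2 * ?n - \<alpha>)) * (ennreal (2 powr (\<alpha> * real_of_int k)) *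
      ((\<integral>\<^sup>+y\<in>?Q k. ennreal \<bar>f y\<bar> \<partial>lebesgue) / emeasure lebesgue (?Q k))) \<partial>count_space UNIV)"
  proof (intro nn_integral_cong)
    fix k :: int
    let ?I = "\<integral>\<^sup>+y\<in>?Q k. ennreal \<bar>f y\<bar> \<partial>lebesgue"
    have Q: "emeasure lebesgue (?Q k) = ennreal (2 powr (?n + ?n * real_of_int k))"
      by (simp add: emeasure_cube powr_mult powr_powr powr_add mult.commute)
    have "emeasure lebesgue (?Q k) * (?I / emeasure lebesgue (?Q k)) = ?I"
      unfolding Q by (rule ennreal_times_divide_cancel) auto
    then have "?c k * ?I = (?c k * emeasure lebesgue (?Q k)) * (?I / emeasure lebesgue (?Q k))"
      by (simp only: mult.assoc)
    also have "?c k * emeasure lebesgue (?Q k) = ennreal (2 powr (2 * ?n - \<alpha>)) * ennreal (2 powr (\<alpha> * real_of_int k))"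
      unfolding Q by (simp add: two_powr_mult algebra_simps)
    finally show "(\<integral>\<^sup>+y. ?c k * (ennreal \<bar>f y\<bar> * indicator (?Q k) y) \<partial>lebesgue) =
      ennreal (2 powr (2 * ?n - \<alpha>)) * (ennreal (2 powr (\<alpha> * real_of_int k)) * (?I / emeasure lebesgue (?Q k)))"
      by (simp add: nn_integral_cmult mult.assoc)
  qed
  finally show ?thesis by (simp add: nn_integral_cmult)
qed

text \<open>Disposes of \<open>g = 0\<close> almost everywhere, where the maximal function cannot be
  normalized by the norm of \<open>g\<close>.\<close>

lemma maximal_function_eq_0:
  assumes "(\<integral>\<^sup>+x. ennreal \<bar>g x\<bar> \<partial>lebesgue) = 0"
  shows "maximal_function g x = 0"
proof -
  have "maximal_function g x \<le> 0"
    unfolding maximal_function_eq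
  proof (rule weighted_maximal_least)
    fix a l
    have "(\<integral>\<^sup>+y\<in>cube a l. ennreal \<bar>g y\<bar> \<partial>lebesgue) \<le> (\<integral>\<^sup>+y. ennreal \<bar>g y\<bar> \<partial>lebesgue)"
      by (intro nn_integral_mono) (auto simp: indicator_def)
    with assms show "(\<integral>\<^sup>+y\<in>cube a l. ennreal \<bar>g y\<bar> \<partial>lebesgue) / emeasure lebesgue (cube a l) \<le> 0" by simp
  qed
  then show ?thesis by simp
qed

section \<open>The maximal function of \<open>g\<close>: weak type and Kolmogorov's inequality on
  cubes\<close>

lemma borel_measurable_maximal_function [measurable]: "maximal_function g \<in> borel_measurable lebesgue"
proof -
  interpret L: doubling_measure "lebesgue :: (real^'n) measure" "3 powr real CARD('n)" by (rule doubling_lebesgue)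
  show ?thesis unfolding maximal_function_eq by (rule L.borel_measurable_weighted_maximal)
qed

lemma weak_type_maximal_function:
  fixes g :: "real^'n \<Rightarrow> real"
  assumes [measurable]: "g \<in> borel_measurable lebesgue" and N: "(\<integral>\<^sup>+x. ennreal \<bar>g x\<bar> \<partial>lebesgue) = ennreal N" "0 < N" and t: "0 < t"
  shows "ennreal t * emeasure lebesgue {x\<in>space lebesgue. ennreal t < maximal_function g x * ennreal (1 / N)} \<le> ennreal (3 powr real CARD('n))"
proof -
  interpret L: doubling_measure "lebesgue :: (real^'n) measure" "3 powr real CARD('n)" by (rule doubling_lebesgue)
  let ?E = "{x. ennreal (t * N) < maximal_function g x}"
  have "x \<in> ?E" if "ennreal t < maximal_function g x * ennreal (1 / N)" for x
  proof (rule ccontr)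
    assume "x \<notin> ?E"
    then have "maximal_function g x * ennreal (1 / N) \<le> ennreal (t * N) * ennreal (1 / N)"
      by (intro mult_right_mono) (auto simp: not_less)
    also have "\<dots> = ennreal t" using t N by (simp flip: ennreal_mult)
    finally show False using that by simp
  qed
  then have "emeasure lebesgue {x\<in>space lebesgue. ennreal t < maximal_function g x * ennreal (1 / N)} \<le> emeasure lebesgue ?E"
    using L.sets_superlevel[of "t * N" "\<lambda>y. ennreal \<bar>g y\<bar>"]
    by (intro emeasure_mono) (auto simp: maximal_function_eq)
  then have "ennreal t * emeasure lebesgue {x\<in>space lebesgue. ennreal t < maximal_function g x * ennreal (1 / N)} \<le>
      ennreal t * emeasure lebesgue ?E"
    by (rule mult_left_mono) simp
  also have "\<dots> = ennreal (1 / N) * (ennreal (t * N) * emeasure lebesgue ?E)"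
    using t N by (simp add: mult.assoc[symmetric] flip: ennreal_mult)
  also have "\<dots> \<le> ennreal (1 / N) * (ennreal (3 powr real CARD('n)) * ennreal N)"
    unfolding maximal_function_eq N(1)[symmetric] by (intro mult_left_mono L.weak_type) auto
  also have "\<dots> = ennreal (3 powr real CARD('n))"
    using N by (simp flip: ennreal_mult)
  finally show ?thesis .
qed

lemma Kolmogorov_const_nonneg: "0 < \<delta> \<Longrightarrow> \<delta> < 1 \<Longrightarrow> 0 \<le> Kolmogorov_const \<delta>"
  using powr_less_mono[of "-\<delta>" 0 2] powr_less_mono[of "\<delta> - 1" 0 2]
  by (auto simp: Kolmogorov_const_def intro!: mult_nonneg_nonneg add_nonneg_nonneg)

text \<open>The height \<open>\<tau> = 1 / |Q|\<close> balances the two parts: below it the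
  integrand is at most \<open>\<tau> powr \<delta>\<close> on \<open>Q\<close>, above it the global
  inequality applies, and both contributions scale like
  \<open>|Q| powr (1 - \<delta>)\<close>.\<close>

lemma Kolmogorov_cube:
  fixes W :: "real^'n \<Rightarrow> ennreal"
  assumes [measurable]: "W \<in> borel_measurable lebesgue" and D: "0 \<le> D" and \<delta>: "0 < \<delta>" "\<delta> < 1" and l: "0 < l"
    and weak: "\<And>t. 0 < t \<Longrightarrow> ennreal t * emeasure lebesgue {x\<in>space lebesgue. ennreal t < W x} \<le> ennreal D"
  shows "(\<integral>\<^sup>+x\<in>cube a l. powr_ennreal (W x) \<delta> \<partial>lebesgue) \<le>
    ennreal ((1 + Kolmogorov_const \<delta> * D) * l powr (real CARD('n) * (1 - \<delta>)))"
proof -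
  let ?n = "real CARD('n)"
  define \<tau> where "\<tau> = l powr (- ?n)"
  have \<tau>: "0 < \<tau>" using l by (simp add: \<tau>_def)
  have "(\<integral>\<^sup>+x\<in>cube a l. powr_ennreal (W x) \<delta> \<partial>lebesgue) \<le>
      (\<integral>\<^sup>+x. ennreal (\<tau> powr \<delta>) * indicator (cube a l) x + powr_ennreal (W x) \<delta> * indicator {x. ennreal \<tau> \<le> W x} x \<partial>lebesgue)"
  proof (intro nn_integral_mono)
    fix x
    show "powr_ennreal (W x) \<delta> * indicator (cube a l) x \<le>
      ennreal (\<tau> powr \<delta>) * indicator (cube a l) x + powr_ennreal (W x) \<delta> * indicator {x. ennreal \<tau> \<le> W x} x"
    proof (cases "ennreal \<tau> \<le> W x")
      case True
      then show ?thesis by (auto simp: indicator_def)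
    next
      case False
      then have "powr_ennreal (W x) \<delta> \<le> powr_ennreal (ennreal \<tau>) \<delta>" using \<delta> by (intro powr_ennreal_mono) auto
      with \<tau> False show ?thesis by (auto simp: powr_ennreal_pos indicator_def)
    qed
  qed
  also have "\<dots> = ennreal (\<tau> powr \<delta>) * emeasure lebesgue (cube a l) +
      (\<integral>\<^sup>+x. powr_ennreal (W x) \<delta> * indicator {x. ennreal \<tau> \<le> W x} x \<partial>lebesgue)"
    by (subst nn_integral_add, measurable, subst nn_integral_cmult_indicator, measurable)
  also have "\<dots> \<le> ennreal (\<tau> powr \<delta>) * ennreal (l powr ?n) + ennreal (Kolmogorov_const \<delta> * D * \<tau> powr (\<delta> - 1))"
    unfolding Kolmogorov_const_def emeasure_cube[OF l] by (intro add_left_mono Kolmogorov D \<delta> \<tau> weak) auto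
  also have "\<dots> = ennreal (\<tau> powr \<delta> * l powr ?n + Kolmogorov_const \<delta> * D * \<tau> powr (\<delta> - 1))"
    using Kolmogorov_const_nonneg[OF \<delta>] D by (simp add: ennreal_mult)
  also have "\<tau> powr \<delta> * l powr ?n + Kolmogorov_const \<delta> * D * \<tau> powr (\<delta> - 1) = (1 + Kolmogorov_const \<delta> * D) * l powr (?n * (1 - \<delta>))"
  proof -
    have "\<tau> powr \<delta> * l powr ?n = l powr (?n * (1 - \<delta>))"
      by (simp add: \<tau>_def powr_powr algebra_simps flip: powr_add)
    moreover have "\<tau> powr (\<delta> - 1) = l powr (?n * (1 - \<delta>))"
      by (simp add: \<tau>_def powr_powr algebra_simps)
    ultimately show ?thesis by (simp add: algebra_simps)
  qed
  finally show ?thesis .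
qed

section \<open>The two estimates for an \<open>A_1\<close> weight\<close>

context A1_weight
begin

text \<open>\<open>powr_le_mean\<close> takes the weight out of the mean of \<open>u\<close> as a
  power of the mean of \<open>s\<close>, which cancels the other factor. The remaining mean of the
  maximal function scales like \<open>|Q| powr (- \<Theta> * q / n)\<close>, and its
  \<open>q\<close>-th root cancels the power of \<open>|Q|\<close> in front.\<close>

lemma testing_condition:
  fixes g :: "real^'n \<Rightarrow> real" and p q \<Theta> :: real
  assumes p: "1 < p" "p \<le> q" and \<Theta>: "0 < \<Theta>" "\<Theta> * q < real CARD('n)" and g: "integrable lebesgue g" and l: "0 < l"
  defines "u \<equiv> \<lambda>x. powr_ennreal (maximal_function g x) (\<Theta> * q / real CARD('n)) * ennreal (s x powr (q * (1 / p - 1)))"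
  shows "powr_ennreal (emeasure lebesgue (cube a l)) (\<Theta> / real CARD('n)) *
      powr_ennreal (average (cube a l) u) (1 / q) * powr_ennreal (average (cube a l) (\<lambda>x. ennreal (s x))) (1 - 1 / p)
    \<le> ennreal ((1 + Kolmogorov_const (\<Theta> * q / real CARD('n)) * 3 powr real CARD('n)) powr (1 / q) * A powr (1 - 1 / p)) *
      powr_ennreal (\<integral>\<^sup>+x. ennreal \<bar>g x\<bar> \<partial>lebesgue) (\<Theta> / real CARD('n))"
proof -
  let ?n = "real CARD('n)"
  define \<delta> where "\<delta> = \<Theta> * q / ?n"
  have q: "0 < q" "0 < p" using p by auto
  have \<delta>: "0 < \<delta>" "\<delta> < 1" using \<Theta> q by (auto simp: \<delta>_def)
  have [measurable]: "g \<in> borel_measurable lebesgue" using g by simp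
  obtain N where N: "(\<integral>\<^sup>+x. ennreal \<bar>g x\<bar> \<partial>lebesgue) = ennreal N" "0 \<le> N"
    using g by (cases "\<integral>\<^sup>+x. ennreal \<bar>g x\<bar> \<partial>lebesgue") (auto simp: integrable_iff_bounded)
  show ?thesis
  proof (cases "N = 0")
    case True
    then have "u x = 0" for x using N \<delta> by (simp add: u_def maximal_function_eq_0 \<delta>_def[symmetric])
    then show ?thesis using q by (simp add: average_def)
  next
    case False
    with N have N0: "0 < N" by simp
    define W where "W x = maximal_function g x * ennreal (1 / N)" for x
    have [measurable]: "W \<in> borel_measurable lebesgue" unfolding W_def by measurable
    have MW: "maximal_function g x = ennreal N * W x" for x
    proof -
      have "ennreal N * ennreal (1 / N) = 1" using N0 by (simp flip: ennreal_mult)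
      then show ?thesis unfolding W_def by (metis mult.left_commute mult.right_neutral)
    qed
    define K where "K = 1 + Kolmogorov_const \<delta> * 3 powr ?n"
    have K: "1 \<le> K" using Kolmogorov_const_nonneg[OF \<delta>] by (simp add: K_def)
    define m where "m = mean a l"
    have m: "0 < m" using l unfolding m_def by (rule mean_pos)
    define c where "c = q * (1 / p - 1)"
    have c: "c \<le> 0" "c / q = 1 / p - 1" using q p by (auto simp: c_def mult_nonneg_nonpos)
    have "(\<integral>\<^sup>+x\<in>cube a l. u x \<partial>lebesgue) \<le>
        (\<integral>\<^sup>+x. ennreal (N powr \<delta> * (A powr (- c) * m powr c)) * (powr_ennreal (W x) \<delta> * indicator (cube a l) x) \<partial>lebesgue)"
    proof (rule nn_integral_mono_AE)
      show "AE x in lebesgue. u x * indicator (cube a l) x \<le>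
        ennreal (N powr \<delta> * (A powr (- c) * m powr c)) * (powr_ennreal (W x) \<delta> * indicator (cube a l) x)"
        using powr_le_mean[OF c(1)]
      proof eventually_elim
        case (elim x)
        show ?case
        proof (cases "x \<in> cube a l")
          case True
          then have "s x powr c \<le> A powr (- c) * m powr c" using elim l by (auto simp: m_def)
          then have "u x \<le> (ennreal (N powr \<delta>) * powr_ennreal (W x) \<delta>) * ennreal (A powr (- c) * m powr c)"
            unfolding u_def \<delta>_def[symmetric] c_def[symmetric] MW using \<delta> N0
            by (simp add: powr_ennreal_mult powr_ennreal_pos mult_left_mono ennreal_leI)
          also have "\<dots> = ennreal (N powr \<delta> * (A powr (- c) * m powr c)) * powr_ennreal (W x) \<delta>"
            by (simp add: ennreal_mult mult_ac)
          finally show ?thesis using True by simp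
        qed simp
      qed
    qed
    also have "\<dots> = ennreal (N powr \<delta> * (A powr (- c) * m powr c)) * (\<integral>\<^sup>+x\<in>cube a l. powr_ennreal (W x) \<delta> \<partial>lebesgue)"
      by (rule nn_integral_cmult) measurable
    also have "\<dots> \<le> ennreal (N powr \<delta> * (A powr (- c) * m powr c)) * ennreal (K * l powr (?n * (1 - \<delta>)))"
      unfolding K_def W_def using N(1) N0
      by (intro mult_left_mono Kolmogorov_cube \<delta> l weak_type_maximal_function) auto
    also have "\<dots> = ennreal (N powr \<delta> * (A powr (- c) * m powr c) * (K * l powr (?n * (1 - \<delta>))))"
      using K by (simp add: ennreal_mult)
    finally have "average (cube a l) u \<le> ennreal (N powr \<delta> * (A powr (- c) * m powr c) * (K * l powr (?n * (1 - \<delta>)))) / ennreal (l powr ?n)"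
      unfolding average_def emeasure_cube[OF l] by (rule divide_right_mono_ennreal)
    also have "\<dots> = ennreal (N powr \<delta> * A powr (- c) * m powr c * K * l powr (- ?n * \<delta>))"
    proof -
      have "l powr (?n * (1 - \<delta>)) / l powr ?n = l powr (- ?n * \<delta>)"
        by (simp add: algebra_simps flip: powr_diff)
      then have "N powr \<delta> * (A powr (- c) * m powr c) * (K * l powr (?n * (1 - \<delta>))) / l powr ?n = N powr \<delta> * A powr (- c) * m powr c * K * l powr (- ?n * \<delta>)"
        by (metis (no_types, lifting) mult.assoc times_divide_eq_right)
      then show ?thesis using l K by (subst divide_ennreal) auto
    qed
    finally have "powr_ennreal (average (cube a l) u) (1 / q) \<le>
        powr_ennreal (ennreal (N powr \<delta> * A powr (- c) * m powr c * K * l powr (- ?n * \<delta>))) (1 / q)"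
      using q by (intro powr_ennreal_mono) auto
    also have "\<dots> = ennreal ((N powr \<delta> * A powr (- c) * m powr c * K * l powr (- ?n * \<delta>)) powr (1 / q))"
      using N0 A_pos m K l by (intro powr_ennreal_pos mult_pos_pos) auto
    also have "(N powr \<delta> * A powr (- c) * m powr c * K * l powr (- ?n * \<delta>)) powr (1 / q) =
        N powr (\<Theta> / ?n) * A powr (1 - 1 / p) * m powr (1 / p - 1) * K powr (1 / q) * l powr (- \<Theta>)"
    proof -
      have "- c * (1 / q) = 1 - 1 / p" "c * (1 / q) = 1 / p - 1" "\<delta> * (1 / q) = \<Theta> / ?n" "- ?n * \<delta> * (1 / q) = - \<Theta>"
        using c(2) q by (auto simp: \<delta>_def)
      then show ?thesis using K by (simp only: powr_mult powr_powr)
    qed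
    finally have U: "powr_ennreal (average (cube a l) u) (1 / q) \<le>
        ennreal (N powr (\<Theta> / ?n) * A powr (1 - 1 / p) * m powr (1 / p - 1) * K powr (1 / q) * l powr (- \<Theta>))" .
    have "average (cube a l) (\<lambda>x. ennreal (s x)) = ennreal (m * l powr ?n) / ennreal (l powr ?n)"
      unfolding average_def m_def emeasure_cube[OF l] emeasure_\<nu>_eq[OF l, symmetric] emeasure_\<nu> ..
    also have "\<dots> = ennreal m" using l m by (subst divide_ennreal) auto
    finally have S: "powr_ennreal (average (cube a l) (\<lambda>x. ennreal (s x))) (1 - 1 / p) = ennreal (m powr (1 - 1 / p))"
      using m by (simp add: powr_ennreal_pos)
    have Q: "powr_ennreal (emeasure lebesgue (cube a l)) (\<Theta> / ?n) = ennreal (l powr \<Theta>)"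
      using l by (simp add: emeasure_cube powr_ennreal_pos powr_powr)
    have "powr_ennreal (emeasure lebesgue (cube a l)) (\<Theta> / ?n) *
        powr_ennreal (average (cube a l) u) (1 / q) * powr_ennreal (average (cube a l) (\<lambda>x. ennreal (s x))) (1 - 1 / p)
      \<le> ennreal (l powr \<Theta>) * ennreal (N powr (\<Theta> / ?n) * A powr (1 - 1 / p) * m powr (1 / p - 1) * K powr (1 / q) * l powr (- \<Theta>)) *
        ennreal (m powr (1 - 1 / p))"
      unfolding S Q by (intro mult_right_mono mult_left_mono U) auto
    also have "\<dots> = ennreal ((l powr \<Theta> * l powr (- \<Theta>)) * (m powr (1 / p - 1) * m powr (1 - 1 / p)) * (K powr (1 / q) * A powr (1 - 1 / p)) * N powr (\<Theta> / ?n))"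
      by (simp add: mult_ac flip: ennreal_mult)
    also have "(l powr \<Theta> * l powr (- \<Theta>)) * (m powr (1 / p - 1) * m powr (1 - 1 / p)) * (K powr (1 / q) * A powr (1 - 1 / p)) * N powr (\<Theta> / ?n) =
        (K powr (1 / q) * A powr (1 - 1 / p)) * N powr (\<Theta> / ?n)"
      using l m by (simp flip: powr_add)
    also have "ennreal ((K powr (1 / q) * A powr (1 - 1 / p)) * N powr (\<Theta> / ?n)) =
        ennreal (K powr (1 / q) * A powr (1 - 1 / p)) * powr_ennreal (ennreal N) (\<Theta> / ?n)"
      using N0 by (simp add: powr_ennreal_pos ennreal_mult)
    finally show ?thesis unfolding N(1) K_def \<delta>_def .
  qed
qed

end

text \<open>The first factor passes from the potential to the dyadic sum. The \<open>max\<close>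
  makes one number bound both integrals required by \<open>ONeil_dyadic\<close>, that of
  \<open>G\<close> and the sum over \<open>k\<close>; the factor after it is the constant of
  \<open>G_bound\<close>.\<close>

definition operator_const :: "real \<Rightarrow> real \<Rightarrow> real \<Rightarrow> real \<Rightarrow> real \<Rightarrow> real \<Rightarrow> real" where
  "operator_const n \<alpha> p q \<Theta> A = 2 powr ((2 * n - \<alpha>) * q) * ONeil_const n q \<Theta> (3 powr n) *
    (max 1 ((2 * A) powr (p - 1) * (2 powr p / ((1 - 2 powr - n) * (1 - 2 powr - p)))) *
      (A powr p * (A * 3 powr n * 4 powr p / (1 - 2 powr (1 - p))))) powr (q / p)"

lemma (in A1_weight) weighted_riesz_bound:
  fixes f g :: "real^'n \<Rightarrow> real" and \<alpha> p q \<Theta> :: real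
  assumes \<alpha>: "\<alpha> < real CARD('n)" and p: "1 < p" "p \<le> q" and \<Theta>: "\<Theta> = \<alpha> + real CARD('n) * (1 / q - 1 / p)" "0 < \<Theta>" "\<Theta> * q < real CARD('n)"
    and g: "integrable lebesgue g" and f [measurable]: "f \<in> borel_measurable lebesgue"
  shows "(\<integral>\<^sup>+x. powr_ennreal (e2ennreal \<bar>riesz_potential \<alpha> f x\<bar>) q *
      powr_ennreal (maximal_function g x) (\<Theta> * q / real CARD('n)) * ennreal (s x powr (q * (1 / p - 1))) \<partial>lebesgue)
    \<le> ennreal (operator_const (real CARD('n)) \<alpha> p q \<Theta> A) * powr_ennreal (\<integral>\<^sup>+x. ennreal \<bar>g x\<bar> \<partial>lebesgue) (\<Theta> * q / real CARD('n)) *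
      powr_ennreal (\<integral>\<^sup>+x. powr_ennreal (ennreal \<bar>f x\<bar>) p * ennreal (s x powr (1 - p)) \<partial>lebesgue) (q / p)"
proof -
  let ?n = "real CARD('n)"
  define \<delta> where "\<delta> = \<Theta> * q / ?n"
  have q: "0 < q" "0 < p" using p by auto
  have \<delta>: "0 < \<delta>" using \<Theta>(2) q by (auto simp: \<delta>_def)
  have [measurable]: "g \<in> borel_measurable lebesgue" using g by simp
  obtain N where N: "(\<integral>\<^sup>+x. ennreal \<bar>g x\<bar> \<partial>lebesgue) = ennreal N" "0 \<le> N"
    using g by (cases "\<integral>\<^sup>+x. ennreal \<bar>g x\<bar> \<partial>lebesgue") (auto simp: integrable_iff_bounded)
  show ?thesis
  proof (cases "N = 0")
    case True
    then have "maximal_function g x = 0" for x using N by (simp add: maximal_function_eq_0)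
    then show ?thesis using \<delta> by (simp add: \<delta>_def)
  next
    case False
    with N have N0: "0 < N" by simp
    define W where "W x = maximal_function g x * ennreal (1 / N)" for x
    have [measurable]: "W \<in> borel_measurable lebesgue" unfolding W_def by measurable
    have MW: "maximal_function g x = ennreal N * W x" for x
    proof -
      have "ennreal N * ennreal (1 / N) = 1" using N0 by (simp flip: ennreal_mult)
      then show ?thesis unfolding W_def by (metis mult.left_commute mult.right_neutral)
    qed
    let ?f = "\<lambda>y. ennreal \<bar>f y\<bar>"
    let ?Q = "\<lambda>k::int. \<lambda>x. cube (x - (\<chi> i. 2 powr real_of_int k)) (2 * 2 powr real_of_int k)"
    define T where "T k x = (\<integral>\<^sup>+y\<in>?Q k x. ?f y \<partial>lebesgue) / emeasure lebesgue (?Q k x)" for k x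
    define H where "H k x = ennreal (s x powr (1 / p - 1)) * T k x" for k x
    define a where "a k = ennreal (A powr (1 - 1 / p)) * (SUP b. level p ?f b (2 * 2 powr real_of_int k))" for k :: int
    define c1 where "c1 = 2 powr p / ((1 - 2 powr - ?n) * (1 - 2 powr - p))"
    define c2 where "c2 = max 1 ((2 * A) powr (p - 1) * c1)"
    define c3 where "c3 = A powr p * (A * 3 powr ?n * 4 powr p / (1 - 2 powr (1 - p)))"
    have "2 powr - ?n < (1::real)" "2 powr - p < (1::real)" "2 powr (1 - p) < (1::real)"
      using p powr_less_mono[of "-?n" 0 2] powr_less_mono[of "-p" 0 2] powr_less_mono[of "1 - p" 0 2] by auto
    then have c: "0 < c1" "1 \<le> c2" "(2 * A) powr (p - 1) * c1 \<le> c2" "0 < c3"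
      using A_pos by (auto simp: c1_def c2_def c3_def)
    define I where "I = (\<integral>\<^sup>+x. powr_ennreal (G p ?f x) p \<partial>lebesgue)"
    define \<Phi> where "\<Phi> = (\<integral>\<^sup>+x. powr_ennreal (?f x) p * ennreal (s x powr (1 - p)) \<partial>lebesgue)"
    have I: "I \<le> ennreal c3 * \<Phi>"
      unfolding I_def c3_def \<Phi>_def using p by (intro G_bound) auto
    have xQ: "x \<in> ?Q k x" for k x by (simp add: mem_cube)
    have HG: "H k x \<le> G p ?f x" for k x
      unfolding H_def G_def T_def using xQ by (intro mult_left_mono average_le_weighted_maximal) auto
    have Ha: "AE x in lebesgue. \<forall>k. H k x \<le> G p ?f x \<and> H k x \<le> a k"
      using average_le_level[OF p(1), of ?f]
    proof eventually_elim
      case (elim x)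
      have "H k x \<le> a k" for k
      proof -
        have "H k x \<le> ennreal (A powr (1 - 1 / p)) * level p ?f (x - (\<chi> i. 2 powr real_of_int k)) (2 * 2 powr real_of_int k)"
          unfolding H_def T_def using elim[rule_format, OF _ xQ] by simp
        also have "\<dots> \<le> a k" unfolding a_def by (intro mult_left_mono SUP_upper) auto
        finally show ?thesis .
      qed
      with HG show ?case by blast
    qed
    have a: "(\<integral>\<^sup>+k. ennreal (2 powr (?n * real_of_int k)) * powr_ennreal (a k) p \<partial>count_space UNIV) \<le> ennreal c2 * I"
    proof -
      \<comment> \<open>\<open>sum_level_le\<close> carries the factor
        \<open>2 powr (1 / p - 1)\<close> from Chebyshev's inequality, while \<open>a k\<close>
        carries \<open>A powr (1 - 1 / p)\<close>; their quotient, to the power \<open>p\<close>, is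
        \<open>(2 * A) powr (p - 1)\<close>.\<close>
      let ?b = "\<lambda>k::int. ennreal (2 powr (1 / p - 1)) * (SUP b. level p ?f b (2 * 2 powr real_of_int k))"
      have ab: "powr_ennreal (a k) p = ennreal ((2 * A) powr (p - 1)) * powr_ennreal (?b k) p" for k
      proof -
        have "A powr (1 - 1 / p) = (2 * A) powr (1 - 1 / p) * 2 powr (1 / p - 1)"
          using A_pos by (simp add: powr_mult flip: powr_add)
        then have "a k = ennreal ((2 * A) powr (1 - 1 / p)) * ?b k"
          by (simp add: a_def ennreal_mult mult.assoc)
        moreover have "((2 * A) powr (1 - 1 / p)) powr p = (2 * A) powr (p - 1)"
          using q by (simp add: powr_powr algebra_simps)
        ultimately show ?thesis
          using q A_pos by (simp only: powr_ennreal_mult[OF less_imp_le[OF q(2)], of _ "?b k"]) (simp add: powr_ennreal_pos)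
      qed
      have "(\<integral>\<^sup>+k. ennreal (2 powr (?n * real_of_int k)) * powr_ennreal (a k) p \<partial>count_space UNIV) =
          (\<integral>\<^sup>+k. ennreal ((2 * A) powr (p - 1)) * (ennreal (2 powr (?n * real_of_int k)) * powr_ennreal (?b k) p) \<partial>count_space UNIV)"
        unfolding ab by (intro nn_integral_cong) (simp only: mult_ac)
      also have "\<dots> = ennreal ((2 * A) powr (p - 1)) * (\<integral>\<^sup>+k. ennreal (2 powr (?n * real_of_int k)) * powr_ennreal (?b k) p \<partial>count_space UNIV)"
        by (rule nn_integral_cmult) simp
      also have "\<dots> \<le> ennreal ((2 * A) powr (p - 1)) * (ennreal c1 * I)"
        unfolding c1_def I_def using p by (intro mult_left_mono sum_level_le) auto
      also have "\<dots> = ennreal ((2 * A) powr (p - 1) * c1) * I"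
        using c by (simp add: ennreal_mult mult.assoc)
      also have "\<dots> \<le> ennreal c2 * I" using c by (intro mult_right_mono ennreal_leI) auto
      finally show ?thesis .
    qed
    have gI: "(\<integral>\<^sup>+x. powr_ennreal (G p ?f x) p \<partial>lebesgue) \<le> ennreal c2 * I"
    proof -
      have "1 * I \<le> ennreal c2 * I" using c by (intro mult_right_mono) (auto simp: ennreal_leI simp flip: ennreal_1)
      then show ?thesis by (simp add: I_def)
    qed
    let ?r = "\<lambda>x. powr_ennreal (\<integral>\<^sup>+k. ennreal (2 powr (\<alpha> * real_of_int k)) * H k x \<partial>count_space UNIV) q"
    have ON: "(\<integral>\<^sup>+x. powr_ennreal (W x) (\<Theta> * q / ?n) * ?r x \<partial>lebesgue)
        \<le> ennreal (ONeil_const ?n q \<Theta> (3 powr ?n)) * powr_ennreal (ennreal c2 * I) (q / p)"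
    proof (rule ONeil_dyadic[OF p _ \<Theta>(1,2,3) _ borel_measurable_G _ _ Ha gI a])
      show "ennreal t * emeasure lebesgue {x\<in>space lebesgue. ennreal t < W x} \<le> ennreal (3 powr ?n)" if "0 < t" for t
        unfolding W_def using N(1) N0 that by (intro weak_type_maximal_function) auto
    qed auto
    have "(\<integral>\<^sup>+x. powr_ennreal (e2ennreal \<bar>riesz_potential \<alpha> f x\<bar>) q *
        powr_ennreal (maximal_function g x) (\<Theta> * q / ?n) * ennreal (s x powr (q * (1 / p - 1))) \<partial>lebesgue)
      \<le> (\<integral>\<^sup>+x. ennreal (2 powr ((2 * ?n - \<alpha>) * q) * N powr \<delta>) * (powr_ennreal (W x) \<delta> * ?r x) \<partial>lebesgue)"
    proof (intro nn_integral_mono)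
      fix x
      let ?t = "\<integral>\<^sup>+k. ennreal (2 powr (\<alpha> * real_of_int k)) * T k x \<partial>count_space UNIV"
      have "e2ennreal \<bar>riesz_potential \<alpha> f x\<bar> \<le> ennreal (2 powr (2 * ?n - \<alpha>)) * ?t"
        unfolding T_def using \<alpha> by (intro riesz_potential_le) auto
      then have "powr_ennreal (e2ennreal \<bar>riesz_potential \<alpha> f x\<bar>) q \<le> powr_ennreal (ennreal (2 powr (2 * ?n - \<alpha>)) * ?t) q"
        using q by (intro powr_ennreal_mono) auto
      also have "\<dots> = ennreal (2 powr ((2 * ?n - \<alpha>) * q)) * powr_ennreal ?t q"
        using q by (simp add: powr_ennreal_mult powr_ennreal_two_powr)
      finally have 1: "powr_ennreal (e2ennreal \<bar>riesz_potential \<alpha> f x\<bar>) q \<le> ennreal (2 powr ((2 * ?n - \<alpha>) * q)) * powr_ennreal ?t q" .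
      have "(\<integral>\<^sup>+k. ennreal (2 powr (\<alpha> * real_of_int k)) * H k x \<partial>count_space UNIV) = ennreal (s x powr (1 / p - 1)) * ?t"
        unfolding H_def by (subst nn_integral_cmult[symmetric]) (auto intro!: nn_integral_cong simp: mult_ac)
      then have 2: "?r x = ennreal (s x powr (q * (1 / p - 1))) * powr_ennreal ?t q"
        using q s_pos[of x] by (simp add: powr_ennreal_mult powr_ennreal_pos powr_powr mult.commute)
      have 3: "powr_ennreal (maximal_function g x) (\<Theta> * q / ?n) = ennreal (N powr \<delta>) * powr_ennreal (W x) \<delta>"
        unfolding MW \<delta>_def[symmetric] using \<delta> N0 by (simp add: powr_ennreal_mult powr_ennreal_pos)
      have "powr_ennreal (e2ennreal \<bar>riesz_potential \<alpha> f x\<bar>) q *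
          powr_ennreal (maximal_function g x) (\<Theta> * q / ?n) * ennreal (s x powr (q * (1 / p - 1)))
        \<le> (ennreal (2 powr ((2 * ?n - \<alpha>) * q)) * powr_ennreal ?t q) * (ennreal (N powr \<delta>) * powr_ennreal (W x) \<delta>) * ennreal (s x powr (q * (1 / p - 1)))"
        unfolding 3 by (intro mult_right_mono 1) auto
      also have "\<dots> = (ennreal (2 powr ((2 * ?n - \<alpha>) * q)) * ennreal (N powr \<delta>)) * (powr_ennreal (W x) \<delta> * ?r x)"
        unfolding 2 by (simp only: mult_ac)
      also have "ennreal (2 powr ((2 * ?n - \<alpha>) * q)) * ennreal (N powr \<delta>) = ennreal (2 powr ((2 * ?n - \<alpha>) * q) * N powr \<delta>)"
        by (simp add: ennreal_mult)
      finally show "powr_ennreal (e2ennreal \<bar>riesz_potential \<alpha> f x\<bar>) q *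
          powr_ennreal (maximal_function g x) (\<Theta> * q / ?n) * ennreal (s x powr (q * (1 / p - 1)))
        \<le> ennreal (2 powr ((2 * ?n - \<alpha>) * q) * N powr \<delta>) * (powr_ennreal (W x) \<delta> * ?r x)" .
    qed
    also have "\<dots> \<le> ennreal (2 powr ((2 * ?n - \<alpha>) * q) * N powr \<delta>) *
        (ennreal (ONeil_const ?n q \<Theta> (3 powr ?n)) * powr_ennreal (ennreal c2 * I) (q / p))"
      unfolding \<delta>_def by (intro order_trans[OF nn_integral_cmult_le mult_left_mono[OF ON]]) (use N0 in auto)
    also have "\<dots> \<le> ennreal (2 powr ((2 * ?n - \<alpha>) * q) * N powr \<delta>) *
        (ennreal (ONeil_const ?n q \<Theta> (3 powr ?n)) * powr_ennreal (ennreal c2 * (ennreal c3 * \<Phi>)) (q / p))"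
      using q I by (intro mult_left_mono powr_ennreal_mono) auto
    also have "powr_ennreal (ennreal c2 * (ennreal c3 * \<Phi>)) (q / p) = ennreal ((c2 * c3) powr (q / p)) * powr_ennreal \<Phi> (q / p)"
    proof -
      have "ennreal c2 * (ennreal c3 * \<Phi>) = ennreal (c2 * c3) * \<Phi>"
        using c by (simp add: ennreal_mult mult.assoc)
      then show ?thesis using q c by (simp add: powr_ennreal_mult[of _ "ennreal (c2 * c3)"] powr_ennreal_pos)
    qed
    also have "ennreal (2 powr ((2 * ?n - \<alpha>) * q) * N powr \<delta>) *
        (ennreal (ONeil_const ?n q \<Theta> (3 powr ?n)) * (ennreal ((c2 * c3) powr (q / p)) * powr_ennreal \<Phi> (q / p))) =
      ennreal (operator_const ?n \<alpha> p q \<Theta> A) * ennreal (N powr \<delta>) * powr_ennreal \<Phi> (q / p)"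
      unfolding operator_const_def c1_def[symmetric] c2_def[symmetric] c3_def[symmetric]
      by (simp only: ennreal_mult''[OF powr_ge_zero] ennreal_mult'[OF powr_ge_zero] mult_ac)
    also have "ennreal (N powr \<delta>) = powr_ennreal (ennreal N) (\<Theta> * q / ?n)"
      using N0 by (simp add: powr_ennreal_pos \<delta>_def)
    finally show ?thesis unfolding N(1) \<Phi>_def .
  qed
qed

text \<open>Choosing \<open>C\<close> before \<open>v\<close> and \<open>g\<close>, as a function of
  two numbers, expresses that beyond the fixed parameters it depends on the weights only through
  their two characteristic constants.\<close>

theorem theorem5p2:
  fixes \<alpha> p q p' \<Theta> :: real
  assumes "0 < \<alpha>" and "\<alpha> < real CARD('n::finite)"
    and "1 < p" and "p \<le> q" and "1 / p + 1 / p' = 1"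
    and "\<Theta> = \<alpha> + real CARD('n) * (1 / q - 1 / p)"
    and "\<Theta> > 0" and "q < real CARD('n) / \<Theta>"
  shows "\<exists>C :: ennreal \<Rightarrow> ennreal \<Rightarrow> real. (\<forall>a b. 0 < C a b) \<and>
    (\<forall>(v :: real^'n \<Rightarrow> ennreal) (g :: real^'n \<Rightarrow> real).
      v \<in> RH_infinity \<longrightarrow> (\<lambda>x. powr_ennreal (v x) (- p' / p)) \<in> A_infinity \<longrightarrow>
      integrable lebesgue g \<longrightarrow>
      (let n = real CARD('n);
           \<sigma> = (\<lambda>x. powr_ennreal (v x) (- p' / p));
           u = (\<lambda>x. powr_ennreal (maximal_function g x) (\<Theta> * q / n) * powr_ennreal (v x) (q / p));
           B = ennreal (C (A_infinity_const \<sigma>) (RH_infinity_const v)) *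
                 powr_ennreal (\<integral>\<^sup>+x. ennreal \<bar>g x\<bar> \<partial>lebesgue) (\<Theta> / n)
       in (SUP Q\<in>cubes. powr_ennreal (emeasure lebesgue Q) (\<Theta> / n) *
             powr_ennreal (average Q u) (1 / q) * powr_ennreal (average Q \<sigma>) (1 / p')) \<le> B \<and>
          B < \<infinity> \<and>
          (\<forall>f :: real^'n \<Rightarrow> real. f \<in> borel_measurable lebesgue \<longrightarrow>
             powr_ennreal (\<integral>\<^sup>+x. powr_ennreal (e2ennreal \<bar>riesz_potential \<alpha> f x\<bar>) q *
               powr_ennreal (maximal_function g x) (\<Theta> * q / n) *
               powr_ennreal (v x) (q / p) \<partial>lebesgue) (1 / q)
             \<le> B * powr_ennreal (\<integral>\<^sup>+x. powr_ennreal (ennreal \<bar>f x\<bar>) p * v x \<partial>lebesgue) (1 / p))))"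
proof -
  let ?n = "real CARD('n)"
  define b where "b = p' / p"
  have q: "0 < q" "0 < p" using assms by auto
  have p'1: "1 / p' = 1 - 1 / p" using assms(5) by simp
  then have "0 < 1 / p'" using assms(3) by simp
  then have p': "0 < p'" by simp
  have b: "0 < b" using p' q by (simp add: b_def)
  have b1: "- (1 / b) = 1 - p"
  proof -
    have "1 / b = p * (1 / p')" by (simp add: b_def)
    also have "\<dots> = p - 1" unfolding p'1 using q by (simp add: field_simps)
    finally show ?thesis by simp
  qed
  have \<Theta>q: "\<Theta> * q < ?n" using assms(7,8) by (simp add: field_simps)
  \<comment> \<open>\<open>2 powr n\<close> is the loss of \<open>AE_all_cubes\<close>; adding
    \<open>1\<close> gives the strict positivity that \<open>A1_weight\<close> asks for.\<close>
  define A where "A x y = 2 powr ?n * A1_const b (enn2real x) (enn2real y) + 1" for x y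
  define C1 where "C1 x y = (1 + Kolmogorov_const (\<Theta> * q / ?n) * 3 powr ?n) powr (1 / q) * A x y powr (1 - 1 / p)" for x y
  define C2 where "C2 x y = operator_const ?n \<alpha> p q \<Theta> (A x y) powr (1 / q)" for x y
  \<comment> \<open>One constant for both estimates, with \<open>1\<close> added for strict
    positivity.\<close>
  define C where "C x y = C1 x y + C2 x y + 1" for x y
  have A1_nonneg: "0 \<le> A1_const b x y" for x y by (simp add: A1_const_def)
  have A: "0 < A x y" for x y using A1_nonneg by (simp add: A_def add_nonneg_pos)
  have C12: "0 \<le> C1 x y" "0 \<le> C2 x y" for x y by (simp_all add: C1_def C2_def)
  have C: "0 < C x y" "C1 x y \<le> C x y" "C2 x y \<le> C x y" for x y
    using C12[of x y] by (simp_all add: C_def)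
  show ?thesis
  proof (rule exI[of _ C], intro conjI allI impI)
    show "0 < C x y" for x y by (rule C)
    fix v :: "real^'n \<Rightarrow> ennreal" and g :: "real^'n \<Rightarrow> real"
    assume v: "v \<in> RH_infinity" and \<sigma>: "(\<lambda>x. powr_ennreal (v x) (- p' / p)) \<in> A_infinity" and g: "integrable lebesgue g"
    define \<sigma> where "\<sigma> = (\<lambda>x. powr_ennreal (v x) (- p' / p))"
    define u where "u = (\<lambda>x. powr_ennreal (maximal_function g x) (\<Theta> * q / ?n) * powr_ennreal (v x) (q / p))"
    define N where "N = (\<integral>\<^sup>+x. ennreal \<bar>g x\<bar> \<partial>lebesgue)"
    have N: "N < \<infinity>" using g by (simp add: N_def integrable_iff_bounded)
    have \<sigma>b: "\<sigma> = (\<lambda>x. powr_ennreal (v x) (- b))" by (simp add: \<sigma>_def b_def)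
    define c where "c = C (A_infinity_const \<sigma>) (RH_infinity_const v)"
    define a where "a = A (A_infinity_const \<sigma>) (RH_infinity_const v)"
    obtain s :: "real^'n \<Rightarrow> real" where s: "s \<in> borel_measurable lebesgue" "\<And>x. 0 < s x"
      "AE x in lebesgue. \<sigma> x = ennreal (s x)" "AE x in lebesgue. v x = ennreal (s x powr (1 - p))"
      "\<And>a l. 0 < l \<Longrightarrow> AE x in lebesgue. x \<in> cube a l \<longrightarrow> (\<integral>\<^sup>+y\<in>cube a l. ennreal (s y) \<partial>lebesgue) \<le>
        ennreal (A1_const b (enn2real (A_infinity_const \<sigma>)) (enn2real (RH_infinity_const v)) * s x) *
        emeasure lebesgue (cube a l)"
      using that unfolding \<sigma>b b1[symmetric]
      by (rule A1_of_RH_A_infinity[OF v \<sigma>[folded \<sigma>_def, unfolded \<sigma>b] b])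
    have "AE x in lebesgue. \<forall>a l. 0 < l \<longrightarrow> x \<in> cube a l \<longrightarrow> (\<integral>\<^sup>+y\<in>cube a l. ennreal (s y) \<partial>lebesgue) \<le>
        ennreal (2 powr ?n * A1_const b (enn2real (A_infinity_const \<sigma>)) (enn2real (RH_infinity_const v)) * s x) * emeasure lebesgue (cube a l)"
      using A1_nonneg s(2) _ s(5)
      by (rule AE_all_cubes[where S = "\<lambda>Q. \<integral>\<^sup>+y\<in>Q. ennreal (s y) \<partial>lebesgue"])
        (auto intro!: nn_integral_mono simp: indicator_def)
    then have "AE x in lebesgue. \<forall>c l. 0 < l \<longrightarrow> x \<in> cube c l \<longrightarrow> (\<integral>\<^sup>+y\<in>cube c l. ennreal (s y) \<partial>lebesgue) \<le>
        ennreal (a * s x) * emeasure lebesgue (cube c l)"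
    proof eventually_elim
      case (elim x)
      show ?case
      proof (intro allI impI)
        fix c l assume "0 < l" "x \<in> cube c l"
        with elim have "(\<integral>\<^sup>+y\<in>cube c l. ennreal (s y) \<partial>lebesgue) \<le>
          ennreal (2 powr ?n * A1_const b (enn2real (A_infinity_const \<sigma>)) (enn2real (RH_infinity_const v)) * s x) * emeasure lebesgue (cube c l)"
          by blast
        also have "\<dots> \<le> ennreal (a * s x) * emeasure lebesgue (cube c l)"
          unfolding a_def A_def using s(2)[of x] by (intro mult_right_mono ennreal_leI) auto
        finally show "(\<integral>\<^sup>+y\<in>cube c l. ennreal (s y) \<partial>lebesgue) \<le> ennreal (a * s x) * emeasure lebesgue (cube c l)" .
      qed
    qed
    then interpret A1_weight s a
      using s(1,2) A by unfold_locales (simp_all add: a_def)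
    have vq: "AE x in lebesgue. powr_ennreal (v x) (q / p) = ennreal (s x powr (q * (1 / p - 1)))"
      using s(4)
    proof eventually_elim
      case (elim x)
      have "(1 - p) * (q / p) = q * (1 / p - 1)" using q by (simp add: field_simps)
      moreover have "powr_ennreal (v x) (q / p) = ennreal ((s x powr (1 - p)) powr (q / p))"
        unfolding elim using s(2)[of x] by (intro powr_ennreal_pos) simp
      ultimately show ?case by (simp only: powr_powr)
    qed
    define B where "B = ennreal c * powr_ennreal N (\<Theta> / ?n)"
    have "(SUP Q\<in>cubes. powr_ennreal (emeasure lebesgue Q) (\<Theta> / ?n) *
        powr_ennreal (average Q u) (1 / q) * powr_ennreal (average Q \<sigma>) (1 / p')) \<le> B"
    proof (rule SUP_least)
      fix Q :: "(real^'n) set" assume "Q \<in> cubes"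
      then obtain d l where Q: "Q = cube d l" "0 < l" by (auto simp: cubes_eq)
      have "average Q u = average Q (\<lambda>x. powr_ennreal (maximal_function g x) (\<Theta> * q / ?n) * ennreal (s x powr (q * (1 / p - 1))))"
        unfolding average_def using vq
        by (intro arg_cong2[where f = "(/)"] refl nn_integral_cong_AE) (auto simp: u_def)
      moreover have "average Q \<sigma> = average Q (\<lambda>x. ennreal (s x))"
        unfolding average_def using s(3) by (intro arg_cong2[where f = "(/)"] refl nn_integral_cong_AE) auto
      ultimately have "powr_ennreal (emeasure lebesgue Q) (\<Theta> / ?n) *
          powr_ennreal (average Q u) (1 / q) * powr_ennreal (average Q \<sigma>) (1 / p')
        \<le> ennreal (C1 (A_infinity_const \<sigma>) (RH_infinity_const v)) * powr_ennreal N (\<Theta> / ?n)"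
        unfolding p'1 Q(1) C1_def N_def a_def[symmetric]
        using testing_condition[OF assms(3,4,7) \<Theta>q g Q(2)] by simp
      also have "\<dots> \<le> B"
        unfolding B_def c_def by (intro mult_right_mono ennreal_leI C) auto
      finally show "powr_ennreal (emeasure lebesgue Q) (\<Theta> / ?n) *
          powr_ennreal (average Q u) (1 / q) * powr_ennreal (average Q \<sigma>) (1 / p') \<le> B" .
    qed
    moreover have "B < \<infinity>"
      using N assms(7) powr_ennreal_less_top[of "\<Theta> / ?n" N] by (simp add: B_def ennreal_mult_less_top)
    moreover have "powr_ennreal (\<integral>\<^sup>+x. powr_ennreal (e2ennreal \<bar>riesz_potential \<alpha> f x\<bar>) q *
        powr_ennreal (maximal_function g x) (\<Theta> * q / ?n) * powr_ennreal (v x) (q / p) \<partial>lebesgue) (1 / q)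
      \<le> B * powr_ennreal (\<integral>\<^sup>+x. powr_ennreal (ennreal \<bar>f x\<bar>) p * v x \<partial>lebesgue) (1 / p)"
      if f: "f \<in> borel_measurable lebesgue" for f :: "real^'n \<Rightarrow> real"
    proof -
      define \<Phi> where "\<Phi> = (\<integral>\<^sup>+x. powr_ennreal (ennreal \<bar>f x\<bar>) p * v x \<partial>lebesgue)"
      have \<Phi>: "\<Phi> = (\<integral>\<^sup>+x. powr_ennreal (ennreal \<bar>f x\<bar>) p * ennreal (s x powr (1 - p)) \<partial>lebesgue)"
        unfolding \<Phi>_def using s(4) by (intro nn_integral_cong_AE) auto
      let ?K = "operator_const ?n \<alpha> p q \<Theta> a"
      have "(\<integral>\<^sup>+x. powr_ennreal (e2ennreal \<bar>riesz_potential \<alpha> f x\<bar>) q *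
          powr_ennreal (maximal_function g x) (\<Theta> * q / ?n) * powr_ennreal (v x) (q / p) \<partial>lebesgue)
        = (\<integral>\<^sup>+x. powr_ennreal (e2ennreal \<bar>riesz_potential \<alpha> f x\<bar>) q *
          powr_ennreal (maximal_function g x) (\<Theta> * q / ?n) * ennreal (s x powr (q * (1 / p - 1))) \<partial>lebesgue)"
        using vq by (intro nn_integral_cong_AE) auto
      also have "\<dots> \<le> ennreal ?K * powr_ennreal N (\<Theta> * q / ?n) * powr_ennreal \<Phi> (q / p)"
        unfolding \<Phi> N_def by (rule weighted_riesz_bound[OF assms(2,3,4,6,7) \<Theta>q g f])
      finally have "powr_ennreal (\<integral>\<^sup>+x. powr_ennreal (e2ennreal \<bar>riesz_potential \<alpha> f x\<bar>) q *
          powr_ennreal (maximal_function g x) (\<Theta> * q / ?n) * powr_ennreal (v x) (q / p) \<partial>lebesgue) (1 / q)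
        \<le> powr_ennreal (ennreal ?K * powr_ennreal N (\<Theta> * q / ?n) * powr_ennreal \<Phi> (q / p)) (1 / q)"
        using q by (intro powr_ennreal_mono) auto
      also have "\<dots> = powr_ennreal (ennreal ?K) (1 / q) * powr_ennreal N (\<Theta> / ?n) * powr_ennreal \<Phi> (1 / p)"
        using q assms(7) by (simp add: powr_ennreal_mult powr_ennreal_powr)
      \<comment> \<open>The sign of \<open>?K\<close> is not established; for a negative value
        \<open>ennreal ?K\<close> is \<open>0\<close> and the inequality is trivial.\<close>
      also have "powr_ennreal (ennreal ?K) (1 / q) \<le> ennreal (?K powr (1 / q))"
        using q by (cases "0 \<le> ?K") (simp_all add: powr_ennreal_nonneg ennreal_neg)
      also have "ennreal (?K powr (1 / q)) \<le> ennreal c"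
        unfolding c_def a_def using C(3) by (simp add: C2_def ennreal_leI)
      finally show ?thesis unfolding B_def \<Phi>_def by (simp add: mult_right_mono)
    qed
    ultimately show "let n = ?n;
           \<sigma> = (\<lambda>x. powr_ennreal (v x) (- p' / p));
           u = (\<lambda>x. powr_ennreal (maximal_function g x) (\<Theta> * q / n) * powr_ennreal (v x) (q / p));
           B = ennreal (C (A_infinity_const \<sigma>) (RH_infinity_const v)) *
                 powr_ennreal (\<integral>\<^sup>+x. ennreal \<bar>g x\<bar> \<partial>lebesgue) (\<Theta> / n)
       in (SUP Q\<in>cubes. powr_ennreal (emeasure lebesgue Q) (\<Theta> / n) *
             powr_ennreal (average Q u) (1 / q) * powr_ennreal (average Q \<sigma>) (1 / p')) \<le> B \<and>
          B < \<infinity> \<and>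
          (\<forall>f :: real^'n \<Rightarrow> real. f \<in> borel_measurable lebesgue \<longrightarrow>
             powr_ennreal (\<integral>\<^sup>+x. powr_ennreal (e2ennreal \<bar>riesz_potential \<alpha> f x\<bar>) q *
               powr_ennreal (maximal_function g x) (\<Theta> * q / n) *
               powr_ennreal (v x) (q / p) \<partial>lebesgue) (1 / q)
             \<le> B * powr_ennreal (\<integral>\<^sup>+x. powr_ennreal (ennreal \<bar>f x\<bar>) p * v x \<partial>lebesgue) (1 / p))"
      unfolding Let_def B_def c_def N_def \<sigma>_def u_def by blast
  qed
qed

end
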